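(* Set $\mathcal{A}= \mathbb{C}\langle X_1,\ldots,X_k,Y_1,\ldots,Y_{\ell}\rangle$, $\mathcal{A}_1=\mathbb{C}\langle X_1,\ldots,X_k\rangle$ and $\mathcal{A}_2=\mathbb{C}\langle Y_1,\ldots,Y_{\ell}\rangle$. Let $(\mathbf{A}_N)_{N\geq 1}$ and $(\mathbf{B}_N)_{N\geq 1}$ be two deterministic sequences of $k$-tuples and $\ell$-tuples of $N\times N$ complex matrices, and $(v_N)_{N\geq 1}$ a sequence of unit vectors of $\mathbb{C}^N$. Assume there are maps $\tau:\mathcal{A}_1\cup\mathcal{A}_2\to\mathbb{C}$ and $\varphi:\mathcal{A}_1\to\mathbb{C}$ such that for all $P\in \mathcal{A}_1$, $\tau_{\mathbf{A}_N}(P)=\tau(P)+o(1)$ and $\tau_{\mathbf{A}_N}^{v_N}(P)=\varphi(P)+o(1)$, and for all $P\in \mathcal{A}_2$, $\tau_{\mathbf{B}_N}(P)=\tau(P)+o(1)$. Let $(U_N)_{N\geq 1}$ be a sequence of Haar distributed unitary random matrices of size $N$. Then $\tau$ and $\varphi$ extend to linear functionals on $\mathcal{A}$ such that, for all $P\in\mathcal{A}$, $\mathbb{E}[ \tau_{\mathbf{A}_N, U_N\mathbf{B}_NU_N^*}(P)]=\tau(P)+o(1)$ and $\mathbb{E}[ \tau^{v_N}_{\mathbf{A}_N, U_N\mathbf{B}_NU_N^*}(P)]=\varphi(P)+o(1)$; moreover $\mathcal{A}_1$ and $\mathcal{A}_2$ are conditionally free with respect to $(\tau,\varphi)$, and $\varphi|_{\mathcal{A}_2}=\tau|_{\mathcal{A}_2}$.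 Furthermore, if all matrices of $\mathbf{A}_N$ and $\mathbf{B}_N$ are self-adjoint, then for all $P\in \mathcal{A}$, $\tau_{\mathbf{A}_N, U_N\mathbf{B}_NU_N^*}(P)=\tau(P)+o(1)$ almost surely and $\tau_{\mathbf{A}_N, U_N\mathbf{B}_NU_N^*}^{v_N}(P)=\varphi(P)+o(1)$ almost surely.
   Context: $\operatorname{tr}_N=\frac1N\operatorname{Tr}$; $\tau_{\mathbf{A}_N}(P)=\operatorname{tr}_N(P(\mathbf{A}_N))$ and $\tau^{v_N}_{\mathbf{A}_N}(P)=\langle P(\mathbf{A}_N)v_N,v_N\rangle$; joint versions are $\tau_{\mathbf{A}_N,U_N\mathbf{B}_NU_N^*}(P)=\operatorname{tr}_N(P(\mathbf{A}_N,U_N\mathbf{B}_NU_N^* ))$ and $\tau^{v_N}_{\mathbf{A}_N,U_N\mathbf{B}_NU_N^*}(P)=\langle P(\mathbf{A}_N,U_N\mathbf{B}_NU_N^* )v_N,v_N\rangle$, where $U_N\mathbf{B}_NU_N^*=(U_NB_N^{(1)}U_N^*,\dots,U_NB_N^{(\ell)}U_N^* )$. Unital subalgebras $\mathcal{A}_1,\mathcal{A}_2$ are conditionally free w.r.t. $(\tau,\varphi)$ if whenever $n>1$, $a_j\in\mathcal{A}_{i_j}$ with consecutive indices different and $\tau(a_j)=0$ for all $j$, one has $\tau(a_1\cdots a_n)=0$ and $\varphi(a_1\cdots a_n)=\varphi(a_1)\cdots\varphi(a_n)$. *)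

theory Defs
  imports "HOL-Probability.Probability" "HOL-Analysis.Function_Topology"
begin

text \<open>N x N complex matrices are functions nat => nat => complex, only entries with
  indices below N are relevant.  Vectors of C^N are functions nat => complex.\<close>

type_synonym cmat = "nat \<Rightarrow> nat \<Rightarrow> complex"
type_synonym cvec = "nat \<Rightarrow> complex"

definition mmult :: "nat \<Rightarrow> cmat \<Rightarrow> cmat \<Rightarrow> cmat" where
  "mmult N A B = (\<lambda>i j. if i < N \<and> j < N then (\<Sum>k<N. A i k * B k j) else 0)"

definition idm :: "nat \<Rightarrow> cmat" where
  "idm N = (\<lambda>i j. if i = j \<and> i < N then 1 else 0)"

definition adj :: "cmat \<Rightarrow> cmat" where
  "adj A = (\<lambda>i j. cnj (A j i))"

definition unitary_mat :: "nat \<Rightarrow> cmat \<Rightarrow> bool" where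
  "unitary_mat N U \<longleftrightarrow> (\<forall>i j. \<not> (i < N \<and> j < N) \<longrightarrow> U i j = 0) \<and> mmult N U (adj U) = idm N"

definition selfadj_mat :: "nat \<Rightarrow> cmat \<Rightarrow> bool" where
  "selfadj_mat N A \<longleftrightarrow> (\<forall>i<N. \<forall>j<N. A i j = cnj (A j i))"

definition unit_vec :: "nat \<Rightarrow> cvec \<Rightarrow> bool" where
  "unit_vec N v \<longleftrightarrow> (\<Sum>i<N. (cmod (v i))\<^sup>2) = 1"

definition ntr :: "nat \<Rightarrow> cmat \<Rightarrow> complex" where
  "ntr N M = (\<Sum>i<N. M i i) / of_nat N"

definition vstate :: "nat \<Rightarrow> cvec \<Rightarrow> cmat \<Rightarrow> complex" where
  "vstate N v M = (\<Sum>i<N. (\<Sum>j<N. M i j * v j) * cnj (v i))"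

text \<open>Haar distributed unitary random matrix of size N on the probability space M:
  a random variable with values (almost surely) in U(N) whose law is invariant under
  left multiplication by every fixed unitary (this characterizes Haar measure).\<close>
definition haar_unitary :: "'w measure \<Rightarrow> nat \<Rightarrow> ('w \<Rightarrow> cmat) \<Rightarrow> bool" where
  "haar_unitary M N U \<longleftrightarrow>
     U \<in> M \<rightarrow>\<^sub>M borel \<and> (AE \<omega> in M. unitary_mat N (U \<omega>)) \<and>
     (\<forall>V. unitary_mat N V \<longrightarrow> distr M borel (\<lambda>\<omega>. mmult N V (U \<omega>)) = distr M borel U)"

text \<open>Noncommutative polynomials: variables Inl i = X_(i+1), Inr j = Y_(j+1);
  a polynomial is a finitely supported function from words (monomials) to C.\<close>
type_synonym var = "nat + nat"
type_synonym ncpoly = "var list \<Rightarrow> complex"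

definition ncpolys :: "var set \<Rightarrow> ncpoly set" where
  "ncpolys V = {p. finite {w. p w \<noteq> 0} \<and> (\<forall>w. p w \<noteq> 0 \<longrightarrow> set w \<subseteq> V)}"

definition Xvars :: "nat \<Rightarrow> var set" where "Xvars k = Inl ` {..<k}"
definition Yvars :: "nat \<Rightarrow> var set" where "Yvars l = Inr ` {..<l}"

definition ncmult :: "ncpoly \<Rightarrow> ncpoly \<Rightarrow> ncpoly" where
  "ncmult p q = (\<lambda>w. \<Sum>i\<le>length w. p (take i w) * q (drop i w))"

definition ncone :: ncpoly where "ncone = (\<lambda>w. if w = [] then 1 else 0)"

definition ncprod :: "ncpoly list \<Rightarrow> ncpoly" where
  "ncprod ps = foldr ncmult ps ncone"

definition mono_eval :: "nat \<Rightarrow> (var \<Rightarrow> cmat) \<Rightarrow> var list \<Rightarrow> cmat" where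
  "mono_eval N X w = foldr (\<lambda>x M. mmult N (X x) M) w (idm N)"

definition poly_eval :: "nat \<Rightarrow> (var \<Rightarrow> cmat) \<Rightarrow> ncpoly \<Rightarrow> cmat" where
  "poly_eval N X p = (\<lambda>i j. \<Sum>w\<in>{w. p w \<noteq> 0}. p w * mono_eval N X w i j)"

definition lin_on :: "ncpoly set \<Rightarrow> (ncpoly \<Rightarrow> complex) \<Rightarrow> bool" where
  "lin_on S f \<longleftrightarrow> (\<forall>p\<in>S. \<forall>q\<in>S. f (\<lambda>w. p w + q w) = f p + f q) \<and> (\<forall>c. \<forall>p\<in>S. f (\<lambda>w. c * p w) = c * f p)"

definition cond_free :: "ncpoly set \<Rightarrow> ncpoly set \<Rightarrow> (ncpoly \<Rightarrow> complex) \<Rightarrow> (ncpoly \<Rightarrow> complex) \<Rightarrow> bool" where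
  "cond_free A1 A2 \<tau> \<phi> \<longleftrightarrow>
    (\<forall>as :: (ncpoly \<times> bool) list. length as > 1 \<longrightarrow>
       (\<forall>i. Suc i < length as \<longrightarrow> snd (as ! i) \<noteq> snd (as ! Suc i)) \<longrightarrow>
       (\<forall>(a, s)\<in>set as. a \<in> (if s then A1 else A2) \<and> \<tau> a = 0) \<longrightarrow>
       \<tau> (ncprod (map fst as)) = 0 \<and>
       \<phi> (ncprod (map fst as)) = (\<Prod>a\<leftarrow>map fst as. \<phi> a))"

end

theory Submission
  imports Defs
begin

text \<open>Left invariance of Haar measure under \<open>U \<mapsto> V U\<close>, differentiated at \<open>V = I\<close>, gives a Schwinger--Dyson equation: the
  expectation of a product of normalized traces of words in \<open>A\<close> and \<open>U B U\<^sup>*\<close> is a sum of expectations in which one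
  word is split into two shorter ones, plus \<open>N\<^sup>-\<^sup>2\<close> times terms in which two words are merged. Only traces of words in
  \<open>A\<close> alone or in \<open>B\<close> alone remain at the end, so no bound on operator norms is needed. The vector state is
  the trace against the additional letter \<open>N v v\<^sup>*\<close>, which may occur at most once per word.

  The equation shows that all these moments are bounded, that products of \<open>s\<close> centered traces have expectation
  \<open>O(N\<^sup>-\<^sup>s\<^sup>/\<^sup>2)\<close>, and that expectations converge to a functional satisfying the equation without the merging terms.
  For that functional, alternating products of centered elements vanish even against one extra factor in \<open>A\<close> and
  the marked letter, which is freeness and conditional freeness at once. For self-adjoint matrices the complex
  conjugate of a trace is the trace of the reversed word, so fourth centered moments are \<open>O(N\<^sup>-\<^sup>2)\<close>,
  hence summable, and convergence is almost sure.\<close>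

subsection \<open>Matrices and words\<close>

text \<open>The obstacle is the marked matrix: its norm grows with N, and a merging can put two
  marks into one word. Such a word factors at the price of N, so that only 1/N survives of the
  factor N^-2. This is why errors are measured in 1/N and a centered trace is worth only 1/sqrt N
  instead of the 1/N usual for Haar unitaries; fourth moments are the first even ones with a
  summable rate. Complex linearity then gives all directions, in particular the matrix units, which
  turn matrix entries into traces. To use the equation as a recursion, a mixed word is rotated so
  that it begins with a \<open>Y\<close>-letter and ends with an \<open>X\<close>-letter. Then
  splitting off the empty word reproduces the word itself with coefficient 1, and all other
  splittings give strictly shorter words.\<close>

definition msupp :: "nat \<Rightarrow> cmat \<Rightarrow> bool" where
  "msupp N A \<longleftrightarrow> (\<forall>i j. \<not> (i < N \<and> j < N) \<longrightarrow> A i j = 0)"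

lemma msupp_mmult [simp]: "msupp N (mmult N A B)"
  by (auto simp: msupp_def mmult_def)

lemma msupp_idm [simp]: "msupp N (idm N)"
  by (auto simp: msupp_def idm_def)

lemma mmult_assoc: "mmult N (mmult N A B) C = mmult N A (mmult N B C)"
proof (intro ext)
  fix i j
  have "(\<Sum>k<N. (\<Sum>m<N. A i m * B m k) * C k j) = (\<Sum>m<N. A i m * (\<Sum>k<N. B m k * C k j))"
    unfolding sum_distrib_left sum_distrib_right by (subst sum.swap) (simp add: mult.assoc)
  then show "mmult N (mmult N A B) C i j = mmult N A (mmult N B C) i j"
    by (simp add: mmult_def)
qed

lemma mmult_idm_left [simp]: "msupp N A \<Longrightarrow> mmult N (idm N) A = A"
proof (intro ext)
  fix i j assume "msupp N A"
  have "(\<Sum>k<N. idm N i k * A k j) = (\<Sum>k<N. if k = i then A k j else 0)"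
    by (rule sum.cong) (auto simp: idm_def)
  then show "mmult N (idm N) A i j = A i j"
    using \<open>msupp N A\<close> by (auto simp: mmult_def msupp_def)
qed

lemma mmult_idm_right [simp]: "msupp N A \<Longrightarrow> mmult N A (idm N) = A"
proof (intro ext)
  fix i j assume "msupp N A"
  have "(\<Sum>k<N. A i k * idm N k j) = (\<Sum>k<N. if k = j then A i k else 0)"
    by (rule sum.cong) (auto simp: idm_def)
  then show "mmult N A (idm N) i j = A i j"
    using \<open>msupp N A\<close> by (auto simp: mmult_def msupp_def)
qed

text \<open>\<open>mmult\<close> reads only entries of its factors with indices below
  \<open>N\<close>, so inside a product the unit law needs no support condition.\<close>

lemma mmult_trunc_middle [simp]: "mmult N A (mmult N (idm N) B) = mmult N A B"
proof -
  have "mmult N (idm N) B k j = B k j" if "k < N" "j < N" for k j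
  proof -
    have "(\<Sum>m<N. idm N k m * B m j) = (\<Sum>m<N. if m = k then B m j else 0)"
      by (rule sum.cong) (auto simp: idm_def)
    then show ?thesis using that by (simp add: mmult_def)
  qed
  then show ?thesis
    by (simp add: mmult_def[of N A] fun_eq_iff)
qed

lemma mmult_add_left: "mmult N (\<lambda>i j. A i j + B i j) C = (\<lambda>i j. mmult N A C i j + mmult N B C i j)"
  by (simp add: mmult_def fun_eq_iff sum.distrib ring_distribs)

lemma mmult_add_right: "mmult N C (\<lambda>i j. A i j + B i j) = (\<lambda>i j. mmult N C A i j + mmult N C B i j)"
  by (simp add: mmult_def fun_eq_iff sum.distrib ring_distribs)

lemma mmult_diff_left: "mmult N (\<lambda>i j. A i j - B i j) C = (\<lambda>i j. mmult N A C i j - mmult N B C i j)"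
  by (simp add: mmult_def fun_eq_iff sum_subtractf ring_distribs)

lemma mmult_diff_right: "mmult N C (\<lambda>i j. A i j - B i j) = (\<lambda>i j. mmult N C A i j - mmult N C B i j)"
  by (simp add: mmult_def fun_eq_iff sum_subtractf ring_distribs)

lemma mmult_scale_left: "mmult N (\<lambda>i j. c * A i j) B = (\<lambda>i j. c * mmult N A B i j)"
  by (simp add: mmult_def fun_eq_iff sum_distrib_left mult_ac)

lemma mmult_scale_right: "mmult N A (\<lambda>i j. c * B i j) = (\<lambda>i j. c * mmult N A B i j)"
  by (simp add: mmult_def fun_eq_iff sum_distrib_left mult_ac)

lemma mmult_zero_left [simp]: "mmult N (\<lambda>i j. 0) A = (\<lambda>i j. 0)"
  by (simp add: mmult_def fun_eq_iff)

lemma mmult_zero_right [simp]: "mmult N A (\<lambda>i j. 0) = (\<lambda>i j. 0)"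
  by (simp add: mmult_def fun_eq_iff)

lemma adj_mmult: "adj (mmult N A B) = mmult N (adj B) (adj A)"
  by (auto simp: adj_def mmult_def fun_eq_iff mult.commute)

lemma adj_adj [simp]: "adj (adj A) = A"
  by (simp add: adj_def)

lemma adj_idm [simp]: "adj (idm N) = idm N"
  by (auto simp: adj_def idm_def fun_eq_iff)

lemma msupp_adj [simp]: "msupp N (adj A) \<longleftrightarrow> msupp N A"
  by (auto simp: msupp_def adj_def)

lemma ntr_mmult_commute: "ntr N (mmult N A B) = ntr N (mmult N B A)"
proof -
  have "(\<Sum>i<N. \<Sum>k<N. A i k * B k i) = (\<Sum>k<N. \<Sum>i<N. B k i * A i k)"
    by (subst sum.swap) (simp add: mult.commute)
  then show ?thesis by (simp add: ntr_def mmult_def)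
qed

lemma ntr_adj: "ntr N (adj A) = cnj (ntr N A)"
  by (simp add: ntr_def adj_def)

lemma mono_eval_Nil [simp]: "mono_eval N X [] = idm N"
  by (simp add: mono_eval_def)

lemma mono_eval_Cons: "mono_eval N X (x # w) = mmult N (X x) (mono_eval N X w)"
  by (simp add: mono_eval_def)

lemma msupp_mono_eval [simp]: "msupp N (mono_eval N X w)"
  by (cases w) (auto simp: mono_eval_Cons)

lemma mono_eval_append: "mono_eval N X (u @ w) = mmult N (mono_eval N X u) (mono_eval N X w)"
  by (induction u) (auto simp: mono_eval_Cons mmult_assoc)

lemma mono_eval_cong: "(\<And>x. x \<in> set w \<Longrightarrow> X x = X' x) \<Longrightarrow> mono_eval N X w = mono_eval N X' w"
  by (induction w) (auto simp: mono_eval_Cons)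

lemma ntr_mono_eval_rotate: "ntr N (mono_eval N X (u @ w)) = ntr N (mono_eval N X (w @ u))"
  by (simp add: mono_eval_append ntr_mmult_commute)

text \<open>A one-sided inverse suffices: the defect \<open>I - U\<^sup>* U\<close> is a self-adjoint idempotent of trace zero.\<close>

lemma unitary_mat_left:
  assumes "unitary_mat N U"
  shows "mmult N (adj U) U = idm N"
proof -
  have supp: "msupp N U" and UU: "mmult N U (adj U) = idm N"
    using assms by (auto simp: unitary_mat_def msupp_def)
  define H where "H = (\<lambda>i j. idm N i j - mmult N (adj U) U i j)"
  have idem: "mmult N (mmult N (adj U) U) (mmult N (adj U) U) = mmult N (adj U) U"
    by (metis UU mmult_assoc mmult_idm_left supp)
  have HH: "mmult N H H = H"
    unfolding H_def mmult_diff_left mmult_diff_right idem by simp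
  have Hadj: "adj H = H"
    by (auto simp: H_def adj_def idm_def mmult_def fun_eq_iff mult.commute)
  have "(\<Sum>i<N. H i i) = (\<Sum>i<N. idm N i i) - (\<Sum>i<N. mmult N (adj U) U i i)"
    by (simp add: H_def sum_subtractf)
  also have "(\<Sum>i<N. mmult N (adj U) U i i) = (\<Sum>i<N. mmult N U (adj U) i i)"
    unfolding mmult_def by simp (subst sum.swap, simp add: mult.commute)
  finally have tr0: "(\<Sum>i<N. H i i) = 0" by (simp add: UU)
  \<comment> \<open>Since H equals H times its adjoint, its trace is also its squared
    Hilbert-Schmidt norm.\<close>
  have "(\<Sum>i<N. H i i) = (\<Sum>i<N. mmult N H (adj H) i i)"
    by (simp add: Hadj HH)
  also have "\<dots> = (\<Sum>i<N. \<Sum>k<N. of_real ((cmod (H i k))\<^sup>2))"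
    by (intro sum.cong refl) (simp add: mmult_def adj_def complex_norm_square del: of_real_power)
  finally have "(\<Sum>i<N. \<Sum>k<N. (cmod (H i k))\<^sup>2) = 0"
    unfolding tr0 by (metis (mono_tags, lifting) of_real_eq_0_iff of_real_sum sum.cong)
  then have "\<And>i k. i < N \<Longrightarrow> k < N \<Longrightarrow> H i k = 0"
    by (subst (asm) sum_nonneg_eq_0_iff) (auto intro: sum_nonneg simp: sum_nonneg_eq_0_iff)
  then show ?thesis
    by (fastforce simp: H_def fun_eq_iff mmult_def idm_def)
qed

text \<open>The rows of a unitary matrix are unit vectors. From this bound all functions of
  \<open>U\<close> below inherit boundedness, hence integrability.\<close>

lemma unitary_mat_entry_le:
  assumes "unitary_mat N U"
  shows "cmod (U i j) \<le> 1"
proof (cases "i < N \<and> j < N")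
  case True
  have "mmult N U (adj U) i i = 1"
    using assms True by (simp add: unitary_mat_def idm_def)
  then have "(\<Sum>k<N. of_real ((cmod (U i k))\<^sup>2)) = (1::complex)"
    using True by (simp add: mmult_def adj_def complex_norm_square del: of_real_power)
  then have *: "(\<Sum>k<N. (cmod (U i k))\<^sup>2) = 1"
    by (metis of_real_eq_1_iff of_real_sum)
  have "(cmod (U i j))\<^sup>2 \<le> (\<Sum>k<N. (cmod (U i k))\<^sup>2)"
    using True by (intro member_le_sum) auto
  then show ?thesis
    using * by (simp add: power_le_one_iff)
next
  case False
  then show ?thesis using assms by (auto simp: unitary_mat_def)
qed

section \<open>Words in the matrices and their derivatives\<close>

definition letters :: "nat \<Rightarrow> (nat \<Rightarrow> cmat) \<Rightarrow> (nat \<Rightarrow> cmat) \<Rightarrow> cmat \<Rightarrow> var \<Rightarrow> cmat" where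
  "letters N A B u = (\<lambda>x. case x of Inl i \<Rightarrow> A i | Inr j \<Rightarrow> mmult N (mmult N u (B j)) (adj u))"

lemma letters_Inl [simp]: "letters N A B u (Inl i) = A i"
  and letters_Inr: "letters N A B u (Inr j) = mmult N (mmult N u (B j)) (adj u)"
  by (simp_all add: letters_def)

lemma letters_mmult:
  "letters N A B (mmult N V u) (Inr j) = mmult N V (mmult N (letters N A B u (Inr j)) (adj V))"
  by (simp add: letters_Inr adj_mmult mmult_assoc)

text \<open>Conjugating \<open>U\<close> moves exactly the \<open>Y\<close>-letters \<open>Inr j\<close>, so the Leibniz rule for a word \<open>w\<close> has one
  term per element of \<open>splits [] w\<close>; \<open>picks\<close> plays the same role for a product of traces.\<close>

fun splits :: "var list \<Rightarrow> var list \<Rightarrow> (var list \<times> var \<times> var list) list" where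
  "splits p [] = []"
| "splits p (x # w) = (if isl x then [] else [(p, x, w)]) @ splits (p @ [x]) w"

fun picks :: "'a list \<Rightarrow> ('a \<times> 'a list) list" where
  "picks [] = []"
| "picks (q # Q) = (q, Q) # map (\<lambda>(r, R). (r, q # R)) (picks Q)"

text \<open>The length bound later keeps the left factor nonempty when the splitting starts behind a
  first letter.\<close>

lemma splits_append_eq: "(a, d, b) \<in> set (splits p w) \<Longrightarrow> a @ d # b = p @ w \<and> \<not> isl d \<and> length p \<le> length a"
  by (induction p w rule: splits.induct) (auto split: if_splits)

text \<open>The derivative at s = 0 of conjugation by exp(s X): a commutator on the conjugated
  letters, zero on the others.\<close>

fun dletter :: "nat \<Rightarrow> (var \<Rightarrow> cmat) \<Rightarrow> cmat \<Rightarrow> var \<Rightarrow> cmat" where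
  "dletter N Z X (Inl i) = (\<lambda>i j. 0)"
| "dletter N Z X (Inr j) = (\<lambda>a b. mmult N X (Z (Inr j)) a b - mmult N (Z (Inr j)) X a b)"

fun dword :: "nat \<Rightarrow> (var \<Rightarrow> cmat) \<Rightarrow> cmat \<Rightarrow> var list \<Rightarrow> cmat" where
  "dword N Z X [] = (\<lambda>i j. 0)"
| "dword N Z X (x # w) = (\<lambda>i j. mmult N (dletter N Z X x) (mono_eval N Z w) i j
      + mmult N (Z x) (dword N Z X w) i j)"

lemma msupp_dword: "msupp N (dword N Z X w)"
  by (cases w) (auto simp: msupp_def mmult_def)

lemma mono_eval_snoc_mmult:
  "mmult N (mono_eval N Z (p @ [x])) M = mmult N (mono_eval N Z p) (mmult N (Z x) M)"
  by (simp add: mono_eval_append mono_eval_Cons mmult_assoc)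

text \<open>Each \<open>Y\<close>-letter contributes X inserted before it minus X inserted after it.
  The accumulated prefix is carried along to make the induction on \<open>w\<close> work.\<close>

lemma mmult_mono_eval_dword:
  "mmult N (mono_eval N Z p) (dword N Z X w) i j =
    (\<Sum>(a, d, b)\<leftarrow>splits p w. mmult N (mmult N (mono_eval N Z a) X) (mono_eval N Z (d # b)) i j
       - mmult N (mmult N (mono_eval N Z (a @ [d])) X) (mono_eval N Z b) i j)"
proof (induction w arbitrary: p)
  case (Cons x w)
  have "mmult N (mono_eval N Z p) (dword N Z X (x # w)) i j
     = mmult N (mono_eval N Z p) (mmult N (dletter N Z X x) (mono_eval N Z w)) i j
     + mmult N (mono_eval N Z (p @ [x])) (dword N Z X w) i j"
    by (simp add: mmult_add_right mono_eval_snoc_mmult)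
  moreover have "mmult N (mono_eval N Z p) (mmult N (dletter N Z X x) (mono_eval N Z w)) i j =
     (\<Sum>(a, d, b)\<leftarrow>(if isl x then [] else [(p, x, w)]). mmult N (mmult N (mono_eval N Z a) X) (mono_eval N Z (d # b)) i j
       - mmult N (mmult N (mono_eval N Z (a @ [d])) X) (mono_eval N Z b) i j)"
    by (cases x) (auto simp: mmult_diff_left mmult_diff_right mono_eval_Cons mono_eval_snoc_mmult mmult_assoc)
  ultimately show ?case using Cons by simp
qed simp

lemma dword_eq:
  "dword N Z X w i j =
    (\<Sum>(a, d, b)\<leftarrow>splits [] w. mmult N (mmult N (mono_eval N Z a) X) (mono_eval N Z (d # b)) i j
       - mmult N (mmult N (mono_eval N Z (a @ [d])) X) (mono_eval N Z b) i j)"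
  using mmult_mono_eval_dword[of N Z "[]" X w i j] by (simp add: msupp_dword)

section \<open>Bounded measurable functions on the unitary group and first-order expansions\<close>

definition bdd_meas :: "nat \<Rightarrow> (cmat \<Rightarrow> complex) \<Rightarrow> bool" where
  "bdd_meas N f \<longleftrightarrow> f \<in> borel_measurable borel \<and> (\<exists>K. \<forall>u. unitary_mat N u \<longrightarrow> cmod (f u) \<le> K)"

lemma bdd_meas_const [intro!]: "bdd_meas N (\<lambda>u. c)"
  by (auto simp: bdd_meas_def)

lemma bdd_meas_entry: "bdd_meas N (\<lambda>u. u i j)"
proof -
  have "(\<lambda>u::cmat. u i j) \<in> borel_measurable borel"
    by (rule measurable_compose[OF measurable_product_coordinates measurable_product_coordinates])
  then show ?thesis
    unfolding bdd_meas_def using unitary_mat_entry_le[of N _ i j] by blast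
qed

lemma bdd_meas_cnj: "bdd_meas N f \<Longrightarrow> bdd_meas N (\<lambda>u. cnj (f u))"
  unfolding bdd_meas_def
  using measurable_compose[OF _ borel_measurable_continuous_onI[OF linear_continuous_on[OF bounded_linear_cnj]], of f]
  by auto

lemma bdd_meas_add:
  assumes "bdd_meas N f" "bdd_meas N g"
  shows "bdd_meas N (\<lambda>u. f u + g u)"
proof -
  obtain K L where KL: "\<And>u. unitary_mat N u \<Longrightarrow> cmod (f u) \<le> K" "\<And>u. unitary_mat N u \<Longrightarrow> cmod (g u) \<le> L"
    using assms by (auto simp: bdd_meas_def)
  then have "\<And>u. unitary_mat N u \<Longrightarrow> cmod (f u + g u) \<le> K + L"
    by (meson add_mono norm_triangle_le)
  then show ?thesis using assms by (auto simp: bdd_meas_def)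
qed

lemma bdd_meas_mult:
  assumes "bdd_meas N f" "bdd_meas N g"
  shows "bdd_meas N (\<lambda>u. f u * g u)"
proof -
  obtain K L where KL: "\<And>u. unitary_mat N u \<Longrightarrow> cmod (f u) \<le> K" "\<And>u. unitary_mat N u \<Longrightarrow> cmod (g u) \<le> L"
    using assms by (auto simp: bdd_meas_def)
  have "cmod (f u * g u) \<le> K * L" if "unitary_mat N u" for u
    unfolding norm_mult using KL[OF that] by (intro mult_mono) (auto intro: order_trans[OF norm_ge_zero])
  then show ?thesis using assms by (auto simp: bdd_meas_def)
qed

lemma bdd_meas_diff: "bdd_meas N f \<Longrightarrow> bdd_meas N g \<Longrightarrow> bdd_meas N (\<lambda>u. f u - g u)"
  using bdd_meas_add[of N f "\<lambda>u. (-1) * g u"] bdd_meas_mult[of N "\<lambda>u. -1" g] by auto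

lemma bdd_meas_sum: "(\<And>i. i \<in> I \<Longrightarrow> bdd_meas N (f i)) \<Longrightarrow> bdd_meas N (\<lambda>u. \<Sum>i\<in>I. f i u)"
  by (induction I rule: infinite_finite_induct) (auto intro: bdd_meas_add)

lemma bdd_meas_sum_list: "(\<And>x. x \<in> set xs \<Longrightarrow> bdd_meas N (f x)) \<Longrightarrow> bdd_meas N (\<lambda>u. \<Sum>x\<leftarrow>xs. f x u)"
  by (induction xs) (auto intro: bdd_meas_add)

definition bdd_meas_mat :: "nat \<Rightarrow> (cmat \<Rightarrow> cmat) \<Rightarrow> bool" where
  "bdd_meas_mat N F \<longleftrightarrow> (\<forall>i j. bdd_meas N (\<lambda>u. F u i j))"

lemma bdd_meas_mat_const [intro!]: "bdd_meas_mat N (\<lambda>u. A)"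
  by (auto simp: bdd_meas_mat_def)

lemma bdd_meas_mat_mmult: "bdd_meas_mat N F \<Longrightarrow> bdd_meas_mat N G \<Longrightarrow> bdd_meas_mat N (\<lambda>u. mmult N (F u) (G u))"
proof -
  assume *: "bdd_meas_mat N F" "bdd_meas_mat N G"
  have "bdd_meas N (\<lambda>u. mmult N (F u) (G u) i j)" for i j
    using * by (cases "i < N \<and> j < N") (auto simp: bdd_meas_mat_def mmult_def intro!: bdd_meas_sum bdd_meas_mult)
  then show ?thesis by (simp add: bdd_meas_mat_def)
qed

lemma bdd_meas_mat_letters: "bdd_meas_mat N (\<lambda>u. letters N A B u x)"
proof -
  have "bdd_meas_mat N (\<lambda>u. u)" "bdd_meas_mat N (\<lambda>u. adj u)"
    by (auto simp: bdd_meas_mat_def adj_def intro: bdd_meas_entry bdd_meas_cnj)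
  then show ?thesis
    by (cases x) (auto simp: letters_Inr intro!: bdd_meas_mat_mmult)
qed

text \<open>Uniformity over the unitary group lets such an expansion be integrated term by term, which replaces
  differentiation under the integral.\<close>

definition first_order :: "nat \<Rightarrow> (real \<Rightarrow> cmat \<Rightarrow> complex) \<Rightarrow> (cmat \<Rightarrow> complex) \<Rightarrow> (cmat \<Rightarrow> complex) \<Rightarrow> bool" where
  "first_order N g g0 g1 \<longleftrightarrow> bdd_meas N g0 \<and> bdd_meas N g1 \<and> (\<forall>t. g t \<in> borel_measurable borel) \<and>
     (\<exists>K. \<forall>u t. unitary_mat N u \<longrightarrow> 0 \<le> t \<longrightarrow> t \<le> 1 \<longrightarrow> cmod (g t u - g0 u - of_real t * g1 u) \<le> K * t\<^sup>2)"

lemma first_order_const: "bdd_meas N f \<Longrightarrow> first_order N (\<lambda>t. f) f (\<lambda>u. 0)"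
  by (auto simp: first_order_def bdd_meas_def intro!: exI[of _ 0])

lemma first_order_add:
  assumes "first_order N g g0 g1" "first_order N h h0 h1"
  shows "first_order N (\<lambda>t u. g t u + h t u) (\<lambda>u. g0 u + h0 u) (\<lambda>u. g1 u + h1 u)"
proof -
  obtain K L where KL: "\<And>u t. unitary_mat N u \<Longrightarrow> 0 \<le> t \<Longrightarrow> t \<le> 1 \<Longrightarrow> cmod (g t u - g0 u - of_real t * g1 u) \<le> K * t\<^sup>2"
    "\<And>u t. unitary_mat N u \<Longrightarrow> 0 \<le> t \<Longrightarrow> t \<le> 1 \<Longrightarrow> cmod (h t u - h0 u - of_real t * h1 u) \<le> L * t\<^sup>2"
    using assms unfolding first_order_def by metis
  have "cmod (g t u + h t u - (g0 u + h0 u) - of_real t * (g1 u + h1 u)) \<le> (K + L) * t\<^sup>2"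
    if "unitary_mat N u" "0 \<le> t" "t \<le> 1" for u t
  proof -
    have "g t u + h t u - (g0 u + h0 u) - of_real t * (g1 u + h1 u)
      = (g t u - g0 u - of_real t * g1 u) + (h t u - h0 u - of_real t * h1 u)"
      by (simp add: algebra_simps)
    then show ?thesis
      using KL[OF that] norm_triangle_le by (metis add_mono distrib_right)
  qed
  then show ?thesis
    using assms by (auto simp: first_order_def intro!: bdd_meas_add borel_measurable_add)
qed

lemma first_order_mult:
  assumes "first_order N g g0 g1" "first_order N h h0 h1"
  shows "first_order N (\<lambda>t u. g t u * h t u) (\<lambda>u. g0 u * h0 u) (\<lambda>u. g1 u * h0 u + g0 u * h1 u)"
proof -
  have bms: "bdd_meas N g0" "bdd_meas N g1" "bdd_meas N h0" "bdd_meas N h1"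
    using assms by (auto simp: first_order_def)
  obtain K L where KL: "\<And>u t. unitary_mat N u \<Longrightarrow> 0 \<le> t \<Longrightarrow> t \<le> 1 \<Longrightarrow> cmod (g t u - g0 u - of_real t * g1 u) \<le> K * t\<^sup>2"
    "\<And>u t. unitary_mat N u \<Longrightarrow> 0 \<le> t \<Longrightarrow> t \<le> 1 \<Longrightarrow> cmod (h t u - h0 u - of_real t * h1 u) \<le> L * t\<^sup>2"
    using assms unfolding first_order_def by metis
  obtain a0 a1 b0 b1 where ab: "\<And>u. unitary_mat N u \<Longrightarrow> cmod (g0 u) \<le> a0" "\<And>u. unitary_mat N u \<Longrightarrow> cmod (g1 u) \<le> a1"
     "\<And>u. unitary_mat N u \<Longrightarrow> cmod (h0 u) \<le> b0" "\<And>u. unitary_mat N u \<Longrightarrow> cmod (h1 u) \<le> b1"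
    using bms unfolding bdd_meas_def by metis
  have "cmod (g t u * h t u - g0 u * h0 u - of_real t * (g1 u * h0 u + g0 u * h1 u)) \<le>
      (a1 * b1 + K * (L + b0 + b1) + (a0 + a1) * L) * t\<^sup>2"
    if u: "unitary_mat N u" "0 \<le> t" "t \<le> 1" for u t
  proof -
    define r where "r = g t u - g0 u - of_real t * g1 u"
    define s where "s = h t u - h0 u - of_real t * h1 u"
    have r: "cmod r \<le> K * t\<^sup>2" and s: "cmod s \<le> L * t\<^sup>2"
      using KL[OF u] by (auto simp: r_def s_def)
    have pos: "0 \<le> a0" "0 \<le> a1" "0 \<le> b0" "0 \<le> b1" and t2: "t\<^sup>2 \<le> 1"
      using ab[OF u(1)] order_trans[OF norm_ge_zero] u by (blast, blast, blast, blast, simp add: power_le_one)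
    \<comment> \<open>The definition does not fix the sign of the constants; t = 1 reveals
      it.\<close>
    have "0 \<le> K * 1\<^sup>2" "0 \<le> L * 1\<^sup>2"
      using KL[OF u(1), of 1] by (auto intro: order_trans[OF norm_ge_zero])
    then have pos2: "0 \<le> K" "0 \<le> L" by auto
    \<comment> \<open>Expanding (g0 + t g1 + r)(h0 + t h1 + s) leaves exactly these terms of second
      order.\<close>
    have eq: "g t u * h t u - g0 u * h0 u - of_real t * (g1 u * h0 u + g0 u * h1 u)
      = of_real (t\<^sup>2) * (g1 u * h1 u) + r * (s + h0 u + of_real t * h1 u) + (g0 u + of_real t * g1 u) * s"
      by (simp add: r_def s_def algebra_simps power2_eq_square)
    have 1: "cmod (of_real (t\<^sup>2) * (g1 u * h1 u)) \<le> t\<^sup>2 * (a1 * b1)"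
      unfolding norm_mult using ab[OF u(1)] pos by (intro mult_mono) (auto simp: norm_power)
    have tb: "cmod (of_real t * h1 u) \<le> 1 * b1" "cmod (of_real t * g1 u) \<le> 1 * a1"
      unfolding norm_mult using ab[OF u(1)] u by (intro mult_mono; auto)+
    have "L * t\<^sup>2 \<le> L" using pos2 t2 by (simp add: mult_left_le)
    then have "cmod (s + h0 u + of_real t * h1 u) \<le> L + b0 + b1"
      using tb ab[OF u(1)] s norm_triangle_ineq[of "s + h0 u" "of_real t * h1 u"] norm_triangle_ineq[of s "h0 u"] by linarith
    then have 2: "cmod (r * (s + h0 u + of_real t * h1 u)) \<le> (K * t\<^sup>2) * (L + b0 + b1)"
      unfolding norm_mult using r pos2 by (intro mult_mono) auto
    have "cmod (g0 u + of_real t * g1 u) \<le> a0 + a1"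
      using tb ab[OF u(1)] norm_triangle_ineq[of "g0 u" "of_real t * g1 u"] by linarith
    then have 3: "cmod ((g0 u + of_real t * g1 u) * s) \<le> (a0 + a1) * (L * t\<^sup>2)"
      unfolding norm_mult using s pos by (intro mult_mono) auto
    have "cmod (g t u * h t u - g0 u * h0 u - of_real t * (g1 u * h0 u + g0 u * h1 u)) \<le>
      t\<^sup>2 * (a1 * b1) + (K * t\<^sup>2) * (L + b0 + b1) + (a0 + a1) * (L * t\<^sup>2)"
      unfolding eq using 1 2 3 by (meson add_mono norm_triangle_le)
    then show ?thesis by (simp add: algebra_simps)
  qed
  then show ?thesis
    using assms bms by (auto simp: first_order_def intro!: bdd_meas_add bdd_meas_mult borel_measurable_times)
qed

lemma first_order_sum:
  "(\<And>i. i \<in> I \<Longrightarrow> first_order N (g i) (g0 i) (g1 i)) \<Longrightarrow>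
    first_order N (\<lambda>t u. \<Sum>i\<in>I. g i t u) (\<lambda>u. \<Sum>i\<in>I. g0 i u) (\<lambda>u. \<Sum>i\<in>I. g1 i u)"
proof (induction I rule: infinite_finite_induct)
  case (insert x F)
  then show ?case using first_order_add[of N "g x" "g0 x" "g1 x"] by simp
qed (auto intro: first_order_const)

definition first_order_mat :: "nat \<Rightarrow> (real \<Rightarrow> cmat \<Rightarrow> cmat) \<Rightarrow> (cmat \<Rightarrow> cmat) \<Rightarrow> (cmat \<Rightarrow> cmat) \<Rightarrow> bool" where
  "first_order_mat N G G0 G1 \<longleftrightarrow> (\<forall>i j. first_order N (\<lambda>t u. G t u i j) (\<lambda>u. G0 u i j) (\<lambda>u. G1 u i j))"

lemma first_order_mat_const: "bdd_meas_mat N F \<Longrightarrow> first_order_mat N (\<lambda>t. F) F (\<lambda>u i j. 0)"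
  by (auto simp: first_order_mat_def bdd_meas_mat_def intro: first_order_const)

lemma first_order_mat_mmult:
  assumes "first_order_mat N G G0 G1" "first_order_mat N H H0 H1"
  shows "first_order_mat N (\<lambda>t u. mmult N (G t u) (H t u)) (\<lambda>u. mmult N (G0 u) (H0 u))
      (\<lambda>u i j. mmult N (G1 u) (H0 u) i j + mmult N (G0 u) (H1 u) i j)"
  unfolding first_order_mat_def
proof (intro allI)
  fix i j
  show "first_order N (\<lambda>t u. mmult N (G t u) (H t u) i j) (\<lambda>u. mmult N (G0 u) (H0 u) i j)
      (\<lambda>u. mmult N (G1 u) (H0 u) i j + mmult N (G0 u) (H1 u) i j)"
  proof (cases "i < N \<and> j < N")
    case True
    then show ?thesis
      using assms unfolding mmult_def first_order_mat_def
      by (simp flip: sum.distrib) (intro first_order_sum first_order_mult; blast)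
  next
    case False
    then show ?thesis by (auto simp: mmult_def intro: first_order_const)
  qed
qed

section \<open>One-parameter groups of unitaries in rank-one directions\<close>

definition rank_one :: "nat \<Rightarrow> cvec \<Rightarrow> cmat" where
  "rank_one N p = (\<lambda>i j. if i < N \<and> j < N then p i * cnj (p j) else 0)"

definition phase :: "nat \<Rightarrow> cvec \<Rightarrow> real \<Rightarrow> cmat" where
  "phase N p t = (\<lambda>i j. idm N i j + (cis t - 1) * rank_one N p i j)"

lemma adj_phase: "adj (phase N p t) = (\<lambda>i j. idm N i j + (cis (-t) - 1) * rank_one N p i j)"
  by (auto simp: adj_def phase_def fun_eq_iff idm_def rank_one_def cis_cnj)

lemma rank_one_idem:
  assumes "unit_vec N p"
  shows "mmult N (rank_one N p) (rank_one N p) = rank_one N p"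
proof (intro ext)
  fix i j
  have "(\<Sum>k<N. cnj (p k) * p k) = of_real (\<Sum>k<N. (cmod (p k))\<^sup>2)"
    unfolding of_real_sum by (simp add: complex_norm_square mult.commute del: of_real_power)
  then have "(\<Sum>k<N. cnj (p k) * p k) = 1"
    using assms by (simp add: unit_vec_def del: of_real_sum)
  moreover have "(\<Sum>k<N. p i * cnj (p k) * (p k * cnj (p j))) = p i * cnj (p j) * (\<Sum>k<N. cnj (p k) * p k)"
    by (simp add: sum_distrib_left mult_ac)
  ultimately show "mmult N (rank_one N p) (rank_one N p) i j = rank_one N p i j"
    by (simp add: mmult_def rank_one_def)
qed

lemma msupp_rank_one [simp]: "msupp N (rank_one N p)"
  by (auto simp: msupp_def rank_one_def)

lemma unitary_phase:
  assumes "unit_vec N p"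
  shows "unitary_mat N (phase N p t)"
proof -
  have "mmult N (phase N p t) (adj (phase N p t)) =
     (\<lambda>i j. idm N i j + ((cis t - 1) + (cis (-t) - 1) + (cis t - 1) * (cis (-t) - 1)) * rank_one N p i j)"
    unfolding adj_phase unfolding phase_def
    by (simp only: mmult_add_left mmult_add_right mmult_scale_left mmult_scale_right rank_one_idem[OF assms]
       mmult_idm_left mmult_idm_right msupp_idm msupp_rank_one fun_eq_iff) (simp add: algebra_simps)
  also have "(cis t - 1) + (cis (-t) - 1) + (cis t - 1) * (cis (-t) - 1) = 0"
    by (simp add: algebra_simps cis_mult)
  finally show ?thesis
    by (auto simp: unitary_mat_def phase_def idm_def rank_one_def)
qed

lemma cis_first_order: "cmod (cis t - 1 - \<i> * of_real t) \<le> t\<^sup>2 / 2"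
  using iexp_approx1[of t 1] by (simp add: cis_conv_exp algebra_simps power2_eq_square numeral_2_eq_2)

lemma first_order_cis: "first_order N (\<lambda>t u. cis (s * t) - 1) (\<lambda>u. 0) (\<lambda>u. \<i> * of_real s)"
proof -
  have "cmod (cis (s * t) - 1 - 0 - of_real t * (\<i> * of_real s)) \<le> (s\<^sup>2 / 2) * t\<^sup>2" for t
    using cis_first_order[of "s * t"] by (simp add: mult_ac power_mult_distrib)
  then show ?thesis
    unfolding first_order_def by (intro conjI allI exI[of _ "s\<^sup>2 / 2"]) auto
qed

lemma first_order_mat_phase:
  "first_order_mat N (\<lambda>t u. phase N p t) (\<lambda>u. idm N) (\<lambda>u i j. \<i> * rank_one N p i j)"
  "first_order_mat N (\<lambda>t u. adj (phase N p t)) (\<lambda>u. idm N) (\<lambda>u i j. (-\<i>) * rank_one N p i j)"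
proof -
  \<comment> \<open>The parameter s treats both claims at once: s = 1 is the phase, s = -1 its
    adjoint.\<close>
  have *: "first_order_mat N (\<lambda>t u i j. idm N i j + (cis (s * t) - 1) * rank_one N p i j) (\<lambda>u. idm N)
     (\<lambda>u i j. (\<i> * of_real s) * rank_one N p i j)" for s
    unfolding first_order_mat_def
  proof (intro allI)
    fix i j
    show "first_order N (\<lambda>t u. idm N i j + (cis (s * t) - 1) * rank_one N p i j) (\<lambda>u. idm N i j)
     (\<lambda>u. (\<i> * of_real s) * rank_one N p i j)"
      using first_order_add[OF first_order_const[OF bdd_meas_const[of N "idm N i j"]] first_order_mult[OF first_order_cis[of N s] first_order_const[OF bdd_meas_const[of N "rank_one N p i j"]]]]
      by simp
  qed
  show "first_order_mat N (\<lambda>t u. phase N p t) (\<lambda>u. idm N) (\<lambda>u i j. \<i> * rank_one N p i j)"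
    using *[of 1] by (simp add: phase_def)
  show "first_order_mat N (\<lambda>t u. adj (phase N p t)) (\<lambda>u. idm N) (\<lambda>u i j. (-\<i>) * rank_one N p i j)"
    using *[of "-1"] by (simp add: adj_phase)
qed

lemma first_order_mat_letters:
  "first_order_mat N (\<lambda>t u. letters N A B (mmult N (phase N p t) u) x) (\<lambda>u. letters N A B u x)
     (\<lambda>u. dletter N (letters N A B u) (\<lambda>i j. \<i> * rank_one N p i j) x)"
proof (cases x)
  case (Inl i)
  then show ?thesis by (simp add: first_order_mat_const bdd_meas_mat_const)
next
  case (Inr j)
  have s: "msupp N (letters N A B u (Inr j))" for u by (simp add: letters_Inr)
  have "first_order_mat N (\<lambda>t u. mmult N (phase N p t) (mmult N (letters N A B u (Inr j)) (adj (phase N p t))))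
    (\<lambda>u. mmult N (idm N) (mmult N (letters N A B u (Inr j)) (idm N)))
    (\<lambda>u a b. mmult N (\<lambda>i j. \<i> * rank_one N p i j) (mmult N (letters N A B u (Inr j)) (idm N)) a b +
       mmult N (idm N) (\<lambda>a b. mmult N (\<lambda>i j. 0) (idm N) a b + mmult N (letters N A B u (Inr j)) (\<lambda>i j. (-\<i>) * rank_one N p i j) a b) a b)"
    by (intro first_order_mat_mmult first_order_mat_phase first_order_mat_const bdd_meas_mat_letters)
  moreover have "mmult N (letters N A B u (Inr j)) (\<lambda>i j. (-\<i>) * rank_one N p i j)
     = (\<lambda>a b. - mmult N (letters N A B u (Inr j)) (\<lambda>i j. \<i> * rank_one N p i j) a b)" for u
    by (simp only: mmult_scale_right) simp
  moreover have "msupp N (\<lambda>a b. - mmult N (letters N A B u (Inr j)) (\<lambda>i j. \<i> * rank_one N p i j) a b)" for u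
    by (auto simp: msupp_def mmult_def)
  ultimately show ?thesis
    using Inr by (simp only: letters_mmult dletter.simps) (simp add: s)
qed

lemma first_order_mat_mono_eval:
  "first_order_mat N (\<lambda>t u. mono_eval N (letters N A B (mmult N (phase N p t) u)) w) (\<lambda>u. mono_eval N (letters N A B u) w)
     (\<lambda>u. dword N (letters N A B u) (\<lambda>i j. \<i> * rank_one N p i j) w)"
proof (induction w)
  case Nil
  then show ?case by (simp add: first_order_mat_const bdd_meas_mat_const)
next
  case (Cons x w)
  show ?case
    unfolding mono_eval_Cons dword.simps by (intro first_order_mat_mmult first_order_mat_letters Cons)
qed

lemma first_order_ntr: "first_order_mat N G G0 G1 \<Longrightarrow> first_order N (\<lambda>t u. ntr N (G t u)) (\<lambda>u. ntr N (G0 u)) (\<lambda>u. ntr N (G1 u))"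
  using first_order_mult[OF first_order_const[OF bdd_meas_const[of N "1 / of_nat N"]] first_order_sum[of "{..<N}" N "\<lambda>i t u. G t u i i" "\<lambda>i u. G0 u i i" "\<lambda>i u. G1 u i i"]]
  by (simp add: first_order_mat_def ntr_def)

text \<open>Each word carries its own centering constant, so plain and centered traces can be mixed
  in one product.\<close>

definition mom :: "('a \<Rightarrow> complex) \<Rightarrow> ('a \<times> complex) list \<Rightarrow> complex" where
  "mom f Q = (\<Prod>(q, c)\<leftarrow>Q. f q - c)"

lemma mom_Nil [simp]: "mom f [] = 1"
  and mom_Cons [simp]: "mom f ((q, c) # Q) = (f q - c) * mom f Q"
  by (simp_all add: mom_def)

definition dmom :: "('a \<Rightarrow> complex) \<Rightarrow> ('a \<Rightarrow> complex) \<Rightarrow> ('a \<times> complex) list \<Rightarrow> complex" where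
  "dmom f f' Q = (\<Sum>((q, c), R)\<leftarrow>picks Q. f' q * mom f R)"

lemma dmom_Cons: "dmom f f' ((q, c) # Q) = f' q * mom f Q + (f q - c) * dmom f f' Q"
  by (simp add: dmom_def o_def case_prod_unfold mult.left_commute flip: sum_list_const_mult)

lemma first_order_mom:
  assumes "\<And>q. first_order N (\<lambda>t u. f t u q) (\<lambda>u. f0 u q) (\<lambda>u. f1 u q)"
  shows "first_order N (\<lambda>t u. mom (f t u) Q) (\<lambda>u. mom (f0 u) Q) (\<lambda>u. dmom (f0 u) (f1 u) Q)"
proof (induction Q)
  case Nil
  then show ?case by (auto simp: dmom_def intro: first_order_const)
next
  case (Cons x Q)
  obtain q c where x: "x = (q, c)" by (cases x)
  show ?case
    using first_order_mult[OF first_order_add[OF assms[of q] first_order_const[OF bdd_meas_const[of N "-c"]]] Cons]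
    by (simp add: x dmom_Cons)
qed

lemma bdd_meas_mat_dword: "bdd_meas_mat N (\<lambda>u. dword N (letters N A B u) X w)"
proof (induction w)
  case (Cons x w)
  have "bdd_meas_mat N (\<lambda>u. dletter N (letters N A B u) X x)"
  proof (cases x)
    case (Inr j)
    have "bdd_meas_mat N (\<lambda>u. mmult N X (letters N A B u x))" "bdd_meas_mat N (\<lambda>u. mmult N (letters N A B u x) X)"
      by (intro bdd_meas_mat_mmult bdd_meas_mat_letters bdd_meas_mat_const)+
    then show ?thesis by (auto simp: bdd_meas_mat_def Inr intro!: bdd_meas_diff)
  qed (auto simp: bdd_meas_mat_def)
  moreover have "bdd_meas_mat N (\<lambda>u. mono_eval N (letters N A B u) w)"
    by (induction w) (auto simp: mono_eval_Cons intro!: bdd_meas_mat_mmult bdd_meas_mat_letters)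
  ultimately have "bdd_meas_mat N (\<lambda>u. mmult N (dletter N (letters N A B u) X x) (mono_eval N (letters N A B u) w))"
    by (rule bdd_meas_mat_mmult)
  moreover have "bdd_meas_mat N (\<lambda>u. mmult N (letters N A B u x) (dword N (letters N A B u) X w))"
    by (intro bdd_meas_mat_mmult bdd_meas_mat_letters Cons)
  ultimately show ?case by (auto simp: bdd_meas_mat_def intro!: bdd_meas_add)
qed (auto simp: bdd_meas_mat_def)

lemma dword_lincomb:
  "dword N Z (\<lambda>i j. c * X i j + Y i j) w = (\<lambda>i j. c * dword N Z X w i j + dword N Z Y w i j)"
proof (induction w)
  case (Cons x w)
  have "dletter N Z (\<lambda>i j. c * X i j + Y i j) x = (\<lambda>i j. c * dletter N Z X x i j + dletter N Z Y x i j)"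
    by (cases x) (simp_all add: mmult_add_left mmult_add_right mmult_scale_left mmult_scale_right fun_eq_iff algebra_simps)
  then show ?case
    by (simp only: dword.simps Cons mmult_add_left mmult_add_right mmult_scale_left mmult_scale_right)
      (simp add: fun_eq_iff algebra_simps)
qed simp

lemma sum_sum_list_swap: "(\<Sum>a\<in>I. \<Sum>x\<leftarrow>xs. f a x) = (\<Sum>x\<leftarrow>xs. \<Sum>a\<in>I. f a x)"
  by (induction xs) (auto simp: sum.distrib)

lemma sum_swap3: "(\<Sum>a\<in>I. \<Sum>b\<in>J. \<Sum>c\<in>K. f a b c) = (\<Sum>c\<in>K. \<Sum>a\<in>I. \<Sum>b\<in>J. f a b c)"
proof -
  have "(\<Sum>a\<in>I. \<Sum>b\<in>J. \<Sum>c\<in>K. f a b c) = (\<Sum>a\<in>I. \<Sum>c\<in>K. \<Sum>b\<in>J. f a b c)"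
    by (intro sum.cong refl sum.swap)
  also have "\<dots> = (\<Sum>c\<in>K. \<Sum>a\<in>I. \<Sum>b\<in>J. f a b c)" by (rule sum.swap)
  finally show ?thesis .
qed

definition mat_unit :: "nat \<Rightarrow> nat \<Rightarrow> cmat" where
  "mat_unit a b = (\<lambda>i j. if i = a \<and> j = b then 1 else 0)"

lemma mmult_mmult:
  assumes "i < N" "j < N"
  shows "mmult N (mmult N F X) G i j = (\<Sum>a<N. \<Sum>b<N. F i a * X a b * G b j)"
  using assms unfolding mmult_def by (simp add: sum_distrib_right) (subst sum.swap, simp)

lemma mmult_mat_unit:
  assumes "i < N" "j < N" "a < N" "b < N"
  shows "mmult N (mmult N F (mat_unit a b)) G i j = F i a * G b j"
proof -
  have "(\<Sum>a'<N. \<Sum>b'<N. F i a' * mat_unit a b a' b' * G b' j) = (\<Sum>a'<N. \<Sum>b'<N. if b' = b then (if a' = a then F i a' * G b' j else 0) else 0)"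
    by (intro sum.cong refl) (auto simp: mat_unit_def)
  then show ?thesis using assms by (simp add: mmult_mmult sum.delta)
qed

subsection \<open>The Schwinger--Dyson equation\<close>

text \<open>The matrices are arbitrary; the marked matrix will enter as one more member of the
  family \<open>A\<close>, so the equation is proved without mentioning it.\<close>

locale haar_matrix = prob_space M for M :: "'w measure" +
  fixes N :: nat and A B :: "nat \<Rightarrow> cmat" and U :: "'w \<Rightarrow> cmat"
  assumes haar: "haar_unitary M N U" and N_pos: "N \<ge> 1"
begin

abbreviation Z :: "cmat \<Rightarrow> var \<Rightarrow> cmat" where "Z u \<equiv> letters N A B u"
abbreviation W :: "cmat \<Rightarrow> var list \<Rightarrow> cmat" where "W u \<equiv> mono_eval N (Z u)"
abbreviation T :: "cmat \<Rightarrow> var list \<Rightarrow> complex" where "T u w \<equiv> ntr N (W u w)"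

lemma U_measurable [measurable]: "U \<in> M \<rightarrow>\<^sub>M borel"
  and U_unitary: "AE \<omega> in M. unitary_mat N (U \<omega>)"
  using haar by (auto simp: haar_unitary_def)

lemma integrable_bdd_meas:
  assumes "bdd_meas N f"
  shows "integrable M (\<lambda>\<omega>. f (U \<omega>))"
proof -
  obtain K where "\<And>u. unitary_mat N u \<Longrightarrow> cmod (f u) \<le> K" and f[measurable]: "f \<in> borel_measurable borel"
    using assms by (auto simp: bdd_meas_def)
  then have "AE \<omega> in M. norm (f (U \<omega>)) \<le> K"
    using U_unitary by auto
  then show ?thesis
    by (intro integrable_const_bound) auto
qed

lemma haar_invariant:
  assumes V: "unitary_mat N V" and f[measurable]: "f \<in> borel_measurable borel"
  shows "(\<integral>\<omega>. f (mmult N V (U \<omega>)) \<partial>M) = (\<integral>\<omega>. (f (U \<omega>) :: complex) \<partial>M)"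
proof -
  have 1: "(\<lambda>u. mmult N V u i j) \<in> borel_measurable borel" for i j
  proof -
    have "bdd_meas N (\<lambda>u. mmult N V u i j)"
      using bdd_meas_mat_mmult[of N "\<lambda>u. V" "\<lambda>u. u"] by (auto simp: bdd_meas_mat_def bdd_meas_entry)
    then show ?thesis by (simp add: bdd_meas_def)
  qed
  have [measurable]: "mmult N V \<in> borel \<rightarrow>\<^sub>M borel"
    by (intro measurable_coordinatewise_then_product 1)
  have "(\<integral>\<omega>. f (mmult N V (U \<omega>)) \<partial>M) = integral\<^sup>L (distr M borel (\<lambda>\<omega>. mmult N V (U \<omega>))) f"
    by (rule integral_distr[symmetric]) measurable
  also have "distr M borel (\<lambda>\<omega>. mmult N V (U \<omega>)) = distr M borel U"
    using haar V by (auto simp: haar_unitary_def)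
  also have "integral\<^sup>L (distr M borel U) f = (\<integral>\<omega>. f (U \<omega>) \<partial>M)"
    by (rule integral_distr) measurable
  finally show ?thesis .
qed

text \<open>Invariance cancels the zeroth order, which leaves |t E g1| <= K t^2; dividing by t and
  letting t tend to 0 gives the claim.\<close>

lemma integral_first_order_zero:
  assumes first_order: "first_order N g g0 g1" and inv: "\<And>t. (\<integral>\<omega>. g t (U \<omega>) \<partial>M) = (\<integral>\<omega>. g0 (U \<omega>) \<partial>M)"
  shows "(\<integral>\<omega>. g1 (U \<omega>) \<partial>M) = 0"
proof -
  obtain K where K: "\<And>u t. unitary_mat N u \<Longrightarrow> 0 \<le> t \<Longrightarrow> t \<le> 1 \<Longrightarrow> cmod (g t u - g0 u - of_real t * g1 u) \<le> K * t\<^sup>2"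
    and bms: "bdd_meas N g0" "bdd_meas N g1" and meas: "\<And>t. g t \<in> borel_measurable borel"
    using first_order unfolding first_order_def by metis
  define I where "I = (\<integral>\<omega>. g1 (U \<omega>) \<partial>M)"
  have "t * cmod I \<le> K * t\<^sup>2" if t: "0 < t" "t \<le> 1" for t
  proof -
    have bt: "bdd_meas N (\<lambda>u. g t u - g0 u - of_real t * g1 u)"
      unfolding bdd_meas_def using K[OF _ less_imp_le[OF t(1)] t(2)] bms meas
      by (auto simp: bdd_meas_def intro!: borel_measurable_diff borel_measurable_times)
    \<comment> \<open>\<open>g t\<close> is only known to be measurable; it is bounded as the sum of
      its remainder and its expansion.\<close>
    then have "bdd_meas N (\<lambda>u. (g t u - g0 u - of_real t * g1 u) + (g0 u + of_real t * g1 u))"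
      using bms by (intro bdd_meas_add bdd_meas_mult bdd_meas_const)
    then have "bdd_meas N (g t)" by simp
    then have "(\<integral>\<omega>. g t (U \<omega>) - g0 (U \<omega>) - of_real t * g1 (U \<omega>) \<partial>M) = - (of_real t * I)"
      using bms inv[of t] by (simp add: integrable_bdd_meas I_def)
    moreover have "cmod (\<integral>\<omega>. g t (U \<omega>) - g0 (U \<omega>) - of_real t * g1 (U \<omega>) \<partial>M) \<le> K * t\<^sup>2"
    proof (rule order_trans[OF integral_norm_bound])
      have "integrable M (\<lambda>\<omega>. g t (U \<omega>) - g0 (U \<omega>) - of_real t * g1 (U \<omega>))"
        using integrable_bdd_meas[OF bt] .
      then have "(\<integral>\<omega>. cmod (g t (U \<omega>) - g0 (U \<omega>) - of_real t * g1 (U \<omega>)) \<partial>M) \<le> (\<integral>\<omega>. K * t\<^sup>2 \<partial>M)"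
        using U_unitary K t by (intro integral_mono_AE) auto
      then show "(\<integral>\<omega>. cmod (g t (U \<omega>) - g0 (U \<omega>) - of_real t * g1 (U \<omega>)) \<partial>M) \<le> K * t\<^sup>2"
        by (simp add: prob_space)
    qed
    ultimately show ?thesis using t by (simp add: norm_mult)
  qed
  then have *: "cmod I \<le> K * t" if "0 < t" "t \<le> 1" for t
    using that by (fastforce simp: power2_eq_square mult.assoc[symmetric])
  have "cmod I \<le> 0"
  proof (rule tendsto_lowerbound)
    show "((\<lambda>t. K * t) \<longlongrightarrow> 0) (at_right 0)"
      by (auto intro!: tendsto_eq_intros)
    show "\<forall>\<^sub>F t in at_right 0. cmod I \<le> K * t"
      using * by (auto simp: eventually_at_right[of 0 1] intro!: exI[of _ 1])
  qed simp
  then show ?thesis by (simp add: I_def)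
qed

text \<open>The derivative in direction \<open>X\<close> of \<open>W u P i j * mom (T u) Q\<close>.
  One word is kept as an open matrix entry, so that summing against matrix units can close it into
  traces.\<close>

definition dform :: "var list \<Rightarrow> (var list \<times> complex) list \<Rightarrow> nat \<Rightarrow> nat \<Rightarrow> cmat \<Rightarrow> cmat \<Rightarrow> complex" where
  "dform P Q i j X u = dword N (Z u) X P i j * mom (T u) Q + W u P i j * dmom (T u) (\<lambda>q. ntr N (dword N (Z u) X q)) Q"

text \<open>Read off from the zeroth-order part of an expansion; the zero vector is a dummy
  direction.\<close>

lemma bdd_meas_mom: "bdd_meas N (\<lambda>u. mom (T u) Q)"
  using first_order_mom[where f = "\<lambda>t u. T (mmult N (phase N (\<lambda>_. 0) t) u)" and N = N and Q = Q, OF first_order_ntr[OF first_order_mat_mono_eval]]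
  unfolding first_order_def by blast

lemma bdd_meas_word: "bdd_meas N (\<lambda>u. W u w i j)"
  using first_order_mat_mono_eval[of N A B _ w] unfolding first_order_def first_order_mat_def by blast

lemma bdd_meas_ntr: "bdd_meas_mat N F \<Longrightarrow> bdd_meas N (\<lambda>u. ntr N (F u))"
  using bdd_meas_mult[OF bdd_meas_const[of N "1 / of_nat N"] bdd_meas_sum[of "{..<N}" N "\<lambda>i u. F u i i"]]
  by (simp add: bdd_meas_mat_def ntr_def)

lemma bdd_meas_dform: "bdd_meas N (dform P Q i j X)"
proof -
  have "bdd_meas N (\<lambda>u. dword N (Z u) X P i j * mom (T u) Q + W u P i j * dmom (T u) (\<lambda>q. ntr N (dword N (Z u) X q)) Q)"
    unfolding dmom_def case_prod_unfold
    using bdd_meas_mat_dword[of N A B X P]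
    by (intro bdd_meas_add bdd_meas_mult bdd_meas_mom bdd_meas_word bdd_meas_sum_list bdd_meas_ntr bdd_meas_mat_dword) (auto simp: bdd_meas_mat_def)
  then show ?thesis by (simp add: dform_def[abs_def])
qed

text \<open>Haar invariance speaks about skew-Hermitian directions only. Complex linearity is what
  carries the conclusion to all matrices.\<close>

lemma dform_lincomb: "dform P Q i j (\<lambda>a b. c * X a b + Y a b) u = c * dform P Q i j X u + dform P Q i j Y u"
proof -
  have ntr: "ntr N (\<lambda>i j. c * F i j + G i j) = c * ntr N F + ntr N G" for F G
    by (simp add: ntr_def sum.distrib sum_distrib_left add_divide_distrib)
  have "dmom f (\<lambda>q. c * g q + h q) Q = c * dmom f g Q + dmom f h Q" for f g h
    by (simp add: dmom_def case_prod_unfold distrib_right sum_list_addf mult.assoc flip: sum_list_const_mult)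
  then show ?thesis
    by (simp only: dform_def dword_lincomb ntr) (simp add: algebra_simps)
qed

lemma integral_dform_lincomb:
  "(\<integral>\<omega>. dform P Q i j (\<lambda>a b. c * X a b + Y a b) (U \<omega>) \<partial>M)
    = c * (\<integral>\<omega>. dform P Q i j X (U \<omega>) \<partial>M) + (\<integral>\<omega>. dform P Q i j Y (U \<omega>) \<partial>M)"
  unfolding dform_lincomb using integrable_bdd_meas[OF bdd_meas_dform] by simp

lemma integral_dform_zero [simp]: "(\<integral>\<omega>. dform P Q i j (\<lambda>a b. 0) (U \<omega>) \<partial>M) = 0"
  using integral_dform_lincomb[of P Q i j 1 "\<lambda>a b. 0" "\<lambda>a b. 0"] by simp

text \<open>Invariance under the phases makes the expectation constant in t, so the coefficient in
  direction i p p^* integrates to zero; linearity removes the factor i.\<close>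

lemma integral_dform_rank_one:
  assumes "unit_vec N p"
  shows "(\<integral>\<omega>. dform P Q i j (rank_one N p) (U \<omega>) \<partial>M) = 0"
proof -
  let ?X = "\<lambda>i j. \<i> * rank_one N p i j"
  let ?g = "\<lambda>t u. W (mmult N (phase N p t) u) P i j * mom (T (mmult N (phase N p t) u)) Q"
  have first_order: "first_order N ?g (\<lambda>u. W u P i j * mom (T u) Q) (\<lambda>u. dform P Q i j ?X u)"
    unfolding dform_def
    by (intro first_order_mult first_order_mom first_order_ntr first_order_mat_mono_eval) (use first_order_mat_mono_eval[of N A B p P] in \<open>auto simp: first_order_mat_def\<close>)
  have "(\<lambda>u. W u P i j * mom (T u) Q) \<in> borel_measurable borel"
    using bdd_meas_mult[OF bdd_meas_word bdd_meas_mom] unfolding bdd_meas_def by blast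
  from haar_invariant[OF unitary_phase[OF assms] this]
  have "(\<integral>\<omega>. dform P Q i j ?X (U \<omega>) \<partial>M) = 0"
    by (intro integral_first_order_zero[OF first_order])
  then show ?thesis
    using integral_dform_lincomb[of P Q i j \<i> "rank_one N p" "\<lambda>a b. 0"] by simp
qed

text \<open>Polarization: the matrix units are complex combinations of rank-one projections.\<close>

lemma integral_dform_mat_unit:
  assumes "a < N" "b < N"
  shows "(\<integral>\<omega>. dform P Q i j (mat_unit a b) (U \<omega>) \<partial>M) = 0"
proof -
  define e where "e = (\<lambda>c. (\<lambda>i. if i = c then 1 else 0) :: cvec)"
  have ue: "unit_vec N (e c)" if "c < N" for c
  proof -
    have "(\<Sum>i<N. (cmod (e c i))\<^sup>2) = (\<Sum>i<N. if i = c then 1 else 0)"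
      by (rule sum.cong) (auto simp: e_def)
    then show ?thesis using that by (simp add: unit_vec_def)
  qed
  have diag: "mat_unit c c = rank_one N (e c)" if "c < N" for c
    using that by (auto simp: mat_unit_def rank_one_def e_def fun_eq_iff)
  show ?thesis
  proof (cases "a = b")
    case True
    then show ?thesis using diag ue integral_dform_rank_one assms by simp
  next
    case False
    define p where "p = (\<lambda>z i. (e a i + z * e b i) / of_real (sqrt 2))"
    have up: "unit_vec N (p z)" if "cmod z = 1" for z
    proof -
      have "(\<Sum>i<N. (cmod (p z i))\<^sup>2) = (\<Sum>i<N. (if i = a then 1/2 else 0) + (if i = b then 1/2 else 0))"
        using False that by (intro sum.cong) (auto simp: p_def e_def norm_divide norm_mult power_divide)
      then show ?thesis using assms by (simp add: unit_vec_def sum.distrib)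
    qed
    have s2: "complex_of_real (sqrt 2) * complex_of_real (sqrt 2) = 2"
      by (simp flip: of_real_mult)
    \<comment> \<open>The projection onto \<open>p z\<close> is 1/2 (E_aa + E_bb + cnj z E_ab + z
      E_ba). Adding the one for z = 1 to i times the one for z = i leaves E_ab and a diagonal part,
      which is subtracted. The final 0 gives the sum the shape required by
      \<open>integral_dform_lincomb\<close>.\<close>
    have "mat_unit a b = (\<lambda>i j. \<i> * rank_one N (p \<i>) i j + (1 * rank_one N (p 1) i j
       + ((-(1 + \<i>)/2) * rank_one N (e a) i j + ((-(1 + \<i>)/2) * rank_one N (e b) i j + 0))))"
      using False assms s2
      by (auto simp: mat_unit_def rank_one_def p_def e_def fun_eq_iff field_simps)
    then show ?thesis
      by (simp only: integral_dform_lincomb integral_dform_zero integral_dform_rank_one ue up assms norm_one norm_ii) simp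
  qed
qed

text \<open>The (a, b) entry of F E_ab G is \<open>F a a * G b b\<close>, so summation breaks the
  word into two traces; normalizing both yields N^2.\<close>

lemma dword_sum_mat_unit:
  "(\<Sum>a<N. \<Sum>b<N. dword N (Z u) (mat_unit a b) P a b) =
     (of_nat N)\<^sup>2 * (\<Sum>(p, d, s)\<leftarrow>splits [] P. T u p * T u (d # s) - T u (p @ [d]) * T u s)"
proof -
  have *: "(\<Sum>a<N. \<Sum>b<N. F a a * G b b) = (of_nat N)\<^sup>2 * (ntr N F * ntr N G)" for F G :: cmat
    using N_pos by (simp add: ntr_def power2_eq_square sum_product)
  have "(\<Sum>a<N. \<Sum>b<N. dword N (Z u) (mat_unit a b) P a b) =
    (\<Sum>a<N. \<Sum>b<N. \<Sum>(p, d, s)\<leftarrow>splits [] P. W u p a a * W u (d # s) b b - W u (p @ [d]) a a * W u s b b)"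
    by (intro sum.cong refl) (simp add: dword_eq mmult_mat_unit)
  also have "\<dots> = (\<Sum>(p, d, s)\<leftarrow>splits [] P. \<Sum>a<N. \<Sum>b<N. W u p a a * W u (d # s) b b - W u (p @ [d]) a a * W u s b b)"
    by (simp add: sum_sum_list_swap case_prod_unfold)
  also have "\<dots> = (\<Sum>(p, d, s)\<leftarrow>splits [] P. (of_nat N)\<^sup>2 * (T u p * T u (d # s) - T u (p @ [d]) * T u s))"
    by (intro arg_cong[of _ _ sum_list] map_cong refl) (auto simp: sum_subtractf * right_diff_distrib)
  finally show ?thesis by (simp add: case_prod_unfold sum_list_const_mult)
qed

text \<open>Weighted with the entries of \<open>P\<close>, the matrix units add up to
  \<open>P\<close> itself, which is thereby inserted into \<open>q\<close>. Only one normalized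
  trace occurs and no N^2, whence the relative weight N^-2 of mergings.\<close>

lemma dword_contract:
  "(\<Sum>a<N. \<Sum>b<N. W u P a b * ntr N (dword N (Z u) (mat_unit a b) q)) =
     (\<Sum>(p, d, s)\<leftarrow>splits [] q. T u (p @ P @ d # s) - T u (p @ d # P @ s))"
proof -
  have *: "(\<Sum>a<N. \<Sum>b<N. W u P a b * (F i a * G b i)) = mmult N (mmult N F (W u P)) G i i" if "i < N" for F G i
    using that by (simp add: mmult_mmult mult_ac)
  have "(\<Sum>a<N. \<Sum>b<N. W u P a b * ntr N (dword N (Z u) (mat_unit a b) q))
     = (\<Sum>a<N. \<Sum>b<N. \<Sum>i<N. \<Sum>(p, d, s)\<leftarrow>splits [] q. (W u P a b * (W u p i a * W u (d # s) b i) - W u P a b * (W u (p @ [d]) i a * W u s b i)) / of_nat N)"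
    by (intro sum.cong refl) (simp add: ntr_def sum_divide_distrib sum_distrib_left dword_eq mmult_mat_unit
       case_prod_unfold right_diff_distrib diff_divide_distrib divide_inverse mult_ac flip: sum_list_const_mult)
  also have "\<dots> = (\<Sum>i<N. \<Sum>a<N. \<Sum>b<N. \<Sum>(p, d, s)\<leftarrow>splits [] q. (W u P a b * (W u p i a * W u (d # s) b i) - W u P a b * (W u (p @ [d]) i a * W u s b i)) / of_nat N)"
    by (rule sum_swap3)
  also have "\<dots> = (\<Sum>(p, d, s)\<leftarrow>splits [] q. \<Sum>i<N. \<Sum>a<N. \<Sum>b<N. (W u P a b * (W u p i a * W u (d # s) b i) - W u P a b * (W u (p @ [d]) i a * W u s b i)) / of_nat N)"
    by (simp add: sum_sum_list_swap case_prod_unfold)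
  also have "\<dots> = (\<Sum>(p, d, s)\<leftarrow>splits [] q. T u (p @ P @ d # s) - T u (p @ d # P @ s))"
  proof (intro arg_cong[of _ _ sum_list] map_cong refl, clarify)
    fix p d s
    have "(\<Sum>i<N. \<Sum>a<N. \<Sum>b<N. (W u P a b * (W u p i a * W u (d # s) b i) - W u P a b * (W u (p @ [d]) i a * W u s b i)) / of_nat N)
      = ntr N (mmult N (mmult N (W u p) (W u P)) (W u (d # s))) - ntr N (mmult N (mmult N (W u (p @ [d])) (W u P)) (W u s))"
      by (simp add: * ntr_def sum_subtractf flip: sum_divide_distrib diff_divide_distrib)
    then show "(\<Sum>i<N. \<Sum>a<N. \<Sum>b<N. (W u P a b * (W u p i a * W u (d # s) b i) - W u P a b * (W u (p @ [d]) i a * W u s b i)) / of_nat N)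
       = T u (p @ P @ d # s) - T u (p @ d # P @ s)"
      using mono_eval_append[of N "Z u" "p @ [d]" "P @ s"] mono_eval_append[of N "Z u" "p" "P @ d # s"]
      by (simp add: mono_eval_append[of N "Z u" P] mmult_assoc)
  qed
  finally show ?thesis .
qed

definition Mom :: "(var list \<times> complex) list \<Rightarrow> complex" where
  "Mom Q = (\<integral>\<omega>. mom (T (U \<omega>)) Q \<partial>M)"

text \<open>The vanishing expectations of \<open>dform P Q a b (mat_unit a b)\<close> are summed
  over a and b and divided by N^2: the derivative of \<open>P\<close> yields the splittings, that of
  \<open>Q\<close> the mergings.\<close>

lemma schwinger_dyson:
  "(\<Sum>(p, d, s)\<leftarrow>splits [] P. Mom ((p, 0) # (d # s, 0) # Q) - Mom ((p @ [d], 0) # (s, 0) # Q)) +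
   (\<Sum>((q, c), R)\<leftarrow>picks Q. \<Sum>(p, d, s)\<leftarrow>splits [] q. Mom ((p @ P @ d # s, 0) # R) - Mom ((p @ d # P @ s, 0) # R)) / (of_nat N)\<^sup>2 = 0"
proof -
  let ?mg = "\<lambda>u. \<Sum>((q, c), R)\<leftarrow>picks Q. \<Sum>(p, d, s)\<leftarrow>splits [] q. mom (T u) ((p @ P @ d # s, 0) # R) - mom (T u) ((p @ d # P @ s, 0) # R)"
  let ?sp = "\<lambda>u. \<Sum>(p, d, s)\<leftarrow>splits [] P. mom (T u) ((p, 0) # (d # s, 0) # Q) - mom (T u) ((p @ [d], 0) # (s, 0) # Q)"
  have int: "integrable M (\<lambda>\<omega>. \<Sum>x\<leftarrow>xs. f x \<omega>) \<and> (\<integral>\<omega>. (\<Sum>x\<leftarrow>xs. f x \<omega>) \<partial>M) = (\<Sum>x\<leftarrow>xs. \<integral>\<omega>. f x \<omega> \<partial>M)"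
    if "\<And>x. x \<in> set xs \<Longrightarrow> integrable M (f x)" for f :: "'b \<Rightarrow> 'w \<Rightarrow> complex" and xs :: "'b list"
    using that by (induction xs) auto
  have Imom: "integrable M (\<lambda>\<omega>. mom (T (U \<omega>)) R)" for R
    by (rule integrable_bdd_meas[OF bdd_meas_mom])
  have Isub: "integrable M (\<lambda>\<omega>. \<Sum>(p, d, s)\<leftarrow>xs. mom (T (U \<omega>)) (f p d s) - mom (T (U \<omega>)) (g p d s))
     \<and> (\<integral>\<omega>. (\<Sum>(p, d, s)\<leftarrow>xs. mom (T (U \<omega>)) (f p d s) - mom (T (U \<omega>)) (g p d s)) \<partial>M)
       = (\<Sum>(p, d, s)\<leftarrow>xs. Mom (f p d s) - Mom (g p d s))"
    for xs :: "('b \<times> 'c \<times> 'd) list" and f g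
    using int[of xs "\<lambda>(p, d, s) \<omega>. mom (T (U \<omega>)) (f p d s) - mom (T (U \<omega>)) (g p d s)"] Imom
    by (auto simp: case_prod_unfold Mom_def)
  note Ione = Isub[of "\<lambda>p d s. (p @ P @ d # s, 0) # R" "\<lambda>p d s. (p @ d # P @ s, 0) # R" "splits [] q" for q R]
  have Imid: "integrable M (\<lambda>\<omega>. ?mg (U \<omega>)) \<and> (\<integral>\<omega>. ?mg (U \<omega>) \<partial>M)
     = (\<Sum>((q, c), R)\<leftarrow>picks Q. \<Sum>(p, d, s)\<leftarrow>splits [] q. Mom ((p @ P @ d # s, 0) # R) - Mom ((p @ d # P @ s, 0) # R))"
    using int[of "picks Q" "\<lambda>((q, c), R) \<omega>. \<Sum>(p, d, s)\<leftarrow>splits [] q. mom (T (U \<omega>)) ((p @ P @ d # s, 0) # R) - mom (T (U \<omega>)) ((p @ d # P @ s, 0) # R)"]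
      Ione by (simp add: case_prod_unfold del: mom_Cons)
  have "(\<Sum>a<N. \<Sum>b<N. dform P Q a b (mat_unit a b) u) = (of_nat N)\<^sup>2 * ?sp u + ?mg u" for u
  proof -
    have 1: "(\<Sum>a<N. \<Sum>b<N. dword N (Z u) (mat_unit a b) P a b * mom (T u) Q) = (of_nat N)\<^sup>2 * ?sp u"
      unfolding sum_distrib_right[symmetric] dword_sum_mat_unit
      by (simp add: case_prod_unfold left_diff_distrib mult.assoc flip: sum_list_mult_const)
    have "(\<Sum>a<N. \<Sum>b<N. W u P a b * dmom (T u) (\<lambda>q. ntr N (dword N (Z u) (mat_unit a b) q)) Q)
      = (\<Sum>((q, c), R)\<leftarrow>picks Q. \<Sum>a<N. \<Sum>b<N. W u P a b * ntr N (dword N (Z u) (mat_unit a b) q) * mom (T u) R)"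
      by (simp add: dmom_def sum_sum_list_swap case_prod_unfold mult.assoc flip: sum_list_const_mult)
    also have "\<dots> = ?mg u"
      unfolding sum_distrib_right[symmetric] dword_contract
      by (simp add: case_prod_unfold left_diff_distrib flip: sum_list_mult_const)
    finally show ?thesis
      using 1 by (simp add: dform_def sum.distrib)
  qed
  then have "(\<integral>\<omega>. (of_nat N)\<^sup>2 * ?sp (U \<omega>) + ?mg (U \<omega>) \<partial>M) = (\<integral>\<omega>. (\<Sum>a<N. \<Sum>b<N. dform P Q a b (mat_unit a b) (U \<omega>)) \<partial>M)"
    by presburger
  also have "\<dots> = (\<Sum>a<N. \<Sum>b<N. \<integral>\<omega>. dform P Q a b (mat_unit a b) (U \<omega>) \<partial>M)"
    using integrable_bdd_meas[OF bdd_meas_dform] by simp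
  also have "\<dots> = 0" by (simp add: integral_dform_mat_unit)
  finally have "(\<integral>\<omega>. (of_nat N)\<^sup>2 * ?sp (U \<omega>) + ?mg (U \<omega>) \<partial>M) = 0" .
  moreover have "(\<integral>\<omega>. (of_nat N)\<^sup>2 * ?sp (U \<omega>) + ?mg (U \<omega>) \<partial>M)
    = (of_nat N)\<^sup>2 * (\<Sum>(p, d, s)\<leftarrow>splits [] P. Mom ((p, 0) # (d # s, 0) # Q) - Mom ((p @ [d], 0) # (s, 0) # Q)) +
   (\<Sum>((q, c), R)\<leftarrow>picks Q. \<Sum>(p, d, s)\<leftarrow>splits [] q. Mom ((p @ P @ d # s, 0) # R) - Mom ((p @ d # P @ s, 0) # R))"
    using Isub[of "\<lambda>p d s. (p, 0) # (d # s, 0) # Q" "\<lambda>p d s. (p @ [d], 0) # (s, 0) # Q" "splits [] P"] Imid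
    by (simp del: mom_Cons)
  ultimately show ?thesis
    using N_pos by (simp add: field_simps)
qed

end

subsection \<open>Asymptotics of systems satisfying the Schwinger--Dyson equation\<close>

text \<open>There is no absolute value around the bound, so weakening it is a plain inequality, as
  in \<open>bigo_le_mono\<close>.\<close>

definition bigo_le :: "(nat \<Rightarrow> complex) \<Rightarrow> (nat \<Rightarrow> real) \<Rightarrow> bool" where
  "bigo_le f g \<longleftrightarrow> (\<exists>K\<ge>0. \<forall>\<^sub>F N in sequentially. cmod (f N) \<le> K * g N)"

lemma bigo_leI: "\<forall>\<^sub>F N in sequentially. cmod (f N) \<le> K * g N \<Longrightarrow> K \<ge> 0 \<Longrightarrow> bigo_le f g"
  by (auto simp: bigo_le_def)

lemma bigo_le_add:
  assumes "bigo_le f g" "bigo_le h g"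
  shows "bigo_le (\<lambda>N. f N + h N) g"
proof -
  obtain K L where *: "K \<ge> 0" "\<forall>\<^sub>F N in sequentially. cmod (f N) \<le> K * g N" "L \<ge> 0" "\<forall>\<^sub>F N in sequentially. cmod (h N) \<le> L * g N"
    using assms by (auto simp: bigo_le_def)
  from *(2,4) have "\<forall>\<^sub>F N in sequentially. cmod (f N + h N) \<le> (K + L) * g N"
    by eventually_elim (smt (verit) distrib_right norm_triangle_ineq)
  with * show ?thesis by (intro bigo_leI[of _ "K + L"]) auto
qed

lemma bigo_le_mult:
  assumes "bigo_le f g" "bigo_le f' g'"
  shows "bigo_le (\<lambda>N. f N * f' N) (\<lambda>N. g N * g' N)"
proof -
  obtain K L where *: "K \<ge> 0" "\<forall>\<^sub>F N in sequentially. cmod (f N) \<le> K * g N" "L \<ge> 0" "\<forall>\<^sub>F N in sequentially. cmod (f' N) \<le> L * g' N"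
    using assms by (auto simp: bigo_le_def)
  from *(2,4) have "\<forall>\<^sub>F N in sequentially. cmod (f N * f' N) \<le> (K * L) * (g N * g' N)"
  proof eventually_elim
    case (elim N)
    have "cmod (f N) * cmod (f' N) \<le> (K * g N) * (L * g' N)"
      using elim by (intro mult_mono) (auto intro: order_trans[OF norm_ge_zero])
    then show ?case by (simp add: norm_mult mult_ac)
  qed
  with * show ?thesis by (intro bigo_leI[of _ "K * L"]) auto
qed

lemma bigo_le_const: "bigo_le (\<lambda>N. c) (\<lambda>N. 1)"
  by (rule bigo_leI[of _ "cmod c"]) auto

lemma bigo_le_cmult: "bigo_le f g \<Longrightarrow> bigo_le (\<lambda>N. c * f N) g"
  using bigo_le_mult[OF bigo_le_const[of c], of f g] by simp

lemma bigo_le_diff: "bigo_le f g \<Longrightarrow> bigo_le h g \<Longrightarrow> bigo_le (\<lambda>N. f N - h N) g"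
  using bigo_le_add[OF _ bigo_le_cmult[of h g "-1"], of f] by simp

lemma bigo_le_0 [simp]: "bigo_le (\<lambda>N. 0) g"
  unfolding bigo_le_def by (auto intro!: exI[of _ 0])

lemma bigo_le_sum_list:
  "(\<And>x. x \<in> set xs \<Longrightarrow> bigo_le (f x) g) \<Longrightarrow> bigo_le (\<lambda>N. \<Sum>x\<leftarrow>xs. f x N) g"
  by (induction xs) (auto intro: bigo_le_add)

lemma bigo_le_mono:
  assumes "bigo_le f g" "\<forall>\<^sub>F N in sequentially. g N \<le> h N"
  shows "bigo_le f h"
proof -
  obtain K where *: "K \<ge> 0" "\<forall>\<^sub>F N in sequentially. cmod (f N) \<le> K * g N"
    using assms by (auto simp: bigo_le_def)
  from *(2) assms(2) have "\<forall>\<^sub>F N in sequentially. cmod (f N) \<le> K * h N"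
    by eventually_elim (meson "*"(1) mult_left_mono order_trans)
  with * show ?thesis by (auto simp: bigo_le_def)
qed

lemma bigo_le_cong:
  assumes "bigo_le f g" "\<forall>\<^sub>F N in sequentially. f N = h N"
  shows "bigo_le h g"
proof -
  obtain K where *: "K \<ge> 0" "\<forall>\<^sub>F N in sequentially. cmod (f N) \<le> K * g N"
    using assms by (auto simp: bigo_le_def)
  from *(2) assms(2) have "\<forall>\<^sub>F N in sequentially. cmod (h N) \<le> K * g N"
    by eventually_elim simp
  with * show ?thesis by (auto simp: bigo_le_def)
qed

lemma bigo_le_convergent:
  assumes "convergent f"
  shows "bigo_le f (\<lambda>N. 1)"
proof -
  obtain K where "\<And>n. cmod (f n) \<le> K" "K > 0"
    using Bseq_def convergent_imp_Bseq[OF assms] by metis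
  then show ?thesis by (intro bigo_leI[of _ K]) auto
qed

lemma bigo_le_tendsto_0:
  assumes "bigo_le f g" "g \<longlonglongrightarrow> 0"
  shows "f \<longlonglongrightarrow> 0"
proof -
  obtain K where *: "K \<ge> 0" "\<forall>\<^sub>F N in sequentially. cmod (f N) \<le> K * g N"
    using assms by (auto simp: bigo_le_def)
  have "(\<lambda>N. K * g N) \<longlonglongrightarrow> 0" using tendsto_mult_right_zero[OF assms(2)] .
  then show ?thesis using *(2) by (rule Lim_null_comparison[rotated])
qed

section \<open>Pure words and rotation of mixed words\<close>

lemma picks_map: "picks (map f Q) = map (\<lambda>(q, R). (f q, map f R)) (picks Q)"
  by (induction Q) auto

lemma mset_picks: "(q, R) \<in> set (picks Q) \<Longrightarrow> mset Q = add_mset q (mset R)"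
  by (induction Q arbitrary: R) auto

text \<open>The trace of such a word is almost surely independent of \<open>U\<close>, which makes
  these words the base cases of all recursions.\<close>

definition pure :: "var list \<Rightarrow> bool" where
  "pure w \<longleftrightarrow> (\<forall>x\<in>set w. isl x) \<or> (\<forall>x\<in>set w. \<not> isl x)"

text \<open>Read cyclically, a mixed word has an \<open>X\<close>-letter followed by a
  \<open>Y\<close>-letter; it is cut open there.\<close>

lemma not_pure_rotate:
  assumes "\<not> pure w"
  obtains u v y z x where "w = u @ v" "v @ u = y # z @ [x]" "\<not> isl y" "isl x"
proof -
  \<comment> \<open>The place to cut lies inside the word or already between its end and its
    beginning.\<close>
  have "(\<exists>a x y b. w = a @ x # y # b \<and> isl x \<and> \<not> isl y) \<or> (\<exists>y z x. w = y # z @ [x] \<and> \<not> isl y \<and> isl x)"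
    using assms
  proof (induction w)
    case (Cons c w)
    show ?case
    proof (cases "pure w")
      case True
      then consider "w = []" | "w \<noteq> []" "\<forall>x\<in>set w. isl x" | "w \<noteq> []" "\<forall>x\<in>set w. \<not> isl x"
        by (auto simp: pure_def)
      then show ?thesis
      proof cases
        case 1
        then show ?thesis using Cons.prems by (auto simp: pure_def)
      next
        case 2
        then have "\<not> isl c" using Cons.prems by (auto simp: pure_def)
        moreover have "w = butlast w @ [last w]" "isl (last w)" using 2 by auto
        ultimately show ?thesis by blast
      next
        case 3
        then have "isl c" using Cons.prems by (auto simp: pure_def)
        moreover obtain y b where "w = y # b" using 3 by (cases w) auto
        ultimately show ?thesis using 3 by (intro disjI1 exI[of _ "[]"]) auto
      qed
    next
      case False
      with Cons.IH consider a x y b where "w = a @ x # y # b" "isl x" "\<not> isl y" | y z x where "w = y # z @ [x]" "\<not> isl y" "isl x"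
        by blast
      then show ?thesis
      proof cases
        case 1
        then have "c # w = (c # a) @ x # y # b" by simp
        then show ?thesis using 1 by blast
      next
        case 2
        show ?thesis
        proof (cases "isl c")
          case True
          then show ?thesis using 2 by (intro disjI1 exI[of _ "[]"]) auto
        next
          case False
          have "c # w = c # (y # z) @ [x]" using 2 by simp
          then show ?thesis using False 2 by blast
        qed
      qed
    qed
  qed (auto simp: pure_def)
  then show ?thesis
  proof (elim disjE exE conjE)
    fix a x y b assume "w = a @ x # y # b" "isl x" "\<not> isl y"
    then show ?thesis by (intro that[of "a @ [x]" "y # b" y "b @ a" x]) auto
  next
    fix y z x assume "w = y # z @ [x]" "\<not> isl y" "isl x"
    then show ?thesis by (intro that[of "[]" w y z x]) auto
  qed
qed

text \<open>\<open>Mom N Q\<close> stands for the expectation of the product of \<open>tr w - c\<close> over \<open>(w, c)\<close> in \<open>Q\<close>. The letter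
  \<open>Inl k\<close>, one beyond the variables \<open>X\<close>, marks the matrix \<open>N v v\<^sup>*\<close>; hence a word marked twice factors at the price
  of a factor \<open>N\<close>, and limits exist only for words marked at most once.\<close>

locale sd_system =
  fixes k l :: nat and Mom :: "nat \<Rightarrow> (var list \<times> complex) list \<Rightarrow> complex"
  assumes Mom_Nil: "N \<ge> 1 \<Longrightarrow> Mom N [] = 1"
    and Mom_mset: "N \<ge> 1 \<Longrightarrow> mset Q = mset Q' \<Longrightarrow> Mom N Q = Mom N Q'"
    and Mom_shift: "N \<ge> 1 \<Longrightarrow> Mom N ((q, c) # Q) = Mom N ((q, 0) # Q) - c * Mom N Q"
    and Mom_rotate: "N \<ge> 1 \<Longrightarrow> Mom N ((u @ w, c) # Q) = Mom N ((w @ u, c) # Q)"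
    and Mom_empty: "N \<ge> 1 \<Longrightarrow> Mom N (([], 0) # Q) = Mom N Q"
    and Mom_pure: "N \<ge> 1 \<Longrightarrow> pure w \<Longrightarrow> Mom N ((w, 0) # Q) = Mom N [(w, 0)] * Mom N Q"
    and Mom_double: "N \<ge> 1 \<Longrightarrow> Mom N ((Inl k # u @ Inl k # w, 0) # Q) = of_nat N * Mom N ((Inl k # u, 0) # (Inl k # w, 0) # Q)"
    and Mom_SD: "N \<ge> 1 \<Longrightarrow>
        (\<Sum>(p, d, s)\<leftarrow>splits [] P. Mom N ((p, 0) # (d # s, 0) # Q) - Mom N ((p @ [d], 0) # (s, 0) # Q)) +
        (\<Sum>((q, c), R)\<leftarrow>picks Q. \<Sum>(p, d, s)\<leftarrow>splits [] q. Mom N ((p @ P @ d # s, 0) # R) - Mom N ((p @ d # P @ s, 0) # R)) / (of_nat N)\<^sup>2 = 0"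
    and pure_convergent: "pure w \<Longrightarrow> set w \<subseteq> insert (Inl k) (Xvars k \<union> Yvars l) \<Longrightarrow> count (mset w) (Inl k) \<le> 1
        \<Longrightarrow> convergent (\<lambda>N. Mom N [(w, 0)])"
begin

section \<open>Solving the equation for a mixed word\<close>

definition adm :: "var list \<Rightarrow> bool" where
  "adm w \<longleftrightarrow> set w \<subseteq> insert (Inl k) (Xvars k \<union> Yvars l) \<and> count (mset w) (Inl k) \<le> 1"

lemma adm_mset_mono:
  assumes "adm w" "mset u \<subseteq># mset w"
  shows "adm u"
proof -
  have "set u \<subseteq> set w" using assms(2) by (metis set_mset_mono set_mset_mset)
  moreover have "count (mset u) (Inl k) \<le> count (mset w) (Inl k)"
    using assms(2) by (simp add: mset_subset_eq_count)
  ultimately show ?thesis using assms(1) by (auto simp: adm_def)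
qed

lemma adm_mset_cong: "adm w \<Longrightarrow> mset u = mset w \<Longrightarrow> adm u"
  using adm_mset_mono by force

text \<open>The centering constants are sequences here, because a trace is centered at its
  expectation, which varies with \<open>N\<close>.\<close>

definition MomS :: "(var list \<times> (nat \<Rightarrow> complex)) list \<Rightarrow> nat \<Rightarrow> complex" where
  "MomS Q N = Mom N (map (\<lambda>(q, c). (q, c N)) Q)"

abbreviation pl :: "var list \<Rightarrow> var list \<times> (nat \<Rightarrow> complex)" where
  "pl q \<equiv> (q, \<lambda>_. 0)"

definition m :: "var list \<Rightarrow> nat \<Rightarrow> complex" where
  "m w N = Mom N [(w, 0)]"

abbreviation ce :: "var list \<Rightarrow> var list \<times> (nat \<Rightarrow> complex)" where
  "ce q \<equiv> (q, m q)"

lemma MomS_mset: "mset Q = mset Q' \<Longrightarrow> N \<ge> 1 \<Longrightarrow> MomS Q N = MomS Q' N"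
  unfolding MomS_def by (intro Mom_mset) auto

lemma MomS_ce: "N \<ge> 1 \<Longrightarrow> MomS (ce q # Q) N = MomS (pl q # Q) N - m q N * MomS Q N"
  unfolding MomS_def using Mom_shift[of N q "m q N"] by simp

lemma m_eq: "m q N = MomS [pl q] N"
  by (simp add: m_def MomS_def)

text \<open>A merged word has at most two marks. With at most one it is admissible, and N^-2 <= 1/N.
  With two it is rotated to begin with a mark and factored by \<open>Mom_double\<close>, whose
  factor N leaves 1/N. The list \<open>ws\<close> in the hypothesis covers both outcomes, one word
  or two.\<close>

lemma merge_bound:
  assumes P: "adm P" and q: "adm q" and q0: "q \<noteq> []"
    and eq: "mset w = mset P + mset q"
    and bd: "\<And>ws. (\<forall>w\<in>set ws. adm w \<and> w \<noteq> []) \<Longrightarrow> mset (concat ws) = mset P + mset q \<Longrightarrow> bigo_le (MomS (map pl ws @ R)) g"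
  shows "bigo_le (\<lambda>N. MomS (pl w # R) N / (of_nat N)\<^sup>2) (\<lambda>N. g N / real N)"
proof -
  have sw: "set w \<subseteq> insert (Inl k) (Xvars k \<union> Yvars l)"
    using P q arg_cong[OF eq, of set_mset] by (auto simp: adm_def)
  have w0: "w \<noteq> []" using eq q0 by auto
  show ?thesis
  proof (cases "count (mset w) (Inl k) \<le> 1")
    case True
    then have "bigo_le (MomS (map pl [w] @ R)) g"
      using sw eq w0 by (intro bd) (auto simp: adm_def)
    then obtain K where K: "K \<ge> 0" "\<forall>\<^sub>F N in sequentially. cmod (MomS (pl w # R) N) \<le> K * g N"
      by (auto simp: bigo_le_def)
    from K(2) eventually_ge_at_top[of 1] have "\<forall>\<^sub>F N in sequentially. cmod (MomS (pl w # R) N / (of_nat N)\<^sup>2) \<le> K * (g N / real N)"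
    proof eventually_elim
      case (elim N)
      then have "cmod (MomS (pl w # R) N) / (real N)\<^sup>2 \<le> cmod (MomS (pl w # R) N) / real N"
        by (intro divide_left_mono) (auto simp: power2_eq_square)
      also have "\<dots> \<le> K * g N / real N" using elim by (intro divide_right_mono) auto
      finally show ?case by (simp add: norm_divide norm_power)
    qed
    with K(1) show ?thesis by (auto simp: bigo_le_def)
  next
    case False
    then have "Inl k \<in> set w" by (metis count_inI le_zero_eq nat_le_linear set_mset_mset zero_le_one)
    then obtain a b where w1: "w = a @ Inl k # b" using split_list by metis
    then have "Inl k \<in> set (b @ a)" using False by (auto simp: count_eq_zero_iff not_le)
    then obtain c e where w2: "b @ a = c @ Inl k # e" using split_list by metis
    have c2: "count (mset w) (Inl k) \<le> 2" using P q eq by (auto simp: adm_def)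
    have mw: "mset w = mset (Inl k # c) + mset (Inl k # e)"
      using w1 arg_cong[OF w2, of mset] by (simp add: ac_simps)
    have "count (mset w) (Inl k) = count (mset c) (Inl k) + count (mset e) (Inl k) + 2"
      using mw by simp
    moreover have "set w = insert (Inl k) (set c \<union> set e)"
      using arg_cong[OF mw, of set_mset] by auto
    ultimately have "adm (Inl k # c)" "adm (Inl k # e)"
      using sw c2 by (auto simp: adm_def)
    then have "bigo_le (MomS (map pl [Inl k # c, Inl k # e] @ R)) g"
      using mw eq by (intro bd) auto
    then obtain K where K: "K \<ge> 0" "\<forall>\<^sub>F N in sequentially. cmod (MomS (pl (Inl k # c) # pl (Inl k # e) # R) N) \<le> K * g N"
      by (auto simp: bigo_le_def)
    have eqN: "MomS (pl w # R) N = of_nat N * MomS (pl (Inl k # c) # pl (Inl k # e) # R) N" if "N \<ge> 1" for N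
      unfolding MomS_def using Mom_rotate[OF that, of a "Inl k # b" 0] Mom_double[OF that, of c e] w1 w2 by simp
    from K(2) eventually_ge_at_top[of 1] have "\<forall>\<^sub>F N in sequentially. cmod (MomS (pl w # R) N / (of_nat N)\<^sup>2) \<le> K * (g N / real N)"
    proof eventually_elim
      case (elim N)
      then show ?case by (simp add: eqN norm_divide norm_mult norm_power power2_eq_square divide_right_mono)
    qed
    with K(1) show ?thesis by (auto simp: bigo_le_def)
  qed
qed

text \<open>The equation in solved form: \<open>P\<close> is replaced by signed pairs of nonempty
  words, up to an error g/N, where g bounds whatever a merging can produce. Keeping g arbitrary lets
  the same fact serve boundedness, decay of centered moments and convergence.\<close>

definition sd_split :: "var list \<Rightarrow> (complex \<times> var list \<times> var list) list \<Rightarrow> bool" where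
  "sd_split P spl \<longleftrightarrow>
    (\<forall>(e, w1, w2)\<in>set spl. w1 \<noteq> [] \<and> w2 \<noteq> [] \<and> mset P = mset w1 + mset w2) \<and>
    (\<forall>Q g. (\<forall>(q, c)\<in>set Q. adm q) \<longrightarrow>
        (\<forall>q c R ws. ((q, c), R) \<in> set (picks Q) \<longrightarrow> (\<forall>w\<in>set ws. adm w \<and> w \<noteq> []) \<longrightarrow>
            mset (concat ws) = mset P + mset q \<longrightarrow> bigo_le (MomS (map pl ws @ R)) g) \<longrightarrow>
        bigo_le (\<lambda>N. MomS (pl P # Q) N - (\<Sum>(e, w1, w2)\<leftarrow>spl. e * MomS (pl w1 # pl w2 # Q) N)) (\<lambda>N. g N / real N))"

lemma sd_splitD:
  assumes "sd_split P spl"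
  shows "(e, w1, w2) \<in> set spl \<Longrightarrow> w1 \<noteq> [] \<and> w2 \<noteq> [] \<and> mset P = mset w1 + mset w2"
    "(\<And>q c. (q, c) \<in> set Q \<Longrightarrow> adm q) \<Longrightarrow>
        (\<And>q c R ws. ((q, c), R) \<in> set (picks Q) \<Longrightarrow> (\<forall>w\<in>set ws. adm w \<and> w \<noteq> []) \<Longrightarrow>
            mset (concat ws) = mset P + mset q \<Longrightarrow> bigo_le (MomS (map pl ws @ R)) g) \<Longrightarrow>
        bigo_le (\<lambda>N. MomS (pl P # Q) N - (\<Sum>(e, w1, w2)\<leftarrow>spl. e * MomS (pl w1 # pl w2 # Q) N)) (\<lambda>N. g N / real N)"
  using assms unfolding sd_split_def by blast+

text \<open>After the rotation the splitting before the first letter y is the pair of the empty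
  word, of trace 1, and \<open>P\<close> itself; everything else goes to the other side of the
  equation.\<close>

lemma SD_mixed:
  assumes P: "adm P" "\<not> pure P"
  shows "\<exists>spl. sd_split P spl"
proof -
  obtain u v y z x where r: "P = u @ v" "v @ u = y # z @ [x]" "\<not> isl y" "isl x"
    using not_pure_rotate[OF P(2)] by metis
  have mP: "mset P = mset (y # z @ [x])" using r(1,2) by (metis mset_append add.commute)
  let ?S = "splits [y] (z @ [x])"
  let ?P = "y # z @ [x]"
  have S: "p \<noteq> [] \<and> s \<noteq> [] \<and> mset P = mset p + mset (d # s)" if "(p, d, s) \<in> set ?S" for p d s
  proof -
    have *: "p @ d # s = [y] @ (z @ [x])" "\<not> isl d" "length [y] \<le> length p"
      using splits_append_eq[OF that] by auto
    \<comment> \<open>The word ends in an \<open>X\<close>-letter and d is a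
      \<open>Y\<close>-letter, so some letter follows d.\<close>
    have "last (p @ d # s) = x" using *(1) by simp
    then have "s \<noteq> []" using *(2) r(4) by auto
    moreover have "mset P = mset p + mset (d # s)" using *(1) mP by (metis append_Cons append_Nil mset_append)
    ultimately show ?thesis using * by auto
  qed
  \<comment> \<open>The first entry is the cut behind y. The cuts behind and before later
    \<open>Y\<close>-letters follow, with opposite signs.\<close>
  define spl where "spl = (1 :: complex, [y], z @ [x]) # map (\<lambda>(p, d, s). (1, p @ [d], s)) ?S @ map (\<lambda>(p, d, s). (-1, p, d # s)) ?S"
  show ?thesis
    unfolding sd_split_def
  proof (intro exI[of _ spl] conjI ballI allI impI, clarify)
    fix e w1 w2 assume "(e, w1, w2) \<in> set spl"
    then consider "w1 = [y]" "w2 = z @ [x]" | p d s where "(p, d, s) \<in> set ?S" "w1 = p @ [d]" "w2 = s"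
      | p d s where "(p, d, s) \<in> set ?S" "w1 = p" "w2 = d # s"
      by (auto simp: spl_def)
    then show "w1 \<noteq> [] \<and> w2 \<noteq> [] \<and> mset P = mset w1 + mset w2"
    proof cases
      case 1
      then show ?thesis using mP by auto
    next
      case 2
      then show ?thesis using S[OF 2(1)] by auto
    next
      case 3
      then show ?thesis using S[OF 3(1)] by auto
    qed
  next
    fix Q :: "(var list \<times> (nat \<Rightarrow> complex)) list" and g :: "nat \<Rightarrow> real"
    assume Q: "\<forall>(q, c)\<in>set Q. adm q"
      and bd0: "\<forall>q c R ws. ((q, c), R) \<in> set (picks Q) \<longrightarrow> (\<forall>w\<in>set ws. adm w \<and> w \<noteq> []) \<longrightarrow>
            mset (concat ws) = mset P + mset q \<longrightarrow> bigo_le (MomS (map pl ws @ R)) g"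
    have bd: "bigo_le (MomS (map pl ws @ R)) g"
      if "((q, c), R) \<in> set (picks Q)" "\<forall>w\<in>set ws. adm w \<and> w \<noteq> []" "mset (concat ws) = mset P + mset q" for q c R ws
      using bd0 that by blast
    let ?mg = "\<lambda>N. \<Sum>((q, c), R)\<leftarrow>picks Q. \<Sum>(p, d, s)\<leftarrow>splits [] q.
        (-1) * (MomS (pl (p @ ?P @ d # s) # R) N / (of_nat N)\<^sup>2 - MomS (pl (p @ d # ?P @ s) # R) N / (of_nat N)\<^sup>2)"
    have 1: "bigo_le ?mg (\<lambda>N. g N / real N)"
    proof (intro bigo_le_sum_list, clarify)
      fix q c R assume qR: "((q, c), R) \<in> set (picks Q)"
      then have "(q, c) \<in> set Q" using mset_picks[OF qR] by (metis set_mset_mset union_single_eq_member)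
      then have "adm q" using Q by auto
      show "bigo_le (\<lambda>N. \<Sum>(p, d, s)\<leftarrow>splits [] q. (-1) * (MomS (pl (p @ ?P @ d # s) # R) N / (of_nat N)\<^sup>2 - MomS (pl (p @ d # ?P @ s) # R) N / (of_nat N)\<^sup>2)) (\<lambda>N. g N / real N)"
      proof (intro bigo_le_sum_list, clarify)
        fix p d s assume d: "(p, d, s) \<in> set (splits [] q)"
        have q0: "q \<noteq> []" using d by auto
        have mq: "mset q = mset p + add_mset d (mset s)"
          using splits_append_eq[OF d] by (metis append_Nil mset.simps(2) mset_append)
        have "bigo_le (\<lambda>N. MomS (pl w # R) N / (of_nat N)\<^sup>2) (\<lambda>N. g N / real N)" if "mset w = mset P + mset q" for w
          using merge_bound[OF P(1) \<open>adm q\<close> q0 that] bd[OF qR] by blast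
        then show "bigo_le (\<lambda>N. (-1) * (MomS (pl (p @ ?P @ d # s) # R) N / (of_nat N)\<^sup>2 - MomS (pl (p @ d # ?P @ s) # R) N / (of_nat N)\<^sup>2)) (\<lambda>N. g N / real N)"
          by (intro bigo_le_cmult bigo_le_diff) (simp_all add: mP mq)
      qed
    qed
    have 2: "MomS (pl P # Q) N - (\<Sum>(e, w1, w2)\<leftarrow>spl. e * MomS (pl w1 # pl w2 # Q) N) = ?mg N" if N: "N \<ge> 1" for N
    proof -
      have a: "MomS (pl P # Q) N = MomS (pl ?P # Q) N"
        unfolding MomS_def using Mom_rotate[OF N, of u v 0] r by simp
      have b: "MomS (pl [] # Q') N = MomS Q' N" for Q'
        unfolding MomS_def using Mom_empty[OF N] by simp
      have e1: "(\<Sum>(p, d, s)\<leftarrow>splits [] ?P. MomS (pl p # pl (d # s) # Q) N - MomS (pl (p @ [d]) # pl s # Q) N) +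
        (\<Sum>((q, c), R)\<leftarrow>picks Q. \<Sum>(p, d, s)\<leftarrow>splits [] q. MomS (pl (p @ ?P @ d # s) # R) N - MomS (pl (p @ d # ?P @ s) # R) N) / (of_nat N)\<^sup>2 = 0"
        using Mom_SD[OF N, where P = ?P and Q = "map (\<lambda>(q, c). (q, c N)) Q"]
        by (simp add: MomS_def picks_map case_prod_unfold o_def)
      have e2: "(\<Sum>(p, d, s)\<leftarrow>splits [] ?P. MomS (pl p # pl (d # s) # Q) N - MomS (pl (p @ [d]) # pl s # Q) N)
        = MomS (pl ?P # Q) N - (\<Sum>(e, w1, w2)\<leftarrow>spl. e * MomS (pl w1 # pl w2 # Q) N)"
        using r(3) by (simp add: b spl_def case_prod_unfold o_def sum_list_subtractf uminus_sum_list_map)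
      have e3: "?mg N = - ((\<Sum>((q, c), R)\<leftarrow>picks Q. \<Sum>(p, d, s)\<leftarrow>splits [] q. MomS (pl (p @ ?P @ d # s) # R) N - MomS (pl (p @ d # ?P @ s) # R) N) / (of_nat N)\<^sup>2)"
        by (simp add: case_prod_unfold divide_inverse uminus_sum_list_map o_def left_diff_distrib flip: sum_list_mult_const)
      show ?thesis
        using e1 unfolding a e2 e3 by (simp only: eq_neg_iff_add_eq_0)
    qed
    show "bigo_le (\<lambda>N. MomS (pl P # Q) N - (\<Sum>(e, w1, w2)\<leftarrow>spl. e * MomS (pl w1 # pl w2 # Q) N)) (\<lambda>N. g N / real N)"
      by (intro bigo_le_cong[OF 1] eventually_mono[OF eventually_ge_at_top[of 1]]) (rule 2[symmetric])
  qed
qed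

end

section \<open>Boundedness, centered moments and convergence\<close>

lemma bigo_le_sum:
  "finite I \<Longrightarrow> (\<And>x. x \<in> I \<Longrightarrow> bigo_le (f x) g) \<Longrightarrow> bigo_le (\<lambda>N. \<Sum>x\<in>I. f x N) g"
  by (induction I rule: finite_induct) (auto intro: bigo_le_add)

lemma picks_append:
  "(x, R) \<in> set (picks (X @ Y)) \<Longrightarrow>
    (\<exists>X'. (x, X') \<in> set (picks X) \<and> R = X' @ Y) \<or> (\<exists>Y'. (x, Y') \<in> set (picks Y) \<and> R = X @ Y')"
proof (induction X arbitrary: R)
  case (Cons a X)
  then consider "x = a" "R = X @ Y" | R' where "(x, R') \<in> set (picks (X @ Y))" "R = a # R'"
    by auto
  then show ?case
  proof cases
    case 2
    then show ?thesis using Cons.IH[OF 2(1)] by force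
  qed auto
qed simp

lemma picks_length: "(x, R) \<in> set (picks X) \<Longrightarrow> length X = Suc (length R)"
  using mset_picks[of x R X] by (metis size_add_mset size_mset)

lemma mset_concat_cong: "mset X = mset Y \<Longrightarrow> mset (concat X) = mset (concat Y)"
  by (metis mset_concat mset_map sum_mset_sum_list)

context sd_system
begin

lemma MomS_cong:
  assumes "mset Q = mset Q'" "bigo_le (MomS Q) g"
  shows "bigo_le (MomS Q') g"
  using eventually_mono[OF eventually_ge_at_top[of 1] MomS_mset[OF assms(1)]] by (rule bigo_le_cong[OF assms(2)])

lemma MomS_pure_bound:
  "(\<And>w. w \<in> set Q \<Longrightarrow> adm w \<and> pure w) \<Longrightarrow> bigo_le (MomS (map pl Q)) (\<lambda>N. 1)"
proof (induction Q)
  case Nil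
  show ?case
    using bigo_le_const[of 1]
    by (rule bigo_le_cong) (auto intro!: eventually_mono[OF eventually_ge_at_top[of 1]] simp: MomS_def Mom_Nil)
next
  case (Cons w Q)
  have "convergent (m w)"
    unfolding m_def using Cons.prems by (intro pure_convergent) (auto simp: adm_def)
  then have "bigo_le (\<lambda>N. m w N * MomS (map pl Q) N) (\<lambda>N. 1 * 1)"
    using bigo_le_mult[OF bigo_le_convergent Cons.IH] Cons.prems by simp
  then show ?case
    using Cons.prems
    by (intro bigo_le_cong[of _ "\<lambda>N. 1" "MomS (map pl (w # Q))"])
      (auto intro!: eventually_mono[OF eventually_ge_at_top[of 1]] simp: m_def MomS_def Mom_pure[of _ w "map _ _"])
qed

text \<open>A splitting increases the number of words at constant total length, so it can be iterated only finitely often,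
  and a merging costs a factor \<open>1 / N\<close>. The sum \<open>Y\<close> of all moments of a given total length therefore satisfies
  \<open>Y \<le> K (1 + Y / N)\<close>, and the last term can be absorbed.\<close>

lemma bounded_nonempty:
  assumes Q: "\<And>w. w \<in> set Q \<Longrightarrow> adm w \<and> w \<noteq> []"
  shows "bigo_le (MomS (map pl Q)) (\<lambda>N. 1)"
proof -
  define L where "L = length (concat Q)"
  \<comment> \<open>Splitting and merging both preserve the total length, so the recursion never
    leaves this family; nonempty words make it finite.\<close>
  define F where "F = {Q. (\<forall>w\<in>set Q. adm w \<and> w \<noteq> []) \<and> length (concat Q) = L}"
  have length_F: "length Q \<le> L" if "Q \<in> F" for Q
  proof -
    have "\<forall>w\<in>set Q. w \<noteq> [] \<Longrightarrow> length Q \<le> length (concat Q)" for Q :: "var list list"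
    proof (induction Q)
      case (Cons a Q)
      then show ?case by (cases a) auto
    qed simp
    then show ?thesis using that by (auto simp: F_def)
  qed
  have "finite F"
  proof (rule finite_subset)
    let ?V = "insert (Inl k) (Xvars k \<union> Yvars l)"
    let ?W = "{w. set w \<subseteq> ?V \<and> length w \<le> L}"
    show "F \<subseteq> {Q. set Q \<subseteq> ?W \<and> length Q \<le> L}"
    proof
      fix Q assume QF: "Q \<in> F"
      have "length w \<le> L" if w: "w \<in> set Q" for w
        using QF split_list[OF w] by (auto simp: F_def)
      then show "Q \<in> {Q. set Q \<subseteq> ?W \<and> length Q \<le> L}"
        using length_F[OF QF] QF by (auto simp: F_def adm_def)
    qed
    show "finite {Q. set Q \<subseteq> ?W \<and> length Q \<le> L}"
      by (intro finite_lists_length_le) (simp add: Xvars_def Yvars_def)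
  qed
  define Y where "Y = (\<lambda>N. \<Sum>Q\<in>F. cmod (MomS (map pl Q) N))"
  have Y_nonneg: "Y N \<ge> 0" for N by (simp add: Y_def sum_nonneg)
  have le_Y: "bigo_le (MomS (map pl Q)) Y" if "Q \<in> F" for Q
    using member_le_sum[OF that _ \<open>finite F\<close>, of "\<lambda>Q. cmod (MomS (map pl Q) _)"]
    by (intro bigo_leI[of _ 1]) (auto simp: Y_def)
  have main: "bigo_le (MomS (map pl Q)) (\<lambda>N. 1 + Y N / real N)" if "Q \<in> F" for Q
    using that
  proof (induction "L - length Q" arbitrary: Q rule: less_induct)
    case less
    then have QF: "\<And>w. w \<in> set Q \<Longrightarrow> adm w \<and> w \<noteq> []" "length (concat Q) = L" by (auto simp: F_def)
    show ?case
    proof (cases "\<forall>w\<in>set Q. pure w")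
      case True
      then have "bigo_le (MomS (map pl Q)) (\<lambda>N. 1)" using QF by (intro MomS_pure_bound) auto
      then show ?thesis by (rule bigo_le_mono) (auto simp: Y_nonneg)
    next
      case False
      then obtain P where P: "P \<in> set Q" "\<not> pure P" by auto
      define Q' where "Q' = remove1 P Q"
      have mQ: "mset Q = mset (P # Q')" using P by (simp add: Q'_def)
      have sQ: "set Q = insert P (set Q')" using arg_cong[OF mQ, of set_mset] by simp
      have lQ: "length Q = Suc (length Q')" using arg_cong[OF mQ, of size] by simp
      have mcQ: "mset (concat Q) = mset P + mset (concat Q')"
        using mset_concat_cong[OF mQ] by simp
      have lcQ: "L = length P + length (concat Q')"
        using arg_cong[OF mcQ, of size] QF(2) by simp
      obtain spl where split: "sd_split P spl"
        using SD_mixed[OF _ P(2)] QF P(1) by blast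
      note spl = sd_splitD(1)[OF split] and sd = sd_splitD(2)[OF split]
      have "bigo_le (\<lambda>N. MomS (pl P # map pl Q') N - (\<Sum>(e, w1, w2)\<leftarrow>spl. e * MomS (pl w1 # pl w2 # map pl Q') N)) (\<lambda>N. Y N / real N)"
      proof (rule sd)
        show "adm q" if "(q, c) \<in> set (map pl Q')" for q c using that QF sQ by auto
        fix q c R ws
        assume R: "((q, c), R) \<in> set (picks (map pl Q'))" and ws: "\<forall>w\<in>set ws. adm w \<and> w \<noteq> []" "mset (concat ws) = mset P + mset q"
        from R obtain R' where R': "(q, R') \<in> set (picks Q')" "R = map pl R'" by (auto simp: picks_map)
        have mQ': "mset Q' = mset (q # R')" using mset_picks[OF R'(1)] by simp
        have "set Q' = insert q (set R')" using arg_cong[OF mQ', of set_mset] by simp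
        moreover have "mset (concat Q') = mset q + mset (concat R')"
          using mset_concat_cong[OF mQ'] by simp
        then have "length (concat Q') = length q + length (concat R')" by (metis size_mset size_union)
        moreover have "length (concat ws) = length P + length q" using ws(2) by (metis size_mset size_union)
        ultimately have "ws @ R' \<in> F"
          using QF sQ lcQ ws(1) by (auto simp: F_def)
        from le_Y[OF this] show "bigo_le (MomS (map pl ws @ R)) Y" by (simp add: R'(2))
      qed
      then have 1: "bigo_le (\<lambda>N. MomS (pl P # map pl Q') N - (\<Sum>(e, w1, w2)\<leftarrow>spl. e * MomS (pl w1 # pl w2 # map pl Q') N)) (\<lambda>N. 1 + Y N / real N)"
        by (rule bigo_le_mono) simp
      have 2: "bigo_le (\<lambda>N. \<Sum>(e, w1, w2)\<leftarrow>spl. e * MomS (pl w1 # pl w2 # map pl Q') N) (\<lambda>N. 1 + Y N / real N)"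
      proof (intro bigo_le_sum_list, clarify, intro bigo_le_cmult)
        fix e w1 w2 assume e: "(e, w1, w2) \<in> set spl"
        note s = spl[OF e]
        have "adm P" using QF P by auto
        then have "adm w1" "adm w2" using s by (auto intro: adm_mset_mono[of P])
        moreover have "length P = length w1 + length w2" using s by (metis size_mset size_union)
        ultimately have new: "w1 # w2 # Q' \<in> F" using s QF sQ lcQ by (auto simp: F_def)
        from length_F[OF new] have "L - length (w1 # w2 # Q') < L - length Q" using lQ by simp
        from less.hyps[OF this new] show "bigo_le (MomS (pl w1 # pl w2 # map pl Q')) (\<lambda>N. 1 + Y N / real N)" by simp
      qed
      have "bigo_le (MomS (map pl (P # Q'))) (\<lambda>N. 1 + Y N / real N)"
        using bigo_le_add[OF 1 2] by simp
      then show ?thesis by (rule MomS_cong[rotated]) (use mQ in auto)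
    qed
  qed
  have "bigo_le (\<lambda>N. \<Sum>Q\<in>F. of_real (cmod (MomS (map pl Q) N))) (\<lambda>N. 1 + Y N / real N)"
    using main by (intro bigo_le_sum \<open>finite F\<close>) (simp add: bigo_le_def)
  then obtain K where K: "K \<ge> 0" "\<forall>\<^sub>F N in sequentially. Y N \<le> K * (1 + Y N / real N)"
    using Y_nonneg by (auto simp: bigo_le_def Y_def simp flip: of_real_sum)
  \<comment> \<open>Once N >= 2 K, the term K Y / N is at most Y / 2 and can be absorbed.\<close>
  obtain n0 :: nat where n0: "2 * K \<le> real n0" using real_arch_simple by blast
  from K(2) eventually_ge_at_top[of "max 1 n0"] have "\<forall>\<^sub>F N in sequentially. Y N \<le> 2 * K"
  proof eventually_elim
    case (elim N)
    then have N: "N \<ge> 1" "real N \<ge> 2 * K" using n0 by auto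
    have "K * (Y N / real N) \<le> Y N / 2"
      using N mult_right_mono[OF N(2) Y_nonneg[of N]] by (simp add: field_simps)
    moreover have "K * (1 + Y N / real N) = K + K * (Y N / real N)" by (simp only: distrib_left mult_1_right)
    ultimately show ?case using elim(1) by linarith
  qed
  moreover have "Q \<in> F" using Q by (auto simp: F_def L_def)
  then have "cmod (MomS (map pl Q) N) \<le> Y N" for N
    using member_le_sum[of Q F "\<lambda>Q. cmod (MomS (map pl Q) N)"] \<open>finite F\<close> by (auto simp: Y_def)
  ultimately have "\<forall>\<^sub>F N in sequentially. cmod (MomS (map pl Q) N) \<le> (2 * K) * 1"
    by (auto elim!: eventually_mono intro: order_trans)
  then show ?thesis
    using K(1) by (intro bigo_leI[of _ "2 * K"]) auto
qed

text \<open>Empty words have trace 1 and may be dropped. They were excluded before because the total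
  length does not control their number.\<close>

lemma MomS_bounded:
  assumes "\<And>w. w \<in> set Q \<Longrightarrow> adm w"
  shows "bigo_le (MomS (map pl Q)) (\<lambda>N. 1)"
proof -
  have "MomS (map pl (A @ Q)) N = MomS (map pl (A @ filter (\<lambda>w. w \<noteq> []) Q)) N" if N: "N \<ge> 1" for N A
  proof (induction Q arbitrary: A)
    case (Cons w Q)
    show ?case
    proof (cases "w = []")
      case True
      have "MomS (map pl (A @ w # Q)) N = MomS (pl [] # map pl (A @ Q)) N"
        using True N by (intro MomS_mset) auto
      also have "\<dots> = MomS (map pl (A @ Q)) N"
        using Mom_empty[OF N] by (simp add: MomS_def)
      finally show ?thesis using Cons True by simp
    next
      case False
      then show ?thesis using Cons[of "A @ [w]"] by simp
    qed
  qed simp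
  from this[where A = "[]"]
  have "\<forall>\<^sub>F N in sequentially. MomS (map pl (filter (\<lambda>w. w \<noteq> []) Q)) N = MomS (map pl Q) N"
    by (intro eventually_mono[OF eventually_ge_at_top[of 1]]) simp
  then show ?thesis
    using assms by (intro bigo_le_cong[OF bounded_nonempty]) auto
qed

end

lemma tendsto_sum_list:
  "(\<And>x. x \<in> set xs \<Longrightarrow> (f x \<longlongrightarrow> L x) F) \<Longrightarrow> ((\<lambda>N. \<Sum>x\<leftarrow>xs. f x N) \<longlongrightarrow> (\<Sum>x\<leftarrow>xs. L x :: complex)) F"
  by (induction xs) (auto intro!: tendsto_add)

context sd_system
begin

text \<open>Each merging removes at most one further centered factor and costs \<open>1 / N\<close>: a factor \<open>1 / sqrt N\<close> for each of
  the two centered traces involved.\<close>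

lemma MomS_centered:
  assumes "\<And>w. w \<in> set S \<union> set Q \<Longrightarrow> adm w"
  shows "bigo_le (MomS (map ce S @ map pl Q)) (\<lambda>N. (1 / sqrt (real N)) ^ length S)"
  using assms
proof (induction "length S" arbitrary: S Q rule: less_induct)
  case less
  define h where "h = (\<lambda>N. 1 / sqrt (real N))"
  have h1: "0 \<le> h N" "h N \<le> 1" if "N \<ge> 1" for N
    using that by (auto simp: h_def)
  have h_mono: "\<forall>\<^sub>F N in sequentially. h N ^ a \<le> h N ^ b" if "b \<le> a" for a b
    using that h1 by (intro eventually_mono[OF eventually_ge_at_top[of 1]]) (auto intro: power_decreasing)
  show ?case
  proof (cases "length S")
    case 0
    then show ?thesis using MomS_bounded[of Q] less.prems by simp
  next
    case (Suc n)
    have outer: "bigo_le (MomS (map ce S' @ map pl Q)) (\<lambda>N. h N ^ length S')"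
      if "length S' \<le> n" "\<And>w. w \<in> set S' \<union> set Q \<Longrightarrow> adm w" for S' Q
      unfolding h_def using less.hyps[of S' Q] that Suc by simp
    \<comment> \<open>The two lost factors are paid for by 1/N. For n = 0 the truncated exponent is
      0, and 1/N is still below 1/sqrt N.\<close>
    have h_div: "\<forall>\<^sub>F N in sequentially. h N ^ (n - 1) / real N \<le> h N ^ Suc n"
    proof (intro eventually_mono[OF eventually_ge_at_top[of 1]])
      fix N :: nat assume N: "1 \<le> N"
      have "h N ^ (n - 1) / real N = h N ^ (n - 1) * (h N * h N)"
        using N by (simp add: h_def)
      also have "\<dots> = h N ^ (n - 1 + 2)" by (simp add: power_add power2_eq_square)
      also have "\<dots> \<le> h N ^ Suc n"
        using h1[OF N] by (intro power_decreasing) auto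
      finally show "h N ^ (n - 1) / real N \<le> h N ^ Suc n" .
    qed
    \<comment> \<open>Second induction, on the length of one centered word: its splittings consist
      of shorter words, which can be centered in turn, while the other factors vary freely.\<close>
    have inner: "bigo_le (MomS (ce P # map ce S' @ map pl Q)) (\<lambda>N. h N ^ Suc n)"
      if "length S' = n" "\<And>w. w \<in> insert P (set S' \<union> set Q) \<Longrightarrow> adm w" for P S' Q
      using that
    proof (induction "length P" arbitrary: P S' Q rule: less_induct)
      case (less P S' Q)
      define rest where "rest = map ce S' @ map pl Q"
      have rest1: "bigo_le (MomS rest) (\<lambda>N. h N ^ n)"
        unfolding rest_def using outer[of S' Q] less.prems by simp
      show ?case
      proof (cases "pure P")
        case True
        have "MomS (ce P # rest) N = 0" if "N \<ge> 1" for N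
          using MomS_ce[OF that] Mom_pure[OF that True, of "map _ _"] by (simp add: MomS_def m_def)
        then show ?thesis
          unfolding rest_def[symmetric]
          by (intro bigo_le_cong[OF bigo_le_0] eventually_mono[OF eventually_ge_at_top[of 1]]) simp
      next
        case False
        have admP: "adm P" using less.prems by auto
        obtain spl where split: "sd_split P spl"
        using SD_mixed[OF admP False] by blast
      note spl = sd_splitD(1)[OF split] and sd = sd_splitD(2)[OF split]
        have "bigo_le (\<lambda>N. MomS (pl P # rest) N - (\<Sum>(e, w1, w2)\<leftarrow>spl. e * MomS (pl w1 # pl w2 # rest) N)) (\<lambda>N. h N ^ (n - 1) / real N)"
        proof (rule sd)
          show "adm q" if "(q, c) \<in> set rest" for q c using that less.prems by (auto simp: rest_def)
          fix q c R ws
          assume R: "((q, c), R) \<in> set (picks rest)" and ws: "\<forall>w\<in>set ws. adm w \<and> w \<noteq> []"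
          \<comment> \<open>The word merged with \<open>P\<close> is one of the n centered ones,
            leaving n - 1 of them, or a plain one, leaving all n.\<close>
          from picks_append[OF R[unfolded rest_def]]
          show "bigo_le (MomS (map pl ws @ R)) (\<lambda>N. h N ^ (n - 1))"
          proof (elim disjE exE conjE)
            fix X' assume X: "((q, c), X') \<in> set (picks (map ce S'))" "R = X' @ map pl Q"
            from X(1) obtain S'' where S'': "(q, S'') \<in> set (picks S')" "X' = map ce S''"
              by (auto simp: picks_map)
            have n: "n = Suc (length S'')" using picks_length[OF S''(1)] less.prems by simp
            have "set S' = insert q (set S'')" using arg_cong[OF mset_picks[OF S''(1)], of set_mset] by simp
            then have "bigo_le (MomS (map ce S'' @ map pl (ws @ Q))) (\<lambda>N. h N ^ length S'')"
              using less.prems ws n by (intro outer) auto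
            then have "bigo_le (MomS (map pl ws @ R)) (\<lambda>N. h N ^ length S'')"
              by (rule MomS_cong[rotated]) (simp add: X S'' ac_simps)
            then show ?thesis using n by simp
          next
            fix Y' assume X: "((q, c), Y') \<in> set (picks (map pl Q))" "R = map ce S' @ Y'"
            from X(1) obtain Q'' where Q'': "(q, Q'') \<in> set (picks Q)" "Y' = map pl Q''"
              by (auto simp: picks_map)
            have "set Q = insert q (set Q'')" using arg_cong[OF mset_picks[OF Q''(1)], of set_mset] by simp
            then have "bigo_le (MomS (map ce S' @ map pl (ws @ Q''))) (\<lambda>N. h N ^ length S')"
              using less.prems ws by (intro outer) auto
            then have "bigo_le (MomS (map pl ws @ R)) (\<lambda>N. h N ^ length S')"
              by (rule MomS_cong[rotated]) (simp add: X Q'' ac_simps)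
            then show ?thesis using less.prems by (auto intro: bigo_le_mono[OF _ h_mono])
          qed
        qed
        then have 1: "bigo_le (\<lambda>N. MomS (pl P # rest) N - (\<Sum>(e, w1, w2)\<leftarrow>spl. e * MomS (pl w1 # pl w2 # rest) N)) (\<lambda>N. h N ^ Suc n)"
          using h_div by (rule bigo_le_mono)
        \<comment> \<open>The same equation without further factors expands the centering constant
          \<open>m P\<close>. It remains to compare the two expansions splitting by
          splitting.\<close>
        have "bigo_le (\<lambda>N. MomS [pl P] N - (\<Sum>(e, w1, w2)\<leftarrow>spl. e * MomS [pl w1, pl w2] N)) (\<lambda>N. h N ^ (n - 1) / real N)"
          by (rule sd) auto
        then have "bigo_le (\<lambda>N. m P N - (\<Sum>(e, w1, w2)\<leftarrow>spl. e * MomS [pl w1, pl w2] N)) (\<lambda>N. h N ^ Suc n)"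
          unfolding m_eq using h_div by (rule bigo_le_mono)
        from bigo_le_mult[OF this bigo_le_mono[OF rest1, of "\<lambda>N. 1"]]
        have 2: "bigo_le (\<lambda>N. (m P N - (\<Sum>(e, w1, w2)\<leftarrow>spl. e * MomS [pl w1, pl w2] N)) * MomS rest N) (\<lambda>N. h N ^ Suc n)"
          using h_mono[of 0 n] by simp
        \<comment> \<open>Writing w' for a centered w and R for the rest: E(w1 w2 R) - E(w1 w2) E(R)
          = E(w1' w2 R) + E(w1) E(w2' R) - E(w1' w2) E(R), and each term contains n + 1 centered
          factors.\<close>
        have 3: "bigo_le (\<lambda>N. MomS (pl w1 # pl w2 # rest) N - MomS [pl w1, pl w2] N * MomS rest N) (\<lambda>N. h N ^ Suc n)"
          if e: "(e, w1, w2) \<in> set spl" for e w1 w2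
        proof -
          note s = spl[OF e]
          have ad: "adm w1" "adm w2" using s by (auto intro: adm_mset_mono[OF admP])
          have "length P = length w1 + length w2" using s by (metis size_mset size_union)
          then have len: "length w1 < length P" "length w2 < length P" using s by auto
          have a: "bigo_le (MomS (ce w1 # pl w2 # rest)) (\<lambda>N. h N ^ Suc n)"
            using less.hyps[OF len(1), of S' "w2 # Q"] less.prems ad
            by (rule_tac MomS_cong[rotated]) (auto simp: rest_def)
          have b: "bigo_le (MomS (ce w2 # rest)) (\<lambda>N. h N ^ Suc n)"
            using less.hyps[OF len(2), of S' Q] less.prems ad by (auto simp: rest_def)
          \<comment> \<open>For n > 0 a single centered factor is covered by the outer hypothesis,
            for n = 0 only by the inner one.\<close>
          have c: "bigo_le (MomS [ce w1, pl w2]) (\<lambda>N. h N)"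
          proof (cases n)
            case 0
            then show ?thesis using less.hyps[OF len(1), of "[]" "[w2]"] ad by auto
          next
            case (Suc n')
            then show ?thesis using outer[of "[w1]" "[w2]"] ad by auto
          qed
          have d: "bigo_le (m w1) (\<lambda>N. 1)"
            using MomS_bounded[of "[w1]"] ad by (simp add: m_eq[abs_def])
          have "bigo_le (\<lambda>N. MomS (ce w1 # pl w2 # rest) N + m w1 N * MomS (ce w2 # rest) N - MomS [ce w1, pl w2] N * MomS rest N) (\<lambda>N. h N ^ Suc n)"
            using bigo_le_mult[OF d b] bigo_le_mult[OF c rest1] by (intro bigo_le_diff bigo_le_add a) auto
          then show ?thesis
            by (rule bigo_le_cong) (auto intro!: eventually_mono[OF eventually_ge_at_top[of 1]] simp: MomS_ce algebra_simps simp flip: m_eq)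
        qed
        have 4: "bigo_le (\<lambda>N. \<Sum>(e, w1, w2)\<leftarrow>spl. e * (MomS (pl w1 # pl w2 # rest) N - MomS [pl w1, pl w2] N * MomS rest N)) (\<lambda>N. h N ^ Suc n)"
          by (intro bigo_le_sum_list, clarify, intro bigo_le_cmult 3)
        have "MomS (pl P # rest) N - (\<Sum>(e, w1, w2)\<leftarrow>spl. e * MomS (pl w1 # pl w2 # rest) N)
           + (\<Sum>(e, w1, w2)\<leftarrow>spl. e * (MomS (pl w1 # pl w2 # rest) N - MomS [pl w1, pl w2] N * MomS rest N))
           - (m P N - (\<Sum>(e, w1, w2)\<leftarrow>spl. e * MomS [pl w1, pl w2] N)) * MomS rest N = MomS (ce P # rest) N" if "N \<ge> 1" for N
        proof -
          have "(\<Sum>(e, w1, w2)\<leftarrow>spl. e * (MomS (pl w1 # pl w2 # rest) N - MomS [pl w1, pl w2] N * MomS rest N))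
            = (\<Sum>(e, w1, w2)\<leftarrow>spl. e * MomS (pl w1 # pl w2 # rest) N) - (\<Sum>(e, w1, w2)\<leftarrow>spl. e * MomS [pl w1, pl w2] N) * MomS rest N"
            by (simp add: case_prod_unfold right_diff_distrib sum_list_subtractf mult.assoc flip: sum_list_mult_const)
          then show ?thesis using MomS_ce[OF that] by (simp add: algebra_simps)
        qed
        then have "bigo_le (MomS (ce P # rest)) (\<lambda>N. h N ^ Suc n)"
          by (intro bigo_le_cong[OF bigo_le_diff[OF bigo_le_add[OF 1 4] 2]] eventually_mono[OF eventually_ge_at_top[of 1]])
        then show ?thesis by (simp add: rest_def)
      qed
    qed
    from Suc obtain P S' where S: "S = P # S'" "length S' = n" by (cases S) auto
    show ?thesis
      using inner[of S' P Q] S less.prems by (simp add: h_def)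
  qed
qed

text \<open>Centering one of the two traces already gains 1/sqrt N, so traces decorrelate.\<close>

lemma m_pair_diff_0:
  assumes "adm u" "adm w"
  shows "(\<lambda>N. MomS [pl u, pl w] N - m u N * m w N) \<longlonglongrightarrow> 0"
proof -
  have "bigo_le (MomS [ce u, pl w]) (\<lambda>N. 1 / sqrt (real N))"
    using MomS_centered[of "[u]" "[w]"] assms by auto
  then have "bigo_le (\<lambda>N. MomS [pl u, pl w] N - m u N * m w N) (\<lambda>N. 1 / sqrt (real N))"
    by (rule bigo_le_cong) (auto intro!: eventually_mono[OF eventually_ge_at_top[of 1]] simp: MomS_ce m_eq)
  moreover have "(\<lambda>N. 1 / sqrt (real N)) \<longlonglongrightarrow> 0"
    by (intro tendsto_divide_0[OF tendsto_const] filterlim_at_top_imp_at_infinity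
        filterlim_compose[OF sqrt_at_top] filterlim_real_sequentially)
  ultimately show ?thesis by (rule bigo_le_tendsto_0)
qed

text \<open>The equation reduces a mixed word to pairs of shorter words, and these factorize in the
  limit, so convergence climbs from shorter words to longer ones.\<close>

lemma m_convergent: "adm w \<Longrightarrow> convergent (m w)"
proof (induction "length w" arbitrary: w rule: less_induct)
  case (less P)
  show ?case
  proof (cases "pure P")
    case True
    then show ?thesis unfolding m_def using less.prems by (intro pure_convergent) (auto simp: adm_def)
  next
    case False
    obtain spl where split: "sd_split P spl"
        using SD_mixed[OF less.prems False] by blast
      note spl = sd_splitD(1)[OF split] and sd = sd_splitD(2)[OF split]
    have "bigo_le (\<lambda>N. MomS [pl P] N - (\<Sum>(e, w1, w2)\<leftarrow>spl. e * MomS [pl w1, pl w2] N)) (\<lambda>N. 1 / real N)"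
      by (rule sd) auto
    then have 1: "(\<lambda>N. m P N - (\<Sum>(e, w1, w2)\<leftarrow>spl. e * MomS [pl w1, pl w2] N)) \<longlonglongrightarrow> 0"
      unfolding m_eq[symmetric] using lim_1_over_n by (rule bigo_le_tendsto_0)
    have "convergent (MomS [pl w1, pl w2])" if e: "(e, w1, w2) \<in> set spl" for e w1 w2
    proof -
      note s = spl[OF e]
      have ad: "adm w1" "adm w2" using s by (auto intro: adm_mset_mono[OF less.prems])
      have "length P = length w1 + length w2" using s by (metis size_mset size_union)
      then have len: "length w1 < length P" "length w2 < length P" using s by auto
      have "convergent (\<lambda>N. (MomS [pl w1, pl w2] N - m w1 N * m w2 N) + m w1 N * m w2 N)"
        using m_pair_diff_0[OF ad] less.hyps[OF len(1) ad(1)] less.hyps[OF len(2) ad(2)]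
        by (intro convergent_add convergent_mult) (auto simp: convergent_def)
      then show ?thesis by simp
    qed
    then have "\<forall>x\<in>set spl. \<exists>L. (\<lambda>N. case x of (e, w1, w2) \<Rightarrow> e * MomS [pl w1, pl w2] N) \<longlonglongrightarrow> L"
      unfolding convergent_def by (force intro: tendsto_mult_left)
    then obtain L where "\<And>x. x \<in> set spl \<Longrightarrow> (\<lambda>N. case x of (e, w1, w2) \<Rightarrow> e * MomS [pl w1, pl w2] N) \<longlonglongrightarrow> L x"
      by metis
    from tendsto_sum_list[where f = "\<lambda>x N. case x of (e, w1, w2) \<Rightarrow> e * MomS [pl w1, pl w2] N" and xs = spl, OF this]
    have "(\<lambda>N. \<Sum>(e, w1, w2)\<leftarrow>spl. e * MomS [pl w1, pl w2] N) \<longlonglongrightarrow> (\<Sum>x\<leftarrow>spl. L x)" by simp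
    from tendsto_add[OF 1 this] show ?thesis by (auto simp: convergent_def)
  qed
qed

definition t :: "var list \<Rightarrow> complex" where
  "t w = lim (m w)"

lemma m_tendsto: "adm w \<Longrightarrow> m w \<longlonglongrightarrow> t w"
  using m_convergent by (simp add: t_def convergent_LIMSEQ_iff)

lemma t_Nil: "t [] = 1"
proof -
  have "m [] N = 1" if "N \<ge> 1" for N using that Mom_empty Mom_Nil by (simp add: m_def)
  then have "m [] \<longlonglongrightarrow> 1"
    by (intro tendsto_eventually eventually_mono[OF eventually_ge_at_top[of 1]])
  then show ?thesis by (simp add: t_def limI)
qed

lemma t_rotate:
  assumes "adm (u @ w)"
  shows "t (u @ w) = t (w @ u)"
proof (rule LIMSEQ_unique)
  show "m (u @ w) \<longlonglongrightarrow> t (u @ w)" by (rule m_tendsto[OF assms])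
  have "adm (w @ u)" by (rule adm_mset_cong[OF assms]) simp
  moreover have "\<forall>\<^sub>F N in sequentially. m (w @ u) N = m (u @ w) N"
    by (intro eventually_mono[OF eventually_ge_at_top[of 1]]) (simp add: m_def Mom_rotate)
  ultimately show "m (u @ w) \<longlonglongrightarrow> t (w @ u)"
    using m_tendsto tendsto_cong by blast
qed

text \<open>With \<open>Q = []\<close> there is nothing to merge with and the equation is exact for
  each N; only the factorization of the pairs is asymptotic.\<close>

lemma t_SD:
  assumes "adm P"
  shows "(\<Sum>(p, d, s)\<leftarrow>splits [] P. t p * t (d # s) - t (p @ [d]) * t s) = 0"
proof (rule LIMSEQ_unique)
  have pair: "MomS [pl u, pl w] \<longlonglongrightarrow> t u * t w" if "adm u" "adm w" for u w
    using tendsto_add[OF m_pair_diff_0[OF that] tendsto_mult[OF m_tendsto[OF that(1)] m_tendsto[OF that(2)]]] by simp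
  show "(\<lambda>N. \<Sum>(p, d, s)\<leftarrow>splits [] P. MomS [pl p, pl (d # s)] N - MomS [pl (p @ [d]), pl s] N)
     \<longlonglongrightarrow> (\<Sum>(p, d, s)\<leftarrow>splits [] P. t p * t (d # s) - t (p @ [d]) * t s)"
    unfolding case_prod_unfold
  proof (intro tendsto_sum_list tendsto_diff pair)
    fix x assume "x \<in> set (splits [] P)"
    then obtain p d s where x: "x = (p, d, s)" "(p, d, s) \<in> set (splits [] P)" by (metis prod_cases3)
    then have "mset P = mset p + add_mset d (mset s)"
      using splits_append_eq[OF x(2)] by (metis append_Nil mset.simps(2) mset_append)
    then show "adm (fst x)" "adm (fst (snd x) # snd (snd x))" "adm (fst x @ [fst (snd x)])" "adm (snd (snd x))"
      using x by (auto intro!: adm_mset_mono[OF assms])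
  qed
  have "(\<Sum>(p, d, s)\<leftarrow>splits [] P. MomS [pl p, pl (d # s)] N - MomS [pl (p @ [d]), pl s] N) = 0" if "N \<ge> 1" for N
    using Mom_SD[OF that, where P = P and Q = "[]"] by (simp add: MomS_def case_prod_unfold)
  then show "(\<lambda>N. \<Sum>(p, d, s)\<leftarrow>splits [] P. MomS [pl p, pl (d # s)] N - MomS [pl (p @ [d]), pl s] N) \<longlonglongrightarrow> 0"
    by (intro tendsto_eventually eventually_mono[OF eventually_ge_at_top[of 1]])
qed

end

subsection \<open>Noncommutative polynomials and freeness\<close>

text \<open>Linear extension from words to polynomials. Identities in \<open>f\<close> hold for
  every \<open>p\<close>, whereas additivity in \<open>p\<close> is proved for finite
  supports.\<close>

definition plin :: "(var list \<Rightarrow> complex) \<Rightarrow> ncpoly \<Rightarrow> complex" where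
  "plin f p = (\<Sum>w\<in>{w. p w \<noteq> 0}. p w * f w)"

definition finpoly :: "ncpoly \<Rightarrow> bool" where
  "finpoly p \<longleftrightarrow> finite {w. p w \<noteq> 0}"

lemma plin_superset: "finite S \<Longrightarrow> {w. p w \<noteq> 0} \<subseteq> S \<Longrightarrow> plin f p = (\<Sum>w\<in>S. p w * f w)"
  unfolding plin_def by (intro sum.mono_neutral_left) auto

lemma finpoly_lincomb: "finpoly p \<Longrightarrow> finpoly q \<Longrightarrow> finpoly (\<lambda>w. p w + c * q w)"
  unfolding finpoly_def by (rule finite_subset[of _ "{w. p w \<noteq> 0} \<union> {w. q w \<noteq> 0}"]) auto

lemma plin_lincomb:
  assumes "finpoly p" "finpoly q"
  shows "plin f (\<lambda>w. p w + c * q w) = plin f p + c * plin f q"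
proof -
  let ?S = "{w. p w \<noteq> 0} \<union> {w. q w \<noteq> 0}"
  have "finite ?S" using assms by (simp add: finpoly_def)
  then have "plin f (\<lambda>w. p w + c * q w) = (\<Sum>w\<in>?S. (p w + c * q w) * f w)" "plin f p = (\<Sum>w\<in>?S. p w * f w)" "plin f q = (\<Sum>w\<in>?S. q w * f w)"
    by (intro plin_superset; auto)+
  then show ?thesis by (simp add: sum.distrib sum_distrib_left algebra_simps)
qed

lemma plin_add_fun: "plin (\<lambda>w. f w + g w) p = plin f p + plin g p"
  by (simp add: plin_def sum.distrib distrib_left)

lemma plin_diff_fun: "plin (\<lambda>w. f w - g w) p = plin f p - plin g p"
  by (simp add: plin_def sum_subtractf right_diff_distrib)

lemma plin_mult_fun: "plin (\<lambda>w. c * f w) p = c * plin f p"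
  unfolding plin_def sum_distrib_left by (simp add: mult_ac)

lemma plin_mult_fun_right: "plin (\<lambda>w. f w * c) p = plin f p * c"
  unfolding plin_def sum_distrib_right by (simp add: mult_ac)

lemma plin_cong: "(\<And>w. p w \<noteq> 0 \<Longrightarrow> f w = g w) \<Longrightarrow> plin f p = plin g p"
  unfolding plin_def by (intro sum.cong) auto

lemma plin_zero [simp]: "plin (\<lambda>w. 0) p = 0"
  by (simp add: plin_def)

lemma plin_swap: "plin (\<lambda>u. plin (\<lambda>w. f u w) q) p = plin (\<lambda>w. plin (\<lambda>u. f u w) p) q"
  unfolding plin_def sum_distrib_left by (subst sum.swap) (simp add: mult_ac)

text \<open>A factorization \<open>w = u @ v\<close> is the same as a cut position, so the
  convolution becomes a sum over pairs of words from the supports.\<close>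

lemma ncmult_pairs:
  assumes "finpoly p" "finpoly q"
  shows "ncmult p q w = (\<Sum>(u, v)\<in>{x \<in> {w. p w \<noteq> 0} \<times> {w. q w \<noteq> 0}. (\<lambda>(u, v). u @ v) x = w}. p u * q v)"
proof -
  have im: "(\<lambda>i. (take i w, drop i w)) ` {..length w} = {(u, v). u @ v = w}"
  proof (intro equalityI subsetI)
    fix x assume "x \<in> {(u, v). u @ v = w}"
    then obtain u v where "x = (u, v)" "w = u @ v" by auto
    then show "x \<in> (\<lambda>i. (take i w, drop i w)) ` {..length w}"
      by (intro image_eqI[of _ _ "length u"]) auto
  qed auto
  have inj: "inj_on (\<lambda>i. (take i w, drop i w)) {..length w}"
    by (rule inj_onI) (metis atMost_iff length_take min.absorb2 prod.inject)
  have "ncmult p q w = (\<Sum>(u, v)\<in>{(u, v). u @ v = w}. p u * q v)"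
    unfolding im[symmetric] ncmult_def by (subst sum.reindex[OF inj]) simp
  also have "\<dots> = (\<Sum>(u, v)\<in>{x \<in> {w. p w \<noteq> 0} \<times> {w. q w \<noteq> 0}. (\<lambda>(u, v). u @ v) x = w}. p u * q v)"
  proof (rule sum.mono_neutral_right)
    show "finite {(u, v). u @ v = w}" unfolding im[symmetric] by simp
  qed auto
  finally show ?thesis .
qed

lemma ncmult_support: "ncmult p q w \<noteq> 0 \<Longrightarrow> \<exists>u v. w = u @ v \<and> p u \<noteq> 0 \<and> q v \<noteq> 0"
proof -
  assume "ncmult p q w \<noteq> 0"
  then obtain i where "p (take i w) * q (drop i w) \<noteq> 0"
    unfolding ncmult_def by (metis (mono_tags, lifting) sum.neutral)
  then show ?thesis by (intro exI[of _ "take i w"] exI[of _ "drop i w"]) auto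
qed

lemma finpoly_ncmult:
  assumes "finpoly p" "finpoly q"
  shows "finpoly (ncmult p q)"
  unfolding finpoly_def
proof (rule finite_subset)
  show "{w. ncmult p q w \<noteq> 0} \<subseteq> (\<lambda>(u, v). u @ v) ` ({w. p w \<noteq> 0} \<times> {w. q w \<noteq> 0})"
    using ncmult_support by force
qed (use assms in \<open>auto simp: finpoly_def\<close>)

lemma plin_ncmult:
  assumes "finpoly p" "finpoly q"
  shows "plin f (ncmult p q) = plin (\<lambda>u. plin (\<lambda>v. f (u @ v)) q) p"
proof -
  let ?S = "{w. p w \<noteq> 0} \<times> {w. q w \<noteq> 0}" and ?h = "\<lambda>(u, v). u @ v :: var list"
  have fin: "finite ?S" using assms by (auto simp: finpoly_def)
  have "plin f (ncmult p q) = (\<Sum>w\<in>?h ` ?S. ncmult p q w * f w)"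
    using fin ncmult_support[of p q] by (intro plin_superset) force+
  also have "\<dots> = (\<Sum>w\<in>?h ` ?S. \<Sum>x\<in>{x \<in> ?S. ?h x = w}. p (fst x) * q (snd x) * f (?h x))"
    unfolding ncmult_pairs[OF assms] sum_distrib_right by (intro sum.cong refl) auto
  also have "\<dots> = (\<Sum>x\<in>?S. p (fst x) * q (snd x) * f (?h x))"
    by (rule sum.image_gen[OF fin, symmetric])
  also have "\<dots> = plin (\<lambda>u. plin (\<lambda>v. f (u @ v)) q) p"
    unfolding plin_def sum_distrib_left sum.cartesian_product by (intro sum.cong) auto
  finally show ?thesis .
qed

lemma finpoly_ncone [simp]: "finpoly ncone"
  by (simp add: finpoly_def ncone_def)

lemma plin_ncone [simp]: "plin f ncone = f []"
  using plin_superset[of "{[]}" ncone f] by (auto simp: ncone_def)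

text \<open>Coefficients are themselves values of linear functionals. With
  \<open>plin_ncmult\<close>, identities between products thereby reduce to identities for
  concatenation.\<close>

lemma finpoly_eqI:
  assumes "finpoly p" "finpoly q" "\<And>f. plin f p = plin f q"
  shows "p = q"
proof
  fix w
  have "plin (\<lambda>u. if u = w then 1 else 0) r = r w" if "finpoly r" for r
  proof -
    have "plin (\<lambda>u. if u = w then 1 else 0) r = (\<Sum>u\<in>insert w {w. r w \<noteq> 0}. r u * (if u = w then 1 else 0))"
      using that by (intro plin_superset) (auto simp: finpoly_def)
    also have "\<dots> = (\<Sum>u\<in>insert w {w. r w \<noteq> 0}. if u = w then r u else 0)"
      by (intro sum.cong) auto
    also have "\<dots> = r w" using that by (subst sum.delta) (auto simp: finpoly_def)
    finally show ?thesis .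
  qed
  then show "p w = q w" using assms by metis
qed

lemma ncmult_assoc:
  assumes "finpoly p" "finpoly q" "finpoly r"
  shows "ncmult (ncmult p q) r = ncmult p (ncmult q r)"
  using assms by (intro finpoly_eqI) (auto intro!: finpoly_ncmult simp: plin_ncmult finpoly_ncmult)

lemma ncmult_ncone_left [simp]: "finpoly p \<Longrightarrow> ncmult ncone p = p"
  by (intro finpoly_eqI) (auto simp: plin_ncmult finpoly_ncmult)

lemma ncmult_ncone_right [simp]: "finpoly p \<Longrightarrow> ncmult p ncone = p"
  by (intro finpoly_eqI) (auto simp: plin_ncmult finpoly_ncmult)

lemma plin_ncmult_lincomb:
  assumes "finpoly p" "finpoly q" "finpoly r"
  shows "plin f (ncmult (\<lambda>w. p w + c * q w) r) = plin f (ncmult p r) + c * plin f (ncmult q r)"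
  using assms by (simp add: plin_ncmult finpoly_lincomb plin_lincomb)

text \<open>Products c1 a1 ... cn an; in all uses the c are polynomials in \<open>Y\<close> and the
  a polynomials in \<open>X\<close>, possibly with the mark. Pairing the factors builds the
  alternation into the type.\<close>

definition cprod :: "(ncpoly \<times> ncpoly) list \<Rightarrow> ncpoly" where
  "cprod cas = foldr (\<lambda>(c, a) r. ncmult c (ncmult a r)) cas ncone"

lemma cprod_Nil [simp]: "cprod [] = ncone"
  and cprod_Cons: "cprod ((c, a) # cas) = ncmult c (ncmult a (cprod cas))"
  by (simp_all add: cprod_def)

lemma finpoly_cprod: "\<forall>x\<in>set cas. finpoly (fst x) \<and> finpoly (snd x) \<Longrightarrow> finpoly (cprod cas)"
  by (induction cas) (auto simp: cprod_Cons intro!: finpoly_ncmult)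

lemma cprod_append:
  assumes "\<forall>x\<in>set (xs @ ys). finpoly (fst x) \<and> finpoly (snd x)"
  shows "cprod (xs @ ys) = ncmult (cprod xs) (cprod ys)"
  using assms
proof (induction xs)
  case Nil
  then show ?case by (simp add: finpoly_cprod)
next
  case (Cons x xs)
  obtain c a where x: "x = (c, a)" by (cases x)
  have "finpoly (cprod xs)" "finpoly (cprod ys)" using Cons.prems by (auto intro!: finpoly_cprod)
  then show ?case using Cons by (simp add: x cprod_Cons ncmult_assoc finpoly_ncmult)
qed

lemma splits_append:
  "splits p (w @ w') = map (\<lambda>(a, d, b). (a, d, b @ w')) (splits p w) @ splits (p @ w) w'"
  by (induction p w rule: splits.induct) auto

lemma ncpolys_finpoly: "p \<in> ncpolys V \<Longrightarrow> finpoly p"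
  by (simp add: ncpolys_def finpoly_def)

lemma ncpolys_ncmult: "p \<in> ncpolys V \<Longrightarrow> q \<in> ncpolys V \<Longrightarrow> ncmult p q \<in> ncpolys V"
  using finpoly_ncmult[of p q] ncmult_support[of p q] by (fastforce simp: ncpolys_def finpoly_def)

lemma ncpolys_ncone [simp]: "ncone \<in> ncpolys V"
  using finpoly_ncone by (auto simp: ncpolys_def ncone_def finpoly_def)

lemma ncpolys_lincomb: "p \<in> ncpolys V \<Longrightarrow> q \<in> ncpolys V \<Longrightarrow> (\<lambda>w. p w + c * q w) \<in> ncpolys V"
proof -
  assume *: "p \<in> ncpolys V" "q \<in> ncpolys V"
  have "set w \<subseteq> V" if "p w + c * q w \<noteq> 0" for w
    using * that by (cases "p w = 0") (auto simp: ncpolys_def)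
  then show ?thesis using * finpoly_lincomb[of p q c] by (auto simp: ncpolys_def finpoly_def)
qed

lemma ncpolys_mono: "V \<subseteq> V' \<Longrightarrow> ncpolys V \<subseteq> ncpolys V'"
  by (auto simp: ncpolys_def)

section \<open>The limiting functional on polynomials and its block equation\<close>

context sd_system
begin

definition tau :: "ncpoly \<Rightarrow> complex" where
  "tau p = plin t p"

text \<open>The space, not closed under products, from which the extra factor against an alternating
  product is taken; both 1 and the marked letter belong to it.\<close>

definition XR :: "ncpoly set" where
  "XR = {p \<in> ncpolys (insert (Inl k) (Xvars k)). \<forall>w. p w \<noteq> 0 \<longrightarrow> count (mset w) (Inl k) \<le> 1}"

definition admp :: "ncpoly set" where
  "admp = {p. finpoly p \<and> (\<forall>w. p w \<noteq> 0 \<longrightarrow> adm w)}"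

abbreviation XY :: "ncpoly set" where
  "XY \<equiv> ncpolys (Xvars k \<union> Yvars l)"

lemma no_mark: "set w \<subseteq> Xvars k \<union> Yvars l \<Longrightarrow> count (mset w) (Inl k) = 0"
  by (auto simp: Xvars_def Yvars_def count_eq_zero_iff)

lemma XR_admp: "XR \<subseteq> admp"
  by (auto simp: XR_def admp_def adm_def ncpolys_def finpoly_def)

lemma XY_admp: "XY \<subseteq> admp"
proof
  fix p assume p: "p \<in> XY"
  then have "count (mset w) (Inl k) \<le> 1" if "p w \<noteq> 0" for w
    using that by (subst no_mark) (auto simp: ncpolys_def)
  then show "p \<in> admp" using p by (auto simp: admp_def adm_def ncpolys_def finpoly_def)
qed

lemma X_XR: "ncpolys (Xvars k) \<subseteq> XR"
proof
  fix p assume p: "p \<in> ncpolys (Xvars k)"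
  then have "count (mset w) (Inl k) \<le> 1" if "p w \<noteq> 0" for w
    using that by (subst no_mark) (auto simp: ncpolys_def)
  then show "p \<in> XR" using p by (auto simp: XR_def ncpolys_def)
qed

lemma finpoly_XR: "p \<in> XR \<Longrightarrow> finpoly p"
  by (auto simp: XR_def ncpolys_finpoly)

lemma XR_ncmult_left: "p \<in> ncpolys (Xvars k) \<Longrightarrow> q \<in> XR \<Longrightarrow> ncmult p q \<in> XR"
proof -
  assume p: "p \<in> ncpolys (Xvars k)" and q: "q \<in> XR"
  have "ncmult p q \<in> ncpolys (insert (Inl k) (Xvars k))"
    using p q ncpolys_mono[of "Xvars k" "insert (Inl k) (Xvars k)"] by (auto simp: XR_def intro!: ncpolys_ncmult)
  moreover have "count (mset w) (Inl k) \<le> 1" if nz: "ncmult p q w \<noteq> 0" for w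
  proof -
    obtain u v where *: "w = u @ v" "p u \<noteq> 0" "q v \<noteq> 0" using ncmult_support[OF nz] by metis
    then have "count (mset u) (Inl k) = 0" using p by (intro no_mark) (auto simp: ncpolys_def)
    moreover have "count (mset v) (Inl k) \<le> 1" using q * by (simp add: XR_def)
    moreover have "count (mset w) (Inl k) = count (mset u) (Inl k) + count (mset v) (Inl k)" using *(1) by simp
    ultimately show ?thesis by linarith
  qed
  ultimately show ?thesis by (auto simp: XR_def)
qed

lemma adm_append: "set u \<subseteq> Xvars k \<union> Yvars l \<Longrightarrow> adm v \<Longrightarrow> adm (u @ v)"
  by (auto simp: adm_def no_mark simp del: count_mset)

lemma admp_ncmult:
  assumes p: "p \<in> XY" and q: "q \<in> admp"
  shows "ncmult p q \<in> admp"
proof -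
  have "adm w" if "ncmult p q w \<noteq> 0" for w
    using ncmult_support[OF that] p q adm_append by (auto simp: ncpolys_def admp_def)
  then show ?thesis using p q finpoly_ncmult[OF ncpolys_finpoly[OF p], of q] by (auto simp: admp_def)
qed

text \<open>Only one factor may carry the mark: otherwise rotation would concern doubly marked
  words, where \<open>t_rotate\<close> does not apply.\<close>

lemma tau_commute:
  assumes p: "p \<in> XY" and q: "q \<in> admp"
  shows "tau (ncmult p q) = tau (ncmult q p)"
proof -
  have fin: "finpoly p" "finpoly q" using assms by (auto simp: admp_def ncpolys_finpoly)
  have "tau (ncmult p q) = plin (\<lambda>u. plin (\<lambda>v. t (u @ v)) q) p"
    by (simp add: tau_def plin_ncmult fin)
  also have "\<dots> = plin (\<lambda>u. plin (\<lambda>v. t (v @ u)) q) p"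
    using p q by (intro plin_cong t_rotate adm_append) (auto simp: ncpolys_def admp_def)
  also have "\<dots> = tau (ncmult q p)"
    by (subst plin_swap) (simp add: tau_def plin_ncmult fin)
  finally show ?thesis .
qed

text \<open>The part of the limiting equation for \<open>pre @ w @ suf\<close> that comes from
  splittings inside \<open>w\<close>. Additivity in the middle word allows evaluation block by
  block.\<close>

definition sd_word :: "var list \<Rightarrow> var list \<Rightarrow> var list \<Rightarrow> complex" where
  "sd_word pre w suf = (\<Sum>(p, d, s)\<leftarrow>splits pre w. t p * t (d # s @ suf) - t (p @ [d]) * t (s @ suf))"

lemma sd_word_append: "sd_word pre (w @ w') suf = sd_word pre w (w' @ suf) + sd_word (pre @ w) w' suf"
  by (simp add: sd_word_def splits_append case_prod_unfold o_def)

lemma sd_word_X: "\<forall>x\<in>set w. isl x \<Longrightarrow> sd_word pre w suf = 0"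
  unfolding sd_word_def by (induction pre w rule: splits.induct) auto

text \<open>Telescoping: the cut behind a \<open>Y\<close>-letter cancels against the cut before the
  next one, so only the two ends of the block survive.\<close>

lemma sd_word_Y: "\<forall>x\<in>set w. \<not> isl x \<Longrightarrow> sd_word pre w suf = t pre * t (w @ suf) - t (pre @ w) * t suf"
  unfolding sd_word_def by (induction pre w rule: splits.induct) auto

lemma sd_word_adm: "adm w \<Longrightarrow> sd_word [] w [] = 0"
  using t_SD[of w] by (simp add: sd_word_def)

definition sd_poly :: "ncpoly \<Rightarrow> ncpoly \<Rightarrow> ncpoly \<Rightarrow> complex" where
  "sd_poly pre p suf = plin (\<lambda>u. plin (\<lambda>w. plin (\<lambda>s. sd_word u w s) suf) p) pre"

lemma sd_poly_ncmult:
  assumes "finpoly pre" "finpoly p" "finpoly q" "finpoly suf"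
  shows "sd_poly pre (ncmult p q) suf = sd_poly pre p (ncmult q suf) + sd_poly (ncmult pre p) q suf"
  using assms by (simp add: sd_poly_def plin_ncmult sd_word_append[abs_def] plin_add_fun)

lemma sd_poly_X: "p \<in> ncpolys V \<Longrightarrow> V \<subseteq> range Inl \<Longrightarrow> sd_poly pre p suf = 0"
proof -
  assume p: "p \<in> ncpolys V" "V \<subseteq> range Inl"
  have "plin (\<lambda>w. plin (\<lambda>s. sd_word u w s) suf) p = plin (\<lambda>w. 0) p" for u
  proof (rule plin_cong)
    fix w assume "p w \<noteq> 0"
    then have "\<forall>x\<in>set w. isl x" using p by (fastforce simp: ncpolys_def)
    then have "sd_word u w = (\<lambda>s. 0)" by (intro ext sd_word_X)
    then show "plin (sd_word u w) suf = 0" by simp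
  qed
  then show ?thesis by (simp add: sd_poly_def)
qed

lemma sd_poly_Y:
  assumes p: "p \<in> ncpolys (Yvars l)" and fin: "finpoly pre" "finpoly suf"
  shows "sd_poly pre p suf = tau pre * tau (ncmult p suf) - tau (ncmult pre p) * tau suf"
proof -
  have finp: "finpoly p" by (rule ncpolys_finpoly[OF p])
  have "plin (\<lambda>w. plin (\<lambda>s. sd_word u w s) suf) p = plin (\<lambda>w. plin (\<lambda>s. t u * t (w @ s) - t (u @ w) * t s) suf) p" for u
  proof (rule plin_cong)
    fix w assume "p w \<noteq> 0"
    then have "\<forall>x\<in>set w. \<not> isl x" using p by (fastforce simp: ncpolys_def Yvars_def)
    then have "sd_word u w = (\<lambda>s. t u * t (w @ s) - t (u @ w) * t s)" by (intro ext sd_word_Y)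
    then show "plin (sd_word u w) suf = plin (\<lambda>s. t u * t (w @ s) - t (u @ w) * t s) suf" by simp
  qed
  then show ?thesis
    by (simp add: sd_poly_def tau_def plin_ncmult finp fin plin_diff_fun plin_mult_fun plin_mult_fun_right)
qed

lemma sd_poly_admp: "p \<in> admp \<Longrightarrow> sd_poly ncone p ncone = 0"
proof -
  assume "p \<in> admp"
  then have "plin (\<lambda>w. sd_word [] w []) p = plin (\<lambda>w. 0) p"
    by (intro plin_cong) (auto simp: admp_def sd_word_adm)
  then show ?thesis by (simp add: sd_poly_def)
qed

text \<open>The block form of the equation: each \<open>Y\<close>-block c contributes the cut before
  it and, with opposite sign, the cut behind it, while blocks of \<open>X\<close> contribute
  nothing. \<open>pre\<close> collects the blocks already passed.\<close>

fun sd_chain :: "ncpoly \<Rightarrow> (ncpoly \<times> ncpoly) list \<Rightarrow> complex" where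
  "sd_chain pre [] = 0"
| "sd_chain pre ((c, a) # r) = tau pre * tau (cprod ((c, a) # r)) - tau (ncmult pre c) * tau (ncmult a (cprod r))
     + sd_chain (ncmult pre (ncmult c a)) r"

lemma sd_poly_cprod:
  "finpoly pre \<Longrightarrow> \<forall>x\<in>set cas. fst x \<in> ncpolys (Yvars l) \<and> snd x \<in> XR \<Longrightarrow> sd_poly pre (cprod cas) ncone = sd_chain pre cas"
proof (induction cas arbitrary: pre)
  case Nil
  then show ?case by (simp add: sd_poly_def sd_word_def)
next
  case (Cons x cas)
  obtain c a where x: "x = (c, a)" by (cases x)
  have c: "c \<in> ncpolys (Yvars l)" and a: "a \<in> XR" using Cons.prems x by auto
  have fin: "finpoly c" "finpoly a" using c a by (auto intro: ncpolys_finpoly finpoly_XR)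
  have fr: "finpoly (cprod cas)" using Cons.prems by (auto intro!: finpoly_cprod intro: ncpolys_finpoly finpoly_XR)
  have "sd_poly pre (cprod (x # cas)) ncone = sd_poly pre c (ncmult a (cprod cas)) + sd_poly (ncmult pre c) (ncmult a (cprod cas)) ncone"
    using Cons.prems fin fr by (simp add: x cprod_Cons sd_poly_ncmult finpoly_ncmult)
  also have "sd_poly (ncmult pre c) (ncmult a (cprod cas)) ncone = sd_poly (ncmult (ncmult pre c) a) (cprod cas) ncone"
  proof -
    have "sd_poly (ncmult pre c) a (ncmult (cprod cas) ncone) = 0"
      using a by (intro sd_poly_X[of a "insert (Inl k) (Xvars k)"]) (auto simp: XR_def Xvars_def)
    then show ?thesis using Cons.prems fin fr by (subst sd_poly_ncmult) (auto simp: finpoly_ncmult)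
  qed
  also have "\<dots> = sd_chain (ncmult (ncmult pre c) a) cas"
    using Cons fin by (simp add: finpoly_ncmult)
  finally show ?case
    using Cons.prems fin fr c by (simp add: x sd_poly_Y finpoly_ncmult ncmult_assoc cprod_Cons)
qed


section \<open>Centered alternating chains\<close>

abbreviation Xp :: "ncpoly set" where "Xp \<equiv> ncpolys (Xvars k)"
abbreviation Yp :: "ncpoly set" where "Yp \<equiv> ncpolys (Yvars l)"

text \<open>The last entry is exempt from centering and may carry the mark. This slack hosts the
  extra factor and keeps chains closed under the rotations used below.\<close>

definition centered_chain :: "(ncpoly \<times> ncpoly) list \<Rightarrow> bool" where
  "centered_chain cas \<longleftrightarrow> cas \<noteq> [] \<and> (\<forall>x\<in>set cas. fst x \<in> Yp \<and> tau (fst x) = 0) \<and>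
     (\<forall>x\<in>set (butlast cas). snd x \<in> Xp \<and> tau (snd x) = 0) \<and> snd (last cas) \<in> XR"

lemma centered_chain_XR: "centered_chain cas \<Longrightarrow> x \<in> set cas \<Longrightarrow> fst x \<in> Yp \<and> snd x \<in> XR"
  using X_XR by (cases cas rule: rev_cases) (auto simp: centered_chain_def)

lemma centered_chain_finpoly: "centered_chain cas \<Longrightarrow> x \<in> set cas \<Longrightarrow> finpoly (fst x) \<and> finpoly (snd x)"
  using centered_chain_XR by (meson finpoly_XR ncpolys_finpoly)

lemma Xp_XY: "p \<in> Xp \<Longrightarrow> p \<in> XY" and Yp_XY: "p \<in> Yp \<Longrightarrow> p \<in> XY"
  using ncpolys_mono[of "Xvars k" "Xvars k \<union> Yvars l"] ncpolys_mono[of "Yvars l" "Xvars k \<union> Yvars l"] by auto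

lemma cprod_XY: "\<forall>x\<in>set cas. fst x \<in> Yp \<and> snd x \<in> Xp \<Longrightarrow> cprod cas \<in> XY"
  by (induction cas) (auto simp: cprod_Cons dest: Xp_XY Yp_XY intro!: ncpolys_ncmult)

lemma cprod_admp:
  assumes "centered_chain cas"
  shows "cprod cas \<in> admp"
proof -
  obtain xs c a where cas: "cas = xs @ [(c, a)]"
    using assms by (cases cas rule: rev_cases) (auto simp: centered_chain_def)
  have fin: "\<forall>x\<in>set cas. finpoly (fst x) \<and> finpoly (snd x)" using centered_chain_finpoly[OF assms] by blast
  have "cprod xs \<in> XY" using assms by (intro cprod_XY) (auto simp: cas centered_chain_def)
  moreover have "c \<in> XY" "a \<in> admp" using assms XR_admp by (auto simp: cas centered_chain_def intro: Yp_XY)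
  ultimately have "ncmult (cprod xs) (ncmult c a) \<in> admp" by (intro admp_ncmult)
  then show ?thesis using fin by (simp add: cas cprod_append cprod_Cons)
qed

lemma tau_ncone: "tau ncone = 1"
  by (simp add: tau_def t_Nil)

definition cent :: "ncpoly \<Rightarrow> ncpoly" where
  "cent p = (\<lambda>w. p w + (- tau p) * ncone w)"

lemma cent_ncpolys: "p \<in> ncpolys V \<Longrightarrow> cent p \<in> ncpolys V"
  unfolding cent_def by (intro ncpolys_lincomb) auto

lemma tau_cent: "finpoly p \<Longrightarrow> tau (cent p) = 0"
  using plin_lincomb[of p ncone t "- tau p"] by (simp add: cent_def tau_def t_Nil)

lemma tau_cent_ncmult:
  assumes "finpoly p" "finpoly q"
  shows "tau (ncmult p q) = tau (ncmult (cent p) q) + tau p * tau q"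
  using plin_ncmult_lincomb[of p ncone q t "- tau p"] assms by (simp add: tau_def cent_def)

text \<open>The block form of the limiting equation expresses \<open>tau (c1 a1 ... cn an)\<close> through products of shorter chains.
  The only non-centered block that arises, \<open>cj c1\<close>, is recentered, and what remains is again a shorter chain.\<close>

lemma tau_centered_chain: "centered_chain cas \<Longrightarrow> tau (cprod cas) = 0"
proof (induction "length cas" arbitrary: cas rule: less_induct)
  case less
  note chain = less.prems
  have fin: "\<And>x. x \<in> set cas \<Longrightarrow> finpoly (fst x) \<and> finpoly (snd x)" using centered_chain_finpoly[OF chain] by blast
  have prefix_chain: "centered_chain done" if "done @ r = cas" "done \<noteq> []" "r \<noteq> []" for "done" r
  proof -
    have "butlast cas = done @ butlast r" using that by (auto simp: butlast_append)
    then show ?thesis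
      using chain that X_XR last_in_set[OF that(2)] by (auto simp: centered_chain_def dest: in_set_butlastD)
  qed
  \<comment> \<open>\<open>done\<close> holds the blocks already passed, at least one. Both cuts at
    the next block c vanish: the cut before c has the shorter chain \<open>done\<close> as its left
    part, the cut behind c has \<open>done\<close> times c.\<close>
  have G0: "sd_chain (cprod done) r = 0" if "done @ r = cas" "done \<noteq> []" for "done" r
    using that
  proof (induction r arbitrary: "done")
    case (Cons x r)
    obtain c a where x: "x = (c, a)" by (cases x)
    note pc = prefix_chain[OF Cons.prems, simplified]
    have findone: "\<forall>x\<in>set done. finpoly (fst x) \<and> finpoly (snd x)" using centered_chain_finpoly[OF pc] by blast
    have in_cas: "(c, a) \<in> set cas" using Cons.prems(1) x by auto
    have c: "c \<in> Yp" "tau c = 0" using chain in_cas by (auto simp: centered_chain_def)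
    have finca: "finpoly c" "finpoly a" using fin[OF in_cas] by auto
    have doneXp: "\<forall>y\<in>set done. fst y \<in> Yp \<and> tau (fst y) = 0 \<and> snd y \<in> Xp \<and> tau (snd y) = 0"
      using chain Cons.prems(1) by (auto simp: centered_chain_def butlast_append)
    have len: "length done < length cas" using Cons.prems by auto
    have 1: "tau (cprod done) = 0" by (rule less.hyps[OF len pc])
    \<comment> \<open>By traciality c moves to the front and meets the first block d. The centered
      part of c d starts a chain as short as \<open>done\<close>; the scalar part multiplies the
      trace of what remains of \<open>done\<close> without d.\<close>
    have 2: "tau (ncmult (cprod done) c) = 0"
    proof -
      obtain d b ds where dn: "done = (d, b) # ds" using Cons.prems(2) by (cases "done") auto
      have db: "d \<in> Yp" "b \<in> Xp" "tau b = 0" using doneXp dn by auto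
      have findb: "finpoly d" "finpoly b" "finpoly (cprod ds)" using findone dn by (auto intro: finpoly_cprod)
      have "tau (ncmult (cprod done) c) = tau (ncmult c (cprod done))"
        using Yp_XY[OF c(1)] cprod_admp[OF pc] by (intro tau_commute[symmetric])
      also have "ncmult c (cprod done) = ncmult (ncmult c d) (ncmult b (cprod ds))"
        using finca findb by (simp add: dn cprod_Cons ncmult_assoc finpoly_ncmult)
      also have "tau \<dots> = tau (ncmult (cent (ncmult c d)) (ncmult b (cprod ds))) + tau (ncmult c d) * tau (ncmult b (cprod ds))"
        using finca findb by (intro tau_cent_ncmult finpoly_ncmult)
      also have "tau (ncmult (cent (ncmult c d)) (ncmult b (cprod ds))) = 0"
      proof -
        have "ncmult c d \<in> Yp" using c db by (intro ncpolys_ncmult)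
        then have "centered_chain ((cent (ncmult c d), b) # ds)"
          using pc finca findb by (auto simp: dn centered_chain_def cent_ncpolys tau_cent finpoly_ncmult split: if_splits)
        then have "tau (cprod ((cent (ncmult c d), b) # ds)) = 0"
          using len by (intro less.hyps) (auto simp: dn)
        then show ?thesis by (simp add: cprod_Cons)
      qed
      \<comment> \<open>Moving b to the end merges it with the last \<open>X\<close>-block. The
        product need not be centered, as the last entry of a chain is exempt.\<close>
      also have "tau (ncmult b (cprod ds)) = 0"
      proof (cases ds rule: rev_cases)
        case Nil
        then show ?thesis using db findb by simp
      next
        case (snoc ds' y)
        obtain c' a' where y: "y = (c', a')" by (cases y)
        have ca': "c' \<in> Yp" "tau c' = 0" "a' \<in> Xp" using doneXp by (auto simp: dn snoc y)
        have fds: "\<forall>x\<in>set ds'. finpoly (fst x) \<and> finpoly (snd x)" "finpoly c'" "finpoly a'"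
          using findone by (auto simp: dn snoc y)
        have "cprod ds \<in> XY" using doneXp by (intro cprod_XY) (auto simp: dn)
        then have "tau (ncmult b (cprod ds)) = tau (ncmult (cprod ds) b)"
          using Xp_XY[OF db(2)] XY_admp by (intro tau_commute) auto
        also have "ncmult (cprod ds) b = cprod (ds' @ [(c', ncmult a' b)])"
          using fds findb by (simp add: snoc y cprod_append cprod_Cons ncmult_assoc finpoly_ncmult finpoly_cprod)
        also have "tau \<dots> = 0"
        proof (rule less.hyps)
          have "ncmult a' b \<in> XR" using ca' db X_XR by (intro XR_ncmult_left) auto
          then show "centered_chain (ds' @ [(c', ncmult a' b)])"
            using doneXp ca' by (auto simp: centered_chain_def dn snoc y)
          show "length (ds' @ [(c', ncmult a' b)]) < length cas" using len by (simp add: dn snoc)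
        qed
        finally show ?thesis .
      qed
      finally show ?thesis by simp
    qed
    have "ncmult (cprod done) (ncmult c a) = cprod (done @ [(c, a)])"
      using findone finca by (subst cprod_append) (auto simp: cprod_Cons)
    moreover have "sd_chain (cprod (done @ [(c, a)])) r = 0"
      using Cons.prems x by (intro Cons.IH) auto
    ultimately show ?case using 1 2 by (simp add: x)
  qed simp
  obtain c a r where cas: "cas = (c, a) # r" using chain by (cases cas) (auto simp: centered_chain_def)
  have finca: "finpoly c" "finpoly a" using fin[of "(c, a)"] cas by auto
  \<comment> \<open>At the first block the cut before c gives the wanted value, since
    \<open>tau ncone = 1\<close>, and the cut behind c vanishes because c is centered.\<close>
  have "sd_chain ncone cas = sd_poly ncone (cprod cas) ncone"
    using centered_chain_XR[OF chain] by (intro sd_poly_cprod[symmetric]) auto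
  also have "\<dots> = 0" by (rule sd_poly_admp[OF cprod_admp[OF chain]])
  finally have "sd_chain ncone cas = 0" .
  moreover have "sd_chain (cprod [(c, a)]) r = 0" using cas by (intro G0) auto
  moreover have "tau c = 0" using chain by (auto simp: cas centered_chain_def)
  ultimately show ?case
    using finca by (simp add: cas tau_ncone finpoly_ncmult cprod_Cons)
qed

lemma alternating_XY:
  "\<forall>(a, s)\<in>set as. a \<in> (if s then Xp else Yp) \<and> tau a = 0 \<Longrightarrow> z \<in> set as \<Longrightarrow> fst z \<in> XY"
  by (cases z; cases "snd z") (auto dest!: bspec intro: Xp_XY Yp_XY)

text \<open>The factors are grouped in pairs from the left; a trailing \<open>X\<close>-factor is
  absorbed, together with \<open>h\<close>, into the exempt last entry.\<close>

lemma alternating_chain: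
  assumes "as \<noteq> []" "\<not> snd (hd as)"
    and "\<forall>i. Suc i < length as \<longrightarrow> snd (as ! i) \<noteq> snd (as ! Suc i)"
    and "\<forall>(a, s)\<in>set as. a \<in> (if s then Xp else Yp) \<and> tau a = 0"
    and h: "h \<in> XR"
  shows "\<exists>cas. centered_chain cas \<and> cprod cas = ncmult (ncprod (map fst as)) h"
  using assms(1-4)
proof (induction as rule: induct_list012)
  case (2 x)
  then have "fst x \<in> Yp" "tau (fst x) = 0" by (auto split: if_splits)
  then show ?case
    using h by (intro exI[of _ "[(fst x, h)]"])
      (auto simp: centered_chain_def cprod_Cons ncprod_def ncpolys_finpoly finpoly_XR)
next
  case (3 x y as)
  have sx: "\<not> snd x" and sy: "snd y" using 3(4) spec[OF 3(5), of 0] by auto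
  have x: "fst x \<in> Yp" "tau (fst x) = 0" and y: "fst y \<in> Xp" "tau (fst y) = 0"
    using 3(6) sx sy by (auto split: if_splits)
  have fin: "finpoly (fst x)" "finpoly (fst y)" "finpoly h" using x y h by (auto simp: ncpolys_finpoly finpoly_XR)
  show ?case
  proof (cases "as = []")
    case True
    have "ncmult (fst y) h \<in> XR" using y h by (intro XR_ncmult_left)
    then show ?thesis
      using True x fin by (intro exI[of _ "[(fst x, ncmult (fst y) h)]"])
        (auto simp: centered_chain_def cprod_Cons ncprod_def ncmult_assoc finpoly_ncmult)
  next
    case False
    have "\<not> snd (hd as)" using spec[OF 3(5), of 1] sy False by (cases as) auto
    moreover have "\<forall>i. Suc i < length as \<longrightarrow> snd (as ! i) \<noteq> snd (as ! Suc i)"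
    proof (intro allI impI)
      fix i assume "Suc i < length as"
      then show "snd (as ! i) \<noteq> snd (as ! Suc i)" using spec[OF 3(5), of "Suc (Suc i)"] by simp
    qed
    ultimately obtain cas where cas: "centered_chain cas" "cprod cas = ncmult (ncprod (map fst as)) h"
      using 3(1) False 3(6) by auto
    have "\<forall>z\<in>set as. finpoly (fst z)"
      using alternating_XY[OF 3(6)] ncpolys_finpoly by (metis list.set_intros(2))
    then have "finpoly (ncprod (map fst as))"
      by (induction as) (auto simp: ncprod_def intro!: finpoly_ncmult)
    then show ?thesis
      using cas x y fin by (intro exI[of _ "(fst x, fst y) # cas"])
        (auto simp: centered_chain_def cprod_Cons ncprod_def ncmult_assoc finpoly_ncmult)
  qed
qed simp

text \<open>By traciality \<open>g\<close> moves to the end, where it fits the last entry of a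
  chain. A leading \<open>X\<close>-factor is first absorbed into \<open>g\<close>, which is what
  \<open>gX\<close> is for; length at least 2 guarantees that a \<open>Y\<close>-factor
  remains.\<close>

lemma tau_alternating:
  assumes len: "length as > 1"
    and alt: "\<forall>i. Suc i < length as \<longrightarrow> snd (as ! i) \<noteq> snd (as ! Suc i)"
    and cen: "\<forall>(a, s)\<in>set as. a \<in> (if s then Xp else Yp) \<and> tau a = 0"
    and g: "g \<in> XR" and gX: "\<And>a. a \<in> Xp \<Longrightarrow> ncmult g a \<in> XR"
  shows "tau (ncmult g (ncprod (map fst as))) = 0"
proof -
  have XY: "\<forall>z\<in>set as. fst z \<in> XY"
    using alternating_XY[OF cen] by blast
  then have prod_XY: "ncprod (map fst as) \<in> XY" if "\<forall>z\<in>set as. fst z \<in> XY" for as :: "(ncpoly \<times> bool) list"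
    using that by (induction as) (auto simp: ncprod_def intro!: ncpolys_ncmult)
  have *: "tau (ncmult h (ncprod (map fst as))) = 0"
    if prem: "as \<noteq> []" "\<not> snd (hd as)" "\<forall>i. Suc i < length as \<longrightarrow> snd (as ! i) \<noteq> snd (as ! Suc i)"
    "\<forall>(a, s)\<in>set as. a \<in> (if s then Xp else Yp) \<and> tau a = 0" "h \<in> XR" "\<forall>z\<in>set as. fst z \<in> XY" for as h
  proof -
    obtain cas where cas: "centered_chain cas" "cprod cas = ncmult (ncprod (map fst as)) h"
      using alternating_chain[OF prem(1-5)] by auto
    then have "tau (ncmult (ncprod (map fst as)) h) = 0" using tau_centered_chain by metis
    then show ?thesis
      using tau_commute[OF prod_XY[OF prem(6)], of h] XR_admp prem(5) by auto
  qed
  obtain x y bs where as: "as = x # y # bs" using len by (cases as; cases "tl as") auto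
  show ?thesis
  proof (cases "snd x")
    case False
    show ?thesis by (rule *[OF _ _ alt cen g XY]) (use False as in auto)
  next
    case True
    have x: "fst x \<in> Xp" using cen True as by (auto split: if_splits)
    have "\<not> snd y" using True spec[OF alt, of 0] by (simp add: as)
    moreover have "\<forall>i. Suc i < length (y # bs) \<longrightarrow> snd ((y # bs) ! i) \<noteq> snd ((y # bs) ! Suc i)"
    proof (intro allI impI)
      fix i assume "Suc i < length (y # bs)"
      then show "snd ((y # bs) ! i) \<noteq> snd ((y # bs) ! Suc i)" using spec[OF alt, of "Suc i"] by (simp add: as)
    qed
    ultimately have "tau (ncmult (ncmult g (fst x)) (ncprod (map fst (y # bs)))) = 0"
      using cen XY gX[OF x] by (intro *) (auto simp: as)
    moreover have "finpoly (ncprod (map fst (y # bs)))"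
      using XY as by (intro ncpolys_finpoly[OF prod_XY]) auto
    ultimately show ?thesis
      using g x by (simp add: as ncprod_def ncmult_assoc finpoly_XR ncpolys_finpoly)
  qed
qed

section \<open>The vector state and conditional freeness\<close>

definition mark :: ncpoly where
  "mark = (\<lambda>w. if w = [Inl k] then 1 else 0)"

lemma finpoly_mark: "finpoly mark"
  by (simp add: finpoly_def mark_def)

lemma plin_mark: "plin f mark = f [Inl k]"
  using plin_superset[of "{[Inl k]}" mark f] by (auto simp: mark_def)

lemma mark_XR: "mark \<in> XR"
  using finpoly_mark by (auto simp: XR_def ncpolys_def finpoly_def mark_def split: if_splits)

text \<open>The limit of <P v, v>: prepending the letter for N v v^* turns the normalized trace into
  the vector state.\<close>

definition phi :: "ncpoly \<Rightarrow> complex" where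
  "phi p = plin (\<lambda>w. t (Inl k # w)) p"

lemma phi_eq: "finpoly p \<Longrightarrow> phi p = tau (ncmult mark p)"
  by (simp add: phi_def tau_def plin_ncmult finpoly_mark plin_mark)

lemma mark_ncmult_XR: "a \<in> Xp \<Longrightarrow> ncmult mark a \<in> XR"
proof -
  assume a: "a \<in> Xp"
  have "ncmult mark a \<in> ncpolys (insert (Inl k) (Xvars k))"
    using mark_XR a ncpolys_mono[of "Xvars k" "insert (Inl k) (Xvars k)"] by (auto simp: XR_def intro!: ncpolys_ncmult)
  moreover have "count (mset w) (Inl k) \<le> 1" if nz: "ncmult mark a w \<noteq> 0" for w
  proof -
    obtain u v where *: "w = u @ v" "mark u \<noteq> 0" "a v \<noteq> 0" using ncmult_support[OF nz] by metis
    then have "count (mset v) (Inl k) = 0" using a by (intro no_mark) (auto simp: ncpolys_def)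
    then show ?thesis using * by (auto simp: mark_def split: if_splits)
  qed
  ultimately show ?thesis by (auto simp: XR_def)
qed

text \<open>A centered \<open>Y\<close>-polynomial followed by the mark is a chain of one block, so
  the mark factors out with \<open>tau mark = 1\<close>, which reflects that the vectors have norm
  one.\<close>

lemma phi_Y:
  assumes c: "c \<in> Yp" and R1: "t [Inl k] = 1"
  shows "phi c = tau c"
proof -
  have fin: "finpoly c" by (rule ncpolys_finpoly[OF c])
  have "centered_chain [(cent c, mark)]"
    using c fin mark_XR by (auto simp: centered_chain_def cent_ncpolys tau_cent)
  then have "tau (ncmult (cent c) mark) = 0"
    using tau_centered_chain[of "[(cent c, mark)]"] by (simp add: cprod_Cons finpoly_mark)
  then have "tau (ncmult c mark) = tau c * tau mark"
    using tau_cent_ncmult[OF fin finpoly_mark] by simp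
  moreover have "tau mark = 1" using R1 by (simp add: tau_def plin_mark)
  moreover have "tau (ncmult c mark) = tau (ncmult mark c)"
    using Yp_XY[OF c] mark_XR XR_admp by (intro tau_commute) auto
  ultimately show ?thesis by (simp add: phi_eq fin)
qed

text \<open>The condition on \<open>phi\<close> holds because both sides are zero: the left by
  \<open>tau_alternating\<close> with the mark in front, the right because one of the first two
  factors is a centered \<open>Y\<close>-polynomial, on which \<open>phi\<close> agrees with
  \<open>tau\<close>.\<close>

lemma cond_free_tau_phi:
  assumes "t [Inl k] = 1"
  shows "cond_free Xp Yp tau phi"
  unfolding cond_free_def
proof (intro allI impI)
  fix as :: "(ncpoly \<times> bool) list"
  assume len: "1 < length as" and alt: "\<forall>i. Suc i < length as \<longrightarrow> snd (as ! i) \<noteq> snd (as ! Suc i)"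
    and cen: "\<forall>(a, s)\<in>set as. a \<in> (if s then Xp else Yp) \<and> tau a = 0"
  have XY: "\<forall>z\<in>set as. fst z \<in> XY"
    using alternating_XY[OF cen] by blast
  then have "ncprod (map fst as) \<in> XY"
    by (induction as) (auto simp: ncprod_def intro!: ncpolys_ncmult)
  then have fin: "finpoly (ncprod (map fst as))" by (rule ncpolys_finpoly)
  have one: "ncone \<in> XR" using X_XR by auto
  have 1: "tau (ncprod (map fst as)) = 0"
    using tau_alternating[OF len alt cen one] X_XR fin by (auto simp: ncpolys_finpoly)
  have 2: "phi (ncprod (map fst as)) = 0"
    using tau_alternating[OF len alt cen mark_XR mark_ncmult_XR] by (simp add: phi_eq fin)
  obtain x y bs where as: "as = x # y # bs" using len by (cases as; cases "tl as") auto
  have "snd x \<noteq> snd y" using spec[OF alt, of 0] by (simp add: as)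
  then have "phi (fst x) = 0 \<or> phi (fst y) = 0"
    using cen as phi_Y[OF _ assms] by (cases "snd x") (auto split: if_splits)
  then have "(\<Prod>a\<leftarrow>map fst as. phi a) = 0" by (auto simp: as)
  then show "tau (ncprod (map fst as)) = 0 \<and> phi (ncprod (map fst as)) = (\<Prod>a\<leftarrow>map fst as. phi a)"
    using 1 2 by simp
qed

end

subsection \<open>The Haar unitary model\<close>

text \<open>The sum of the variables has finite expectation, hence is almost surely finite, so its
  terms tend to 0.\<close>

lemma AE_tendsto_0_of_summable_expectation:
  fixes X :: "nat \<Rightarrow> 'w \<Rightarrow> real"
  assumes int: "\<And>n. n \<ge> 1 \<Longrightarrow> integrable M (X n)" and pos: "\<And>n \<omega>. 0 \<le> X n \<omega>"
    and bd: "\<forall>\<^sub>F n in sequentially. (\<integral>\<omega>. X n \<omega> \<partial>M) \<le> K / (real n)\<^sup>2"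
  shows "AE \<omega> in M. (\<lambda>n. X n \<omega>) \<longlonglongrightarrow> 0"
proof -
  obtain n1 where "\<And>n. n \<ge> n1 \<Longrightarrow> (\<integral>\<omega>. X n \<omega> \<partial>M) \<le> K / (real n)\<^sup>2"
    using bd by (auto simp: eventually_sequentially)
  \<comment> \<open>\<open>n0\<close> is at least 1 because \<open>X 0\<close> is not assumed
    integrable.\<close>
  then obtain n0 where n0: "n0 \<ge> 1" "\<And>n. n \<ge> n0 \<Longrightarrow> (\<integral>\<omega>. X n \<omega> \<partial>M) \<le> K / (real n)\<^sup>2"
    by (metis dual_order.trans nle_le)
  have int0: "integrable M (X (n + n0))" for n using int n0 by simp
  have [measurable]: "X (n + n0) \<in> borel_measurable M" for n using int0 by auto
  have E0: "0 \<le> (\<integral>\<omega>. X (n + n0) \<omega> \<partial>M)" for n using pos by simp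
  have "summable (\<lambda>n. K / (real n)\<^sup>2)"
    using summable_mult[OF inverse_power_summable[of 2, where 'a = real], of K] by (simp add: divide_inverse)
  then have "summable (\<lambda>n. K / (real (n + n0))\<^sup>2)"
    by (rule summable_ignore_initial_segment)
  then have sm: "summable (\<lambda>n. \<integral>\<omega>. X (n + n0) \<omega> \<partial>M)"
  proof (rule summable_comparison_test'[of _ 0])
    show "norm (\<integral>\<omega>. X (n + n0) \<omega> \<partial>M) \<le> K / (real (n + n0))\<^sup>2" for n
      using E0[of n] n0(2)[of "n + n0"] by simp
  qed
  have "(\<integral>\<^sup>+\<omega>. (\<Sum>n. ennreal (X (n + n0) \<omega>)) \<partial>M) = (\<Sum>n. \<integral>\<^sup>+\<omega>. ennreal (X (n + n0) \<omega>) \<partial>M)"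
    by (rule nn_integral_suminf) measurable
  also have "\<dots> = (\<Sum>n. ennreal (\<integral>\<omega>. X (n + n0) \<omega> \<partial>M))"
    using pos int0 by (intro suminf_cong nn_integral_eq_integral) auto
  also have "\<dots> = ennreal (\<Sum>n. \<integral>\<omega>. X (n + n0) \<omega> \<partial>M)"
    using sm E0 by (intro suminf_ennreal2) auto
  finally have "(\<integral>\<^sup>+\<omega>. (\<Sum>n. ennreal (X (n + n0) \<omega>)) \<partial>M) \<noteq> \<infinity>" by simp
  then have "AE \<omega> in M. (\<Sum>n. ennreal (X (n + n0) \<omega>)) \<noteq> \<infinity>"
    by (intro nn_integral_PInf_AE) measurable
  then show ?thesis
  proof eventually_elim
    case (elim \<omega>)
    then have "summable (\<lambda>n. X (n + n0) \<omega>)"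
      using pos by (intro summable_suminf_not_top) auto
    then have "(\<lambda>n. X (n + n0) \<omega>) \<longlonglongrightarrow> 0" by (rule summable_LIMSEQ_zero)
    then show ?case by (rule LIMSEQ_offset)
  qed
qed

lemma mmult_cong:
  "(\<And>i j. i < N \<Longrightarrow> j < N \<Longrightarrow> A i j = A' i j) \<Longrightarrow> (\<And>i j. i < N \<Longrightarrow> j < N \<Longrightarrow> B i j = B' i j) \<Longrightarrow> mmult N A B = mmult N A' B'"
  by (auto simp: mmult_def fun_eq_iff)

lemma selfadj_mat_adj: "selfadj_mat N A \<Longrightarrow> i < N \<Longrightarrow> j < N \<Longrightarrow> adj A i j = A i j"
  unfolding selfadj_mat_def adj_def by metis

lemma mono_eval_rev_adj:
  "(\<And>x. x \<in> set w \<Longrightarrow> selfadj_mat N (X x)) \<Longrightarrow> mono_eval N X (rev w) = adj (mono_eval N X w)"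
proof (induction w)
  case (Cons x w)
  have "mono_eval N X (rev (x # w)) = mmult N (adj (mono_eval N X w)) (mmult N (X x) (idm N))"
    using Cons by (simp add: mono_eval_append mono_eval_Cons)
  also have "\<dots> = mmult N (adj (mono_eval N X w)) (X x)"
    using mmult_idm_right[of N "mmult N (adj (mono_eval N X w)) (X x)"] by (simp add: mmult_assoc)
  also have "\<dots> = mmult N (adj (mono_eval N X w)) (adj (X x))"
    using Cons.prems[of x] by (intro mmult_cong) (simp_all add: selfadj_mat_adj)
  finally show ?case by (simp add: mono_eval_Cons adj_mmult)
qed simp

lemma selfadj_letters:
  assumes "\<And>i. x = Inl i \<Longrightarrow> selfadj_mat N (A i)" "\<And>j. x = Inr j \<Longrightarrow> selfadj_mat N (B j)"
  shows "selfadj_mat N (letters N A B u x)"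
proof (cases x)
  case (Inl i)
  then show ?thesis using assms by simp
next
  case (Inr j)
  have "adj (mmult N (mmult N u (B j)) (adj u)) = mmult N u (mmult N (adj (B j)) (adj u))"
    by (simp add: adj_mmult)
  also have "mmult N (adj (B j)) (adj u) = mmult N (B j) (adj u)"
    using assms(2)[OF Inr] by (intro mmult_cong) (simp_all add: selfadj_mat_adj)
  finally have "adj (letters N A B u x) = letters N A B u x"
    by (simp add: Inr letters_Inr mmult_assoc)
  then show ?thesis by (metis (no_types) adj_def selfadj_mat_def)
qed

lemma mono_eval_Y:
  assumes u: "unitary_mat N u" and w: "\<forall>x\<in>set w. \<not> isl x"
  shows "mono_eval N (letters N A B u) w = mmult N (mmult N u (mono_eval N (\<lambda>x. B (projr x)) w)) (adj u)"
  using w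
proof (induction w)
  case Nil
  then show ?case using u by (simp add: unitary_mat_def msupp_def mmult_idm_right)
next
  case (Cons x w)
  obtain j where x: "x = Inr j" using Cons.prems by (cases x) auto
  have "mono_eval N (letters N A B u) (x # w)
    = mmult N u (mmult N (B j) (mmult N (mmult N (adj u) u) (mmult N (mono_eval N (\<lambda>x. B (projr x)) w) (adj u))))"
    using Cons by (simp add: mono_eval_Cons x letters_Inr mmult_assoc)
  also have "\<dots> = mmult N u (mmult N (B j) (mmult N (mono_eval N (\<lambda>x. B (projr x)) w) (adj u)))"
    by (simp add: unitary_mat_left[OF u])
  finally show ?case by (simp add: mono_eval_Cons x mmult_assoc)
qed

lemma ntr_mono_eval_Y:
  assumes u: "unitary_mat N u" and w: "\<forall>x\<in>set w. \<not> isl x"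
  shows "ntr N (mono_eval N (letters N A B u) w) = ntr N (mono_eval N (\<lambda>x. B (projr x)) w)"
  unfolding mono_eval_Y[OF assms]
  by (subst ntr_mmult_commute) (simp add: unitary_mat_left[OF u] flip: mmult_assoc)

text \<open>The factor N offsets the normalization of the trace: tr(N v v^* F) = <F v, v>.\<close>

definition scaled_proj :: "nat \<Rightarrow> cvec \<Rightarrow> cmat" where
  "scaled_proj N v = (\<lambda>i j. of_nat N * (v i * cnj (v j)))"

text \<open>The source of the factor N in \<open>Mom_double\<close>. The case distinction appears
  because products are truncated to the N x N block while \<open>scaled_proj\<close> is not.\<close>

lemma scaled_proj_sandwich:
  "mmult N (scaled_proj N v) (mmult N F (scaled_proj N v)) = (\<lambda>i j. of_nat N * vstate N v F * (if i < N \<and> j < N then scaled_proj N v i j else 0))"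
proof (intro ext)
  fix i j
  have "(\<Sum>k<N. of_nat N * (v i * cnj (v k)) * (\<Sum>m<N. F k m * (of_nat N * (v m * cnj (v j)))))
     = of_nat N * (\<Sum>k<N. (\<Sum>m<N. F k m * v m) * cnj (v k)) * (of_nat N * (v i * cnj (v j)))"
    by (simp add: sum_distrib_left sum_distrib_right mult_ac)
  then show "mmult N (scaled_proj N v) (mmult N F (scaled_proj N v)) i j = of_nat N * vstate N v F * (if i < N \<and> j < N then scaled_proj N v i j else 0)"
    by (simp add: mmult_def scaled_proj_def vstate_def)
qed

lemma ntr_scaled_proj: "N \<ge> 1 \<Longrightarrow> ntr N (mmult N (scaled_proj N v) F) = vstate N v F"
proof -
  assume N: "N \<ge> 1"
  have "(\<Sum>i<N. \<Sum>k<N. of_nat N * (v i * cnj (v k)) * F k i) = of_nat N * (\<Sum>k<N. \<Sum>i<N. F k i * v i * cnj (v k))"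
    by (subst sum.swap) (simp add: sum_distrib_left mult_ac)
  then show ?thesis using N by (simp add: ntr_def mmult_def scaled_proj_def vstate_def sum_distrib_right)
qed

lemma selfadj_scaled_proj: "selfadj_mat N (scaled_proj N v)"
  by (simp add: selfadj_mat_def scaled_proj_def)

lemma mom_mset: "mset Q = mset Q' \<Longrightarrow> mom f Q = mom f Q'"
  unfolding mom_def by (metis mset_map prod_mset_prod_list)

context haar_matrix
begin

lemma integrable_mom: "integrable M (\<lambda>\<omega>. mom (T (U \<omega>)) Q)"
  by (rule integrable_bdd_meas[OF bdd_meas_mom])

lemma Mom_Nil: "Mom [] = 1"
  by (simp add: Mom_def prob_space)

lemma Mom_mset: "mset Q = mset Q' \<Longrightarrow> Mom Q = Mom Q'"
  by (simp add: Mom_def mom_mset[of Q Q'])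

lemma Mom_shift: "Mom ((q, c) # Q) = Mom ((q, 0) # Q) - c * Mom Q"
proof -
  have "Mom ((q, c) # Q) = (\<integral>\<omega>. mom (T (U \<omega>)) ((q, 0) # Q) - c * mom (T (U \<omega>)) Q \<partial>M)"
    unfolding Mom_def by (simp add: left_diff_distrib)
  also have "\<dots> = Mom ((q, 0) # Q) - c * Mom Q"
    unfolding Mom_def using integrable_mom by (simp del: mom_Cons)
  finally show ?thesis .
qed

lemma Mom_rotate: "Mom ((u @ w, c) # Q) = Mom ((w @ u, c) # Q)"
  by (simp add: Mom_def ntr_mono_eval_rotate[of N _ u w])

lemma Mom_empty: "Mom (([], 0) # Q) = Mom Q"
proof -
  have "ntr N (idm N) = 1" using N_pos by (simp add: ntr_def idm_def)
  then show ?thesis by (simp add: Mom_def)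
qed

text \<open>Words in the first family do not involve \<open>U\<close>; in words in the second the
  conjugation drops out under the trace as soon as \<open>U\<close> is unitary, that is, almost
  surely.\<close>

lemma T_pure:
  assumes "pure w"
  obtains c where "AE \<omega> in M. T (U \<omega>) w = c"
proof (cases "\<forall>x\<in>set w. isl x")
  case True
  have "T (U \<omega>) w = ntr N (mono_eval N (\<lambda>x. A (projl x)) w)" for \<omega>
    using True by (intro arg_cong[of _ _ "ntr N"] mono_eval_cong) (auto simp: letters_def split: sum.splits)
  then show ?thesis by (intro that[of "ntr N (mono_eval N (\<lambda>x. A (projl x)) w)"]) auto
next
  case False
  then have "\<forall>x\<in>set w. \<not> isl x" using assms by (auto simp: pure_def)
  then show ?thesis
    using U_unitary by (intro that[of "ntr N (mono_eval N (\<lambda>x. B (projr x)) w)"]) (auto simp: ntr_mono_eval_Y)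
qed

lemma Mom_AE_const:
  assumes "AE \<omega> in M. T (U \<omega>) w = c"
  shows "Mom ((w, 0) # Q) = c * Mom Q"
proof -
  have "Mom ((w, 0) # Q) = (\<integral>\<omega>. c * mom (T (U \<omega>)) Q \<partial>M)"
    unfolding Mom_def
  proof (rule integral_cong_AE)
    show "(\<lambda>\<omega>. mom (T (U \<omega>)) ((w, 0) # Q)) \<in> borel_measurable M" "(\<lambda>\<omega>. c * mom (T (U \<omega>)) Q) \<in> borel_measurable M"
      using borel_measurable_integrable[OF integrable_mom] by (auto simp del: mom_Cons)
  qed (use assms in auto)
  then show ?thesis by (simp add: Mom_def)
qed

lemma Mom_pure:
  assumes "pure w"
  shows "Mom ((w, 0) # Q) = Mom [(w, 0)] * Mom Q"
proof -
  obtain c where c: "AE \<omega> in M. T (U \<omega>) w = c" using T_pure[OF assms] .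
  show ?thesis using Mom_AE_const[OF c] by (simp add: Mom_Nil)
qed

lemma Mom_double:
  assumes "A k = scaled_proj N v"
  shows "Mom ((Inl k # u @ Inl k # w, 0) # Q) = of_nat N * Mom ((Inl k # u, 0) # (Inl k # w, 0) # Q)"
proof -
  have "T z (Inl k # u @ Inl k # w) = of_nat N * T z (Inl k # u) * T z (Inl k # w)" for z
  proof -
    let ?R = "scaled_proj N v"
    have "mmult N (\<lambda>i j. if i < N \<and> j < N then ?R i j else 0) F = mmult N ?R F" for F
      by (rule mmult_cong) auto
    moreover have "W z (Inl k # u @ Inl k # w) = mmult N (mmult N ?R (mmult N (W z u) ?R)) (W z w)"
      using assms by (simp add: mono_eval_Cons mono_eval_append mmult_assoc)
    ultimately have "W z (Inl k # u @ Inl k # w) = (\<lambda>i j. of_nat N * vstate N v (W z u) * mmult N ?R (W z w) i j)"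
      by (simp only: scaled_proj_sandwich mmult_scale_left)
    then have "T z (Inl k # u @ Inl k # w) = of_nat N * vstate N v (W z u) * ntr N (mmult N ?R (W z w))"
      by (simp add: ntr_def sum_distrib_left flip: sum_divide_distrib)
    then show ?thesis
      using assms N_pos by (simp add: mono_eval_Cons ntr_scaled_proj)
  qed
  then show ?thesis by (simp add: Mom_def mult.assoc)
qed

end

section \<open>The matrices of the theorem as an instance\<close>

definition xeval :: "(nat \<Rightarrow> cmat) \<Rightarrow> var \<Rightarrow> cmat" where
  "xeval A = (\<lambda>x. case x of Inl i \<Rightarrow> A i | Inr j \<Rightarrow> (\<lambda>_ _. 0))"

definition yeval :: "(nat \<Rightarrow> cmat) \<Rightarrow> var \<Rightarrow> cmat" where
  "yeval B = (\<lambda>x. case x of Inl i \<Rightarrow> (\<lambda>_ _. 0) | Inr j \<Rightarrow> B j)"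

lemma ntr_poly_eval: "ntr N (poly_eval N X p) = plin (\<lambda>w. ntr N (mono_eval N X w)) p"
  unfolding ntr_def poly_eval_def plin_def
  by (subst sum.swap) (simp add: sum_distrib_left sum_divide_distrib)

lemma vstate_poly_eval: "vstate N v (poly_eval N X p) = plin (\<lambda>w. vstate N v (mono_eval N X w)) p"
proof -
  let ?S = "{w. p w \<noteq> 0}"
  have "vstate N v (poly_eval N X p) = (\<Sum>i<N. \<Sum>j<N. \<Sum>w\<in>?S. p w * (mono_eval N X w i j * v j * cnj (v i)))"
    by (simp add: vstate_def poly_eval_def sum_distrib_right mult.assoc)
  also have "\<dots> = (\<Sum>w\<in>?S. \<Sum>i<N. \<Sum>j<N. p w * (mono_eval N X w i j * v j * cnj (v i)))"
    by (rule sum_swap3)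
  finally show ?thesis
    by (simp add: plin_def vstate_def sum_distrib_left sum_distrib_right)
qed

lemma plin_tendsto:
  "(\<And>w. p w \<noteq> 0 \<Longrightarrow> (\<lambda>N. f N w) \<longlonglongrightarrow> L w) \<Longrightarrow> (\<lambda>N. plin (f N) p) \<longlonglongrightarrow> plin L p"
  unfolding plin_def by (intro tendsto_sum tendsto_mult_left) auto

definition monom :: "var list \<Rightarrow> ncpoly" where
  "monom w = (\<lambda>u. if u = w then 1 else 0)"

lemma monom_ncpolys: "set w \<subseteq> V \<Longrightarrow> monom w \<in> ncpolys V"
  by (auto simp: ncpolys_def monom_def)

lemma plin_monom: "plin f (monom w) = f w"
  using plin_superset[of "{w}" "monom w" f] by (auto simp: monom_def)

locale haar_model = prob_space M for M :: "'w measure" +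
  fixes k l :: nat and A B :: "nat \<Rightarrow> nat \<Rightarrow> cmat" and v :: "nat \<Rightarrow> cvec"
    and \<tau> \<phi> :: "ncpoly \<Rightarrow> complex" and U :: "nat \<Rightarrow> 'w \<Rightarrow> cmat"
  assumes unit: "\<And>N. N \<ge> 1 \<Longrightarrow> unit_vec N (v N)"
    and limA: "\<And>P. P \<in> ncpolys (Xvars k) \<Longrightarrow> (\<lambda>N. ntr N (poly_eval N (xeval (A N)) P)) \<longlonglongrightarrow> \<tau> P"
    and limAv: "\<And>P. P \<in> ncpolys (Xvars k) \<Longrightarrow> (\<lambda>N. vstate N (v N) (poly_eval N (xeval (A N)) P)) \<longlonglongrightarrow> \<phi> P"
    and limB: "\<And>P. P \<in> ncpolys (Yvars l) \<Longrightarrow> (\<lambda>N. ntr N (poly_eval N (yeval (B N)) P)) \<longlonglongrightarrow> \<tau> P"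
    and haar_U: "\<And>N. N \<ge> 1 \<Longrightarrow> haar_unitary M N (U N)"
begin

text \<open>Slot k lies just beyond the variables \<open>X\<close>, so words in the proper variables
  do not see the modification.\<close>

definition A' :: "nat \<Rightarrow> nat \<Rightarrow> cmat" where
  "A' N = (A N)(k := scaled_proj N (v N))"

abbreviation Z :: "nat \<Rightarrow> 'w \<Rightarrow> var \<Rightarrow> cmat" where
  "Z N \<omega> \<equiv> letters N (A N) (B N) (U N \<omega>)"

abbreviation T :: "nat \<Rightarrow> 'w \<Rightarrow> var list \<Rightarrow> complex" where
  "T N \<omega> w \<equiv> ntr N (mono_eval N (letters N (A' N) (B N) (U N \<omega>)) w)"

definition Mom :: "nat \<Rightarrow> (var list \<times> complex) list \<Rightarrow> complex" where
  "Mom N Q = (\<integral>\<omega>. mom (T N \<omega>) Q \<partial>M)"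

lemma haar_matrix: "N \<ge> 1 \<Longrightarrow> haar_matrix M N (U N)"
  using haar_U by unfold_locales auto

lemma Mom_eq: "N \<ge> 1 \<Longrightarrow> Mom N = haar_matrix.Mom M N (A' N) (B N) (U N)"
  by (rule ext) (simp add: Mom_def haar_matrix.Mom_def[OF haar_matrix])

lemma mono_eval_A':
  "set w \<subseteq> Xvars k \<union> Yvars l \<Longrightarrow> mono_eval N (letters N (A' N) (B N) u) w = mono_eval N (letters N (A N) (B N) u) w"
  by (intro mono_eval_cong) (auto simp: letters_def A'_def Xvars_def Yvars_def split: sum.splits)

lemma T_unmarked: "set w \<subseteq> Xvars k \<union> Yvars l \<Longrightarrow> T N \<omega> w = ntr N (mono_eval N (Z N \<omega>) w)"
  by (simp add: mono_eval_A')

lemma T_marked: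
  "N \<ge> 1 \<Longrightarrow> set w \<subseteq> Xvars k \<union> Yvars l \<Longrightarrow> T N \<omega> (Inl k # w) = vstate N (v N) (mono_eval N (Z N \<omega>) w)"
  by (simp add: mono_eval_Cons mono_eval_A' ntr_scaled_proj) (simp add: A'_def ntr_scaled_proj)

lemma mono_eval_X: "set w \<subseteq> Xvars k \<Longrightarrow> mono_eval N (Z N \<omega>) w = mono_eval N (xeval (A N)) w"
  by (intro mono_eval_cong) (auto simp: letters_def xeval_def Xvars_def split: sum.splits)

lemma ntr_mono_eval_yeval:
  assumes "N \<ge> 1" "set w \<subseteq> Yvars l"
  shows "AE \<omega> in M. T N \<omega> w = ntr N (mono_eval N (yeval (B N)) w)"
proof -
  interpret h: haar_matrix M N "A' N" "B N" "U N" by (rule haar_matrix[OF assms(1)])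
  have w: "\<forall>x\<in>set w. \<not> isl x" using assms(2) by (auto simp: Yvars_def)
  have "mono_eval N (\<lambda>x. B N (projr x)) w = mono_eval N (yeval (B N)) w"
    using w by (intro mono_eval_cong) (auto simp: yeval_def split: sum.splits)
  then show ?thesis using h.U_unitary w by (auto simp: ntr_mono_eval_Y)
qed

lemma Mom_single_const:
  assumes "N \<ge> 1" "AE \<omega> in M. T N \<omega> w = c"
  shows "Mom N [(w, 0)] = c"
proof -
  interpret h: haar_matrix M N "A' N" "B N" "U N" by (rule haar_matrix[OF assms(1)])
  show ?thesis using h.Mom_AE_const[OF assms(2), of "[]"] by (simp add: Mom_eq[OF assms(1)] h.Mom_Nil)
qed

text \<open>Here the three convergence hypotheses enter. A pure word with one mark is rotated to
  begin with it, which makes its trace a vector state.\<close>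

lemma pure_convergent:
  assumes "pure w" "set w \<subseteq> insert (Inl k) (Xvars k \<union> Yvars l)" "count (mset w) (Inl k) \<le> 1"
  shows "convergent (\<lambda>N. Mom N [(w, 0)])"
proof -
  have conv: "convergent (\<lambda>N. Mom N [(w, 0)])" if "\<And>N. N \<ge> 1 \<Longrightarrow> AE \<omega> in M. T N \<omega> w = f N" "f \<longlonglongrightarrow> L" for f L
  proof -
    have "\<forall>\<^sub>F N in sequentially. f N = Mom N [(w, 0)]"
      by (intro eventually_mono[OF eventually_ge_at_top[of 1]] Mom_single_const[symmetric] that(1))
    then have "(\<lambda>N. Mom N [(w, 0)]) \<longlonglongrightarrow> L" using Lim_transform_eventually[OF that(2)] by simp
    then show ?thesis by (auto simp: convergent_def)
  qed
  have isl_vars: "\<forall>x\<in>Xvars k. isl x" "\<forall>x\<in>Yvars l. \<not> isl x" and isl_Inl: "isl (Inl k :: var)"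
    by (auto simp: Xvars_def Yvars_def)
  consider "set w \<subseteq> Xvars k" | "Inl k \<in> set w" "\<forall>x\<in>set w. isl x" | "set w \<subseteq> Yvars l"
  proof (cases "\<forall>x\<in>set w. isl x")
    case True
    then have "set w \<subseteq> insert (Inl k) (Xvars k)" using assms(2) isl_vars(2) by blast
    then show thesis using True that(1,2) by blast
  next
    case False
    then have "\<forall>x\<in>set w. \<not> isl x" using assms(1) by (auto simp: pure_def)
    then have "set w \<subseteq> Yvars l" using assms(2) isl_vars(1) isl_Inl by blast
    then show thesis by (rule that(3))
  qed
  then show ?thesis
  proof cases
    case 1
    have "T N \<omega> w = ntr N (mono_eval N (xeval (A N)) w)" for N \<omega>
      using 1 T_unmarked[of w N \<omega>] by (simp add: mono_eval_X le_supI1)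
    moreover have "(\<lambda>N. ntr N (mono_eval N (xeval (A N)) w)) \<longlonglongrightarrow> \<tau> (monom w)"
      using limA[OF monom_ncpolys[OF 1]] by (simp add: ntr_poly_eval plin_monom)
    ultimately show ?thesis by (intro conv) auto
  next
    case 2
    then obtain a b where w: "w = a @ Inl k # b" using split_list by metis
    have "Inl k \<notin> set (b @ a)" using assms(3) by (auto simp: w count_eq_zero_iff)
    then have ba: "set (b @ a) \<subseteq> Xvars k" using 2 assms(2) isl_vars(2) unfolding w set_append list.set by blast
    have "T N \<omega> w = vstate N (v N) (mono_eval N (xeval (A N)) (b @ a))" if "N \<ge> 1" for N \<omega>
      unfolding w using ba ntr_mono_eval_rotate[of N _ a "Inl k # b"] T_marked[OF that, of "b @ a" \<omega>]
      by (simp add: mono_eval_X[OF ba, simplified] le_supI1)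
    moreover have "(\<lambda>N. vstate N (v N) (mono_eval N (xeval (A N)) (b @ a))) \<longlonglongrightarrow> \<phi> (monom (b @ a))"
      using limAv[OF monom_ncpolys[OF ba]] by (simp add: vstate_poly_eval plin_monom)
    ultimately show ?thesis by (intro conv) auto
  next
    case 3
    have "(\<lambda>N. ntr N (mono_eval N (yeval (B N)) w)) \<longlonglongrightarrow> \<tau> (monom w)"
      using limB[OF monom_ncpolys[OF 3]] by (simp add: ntr_poly_eval plin_monom)
    then show ?thesis using ntr_mono_eval_yeval[OF _ 3] by (intro conv) auto
  qed
qed

sublocale sd_system k l Mom
proof
  fix N :: nat assume N: "N \<ge> 1"
  interpret h: haar_matrix M N "A' N" "B N" "U N" by (rule haar_matrix[OF N])
  note eq = Mom_eq[OF N]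
  show "Mom N [] = 1" by (simp add: eq h.Mom_Nil)
  show "Mom N Q = Mom N Q'" if "mset Q = mset Q'" for Q Q' by (simp add: eq h.Mom_mset[OF that])
  show "Mom N ((q, c) # Q) = Mom N ((q, 0) # Q) - c * Mom N Q" for q c Q unfolding eq by (rule h.Mom_shift)
  show "Mom N ((u @ w, c) # Q) = Mom N ((w @ u, c) # Q)" for u w c Q unfolding eq by (rule h.Mom_rotate)
  show "Mom N (([], 0) # Q) = Mom N Q" for Q unfolding eq by (rule h.Mom_empty)
  show "Mom N ((w, 0) # Q) = Mom N [(w, 0)] * Mom N Q" if "pure w" for w Q unfolding eq by (rule h.Mom_pure[OF that])
  have "A' N k = scaled_proj N (v N)" by (simp add: A'_def)
  then show "Mom N ((Inl k # u @ Inl k # w, 0) # Q) = of_nat N * Mom N ((Inl k # u, 0) # (Inl k # w, 0) # Q)" for u w Q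
    unfolding eq by (rule h.Mom_double)
  show "(\<Sum>(p, d, s)\<leftarrow>splits [] P. Mom N ((p, 0) # (d # s, 0) # Q) - Mom N ((p @ [d], 0) # (s, 0) # Q)) +
        (\<Sum>((q, c), R)\<leftarrow>picks Q. \<Sum>(p, d, s)\<leftarrow>splits [] q. Mom N ((p @ P @ d # s, 0) # R) - Mom N ((p @ d # P @ s, 0) # R)) / (of_nat N)\<^sup>2 = 0" for P Q
    unfolding eq by (rule h.schwinger_dyson)
qed (rule pure_convergent)

section \<open>Convergence in expectation\<close>

lemma integrable_T: "N \<ge> 1 \<Longrightarrow> integrable M (\<lambda>\<omega>. T N \<omega> w)"
proof -
  assume N: "N \<ge> 1"
  interpret h: haar_matrix M N "A' N" "B N" "U N" by (rule haar_matrix[OF N])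
  show ?thesis using h.integrable_mom[of "[(w, 0)]"] by simp
qed

lemma m_expectation: "m w N = expectation (\<lambda>\<omega>. T N \<omega> w)"
  by (simp add: m_def Mom_def)

lemma expectation_plin:
  assumes "N \<ge> 1"
  shows "expectation (\<lambda>\<omega>. plin (\<lambda>w. T N \<omega> (f w)) p) = plin (\<lambda>w. m (f w) N) p"
  unfolding plin_def m_expectation using integrable_T[OF assms] by simp

lemma XY_word: "p \<in> XY \<Longrightarrow> p w \<noteq> 0 \<Longrightarrow> set w \<subseteq> Xvars k \<union> Yvars l"
  by (auto simp: ncpolys_def)

lemma ntr_eq_plin: "p \<in> XY \<Longrightarrow> ntr N (poly_eval N (Z N \<omega>) p) = plin (T N \<omega>) p"
  unfolding ntr_poly_eval by (intro plin_cong) (simp add: T_unmarked XY_word)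

lemma vstate_eq_plin: "N \<ge> 1 \<Longrightarrow> p \<in> XY \<Longrightarrow> vstate N (v N) (poly_eval N (Z N \<omega>) p) = plin (\<lambda>w. T N \<omega> (Inl k # w)) p"
  unfolding vstate_poly_eval by (intro plin_cong) (simp add: T_marked XY_word)

lemma adm_unmarked: "set w \<subseteq> Xvars k \<union> Yvars l \<Longrightarrow> adm w \<and> adm (Inl k # w)"
  by (auto simp: adm_def no_mark simp del: count_mset)

lemma expectation_ntr_tendsto:
  assumes p: "p \<in> XY"
  shows "(\<lambda>N. expectation (\<lambda>\<omega>. ntr N (poly_eval N (Z N \<omega>) p))) \<longlonglongrightarrow> tau p"
proof -
  have "(\<lambda>N. plin (\<lambda>w. m w N) p) \<longlonglongrightarrow> tau p"
    unfolding tau_def using XY_word[OF p] adm_unmarked by (intro plin_tendsto m_tendsto) auto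
  moreover have "\<forall>\<^sub>F N in sequentially. plin (\<lambda>w. m w N) p = expectation (\<lambda>\<omega>. ntr N (poly_eval N (Z N \<omega>) p))"
    using expectation_plin[of _ "\<lambda>w. w" p]
    by (intro eventually_mono[OF eventually_ge_at_top[of 1]]) (simp add: ntr_eq_plin[OF p])
  ultimately show ?thesis by (rule Lim_transform_eventually)
qed

lemma expectation_vstate_tendsto:
  assumes p: "p \<in> XY"
  shows "(\<lambda>N. expectation (\<lambda>\<omega>. vstate N (v N) (poly_eval N (Z N \<omega>) p))) \<longlonglongrightarrow> phi p"
proof -
  have "(\<lambda>N. plin (\<lambda>w. m (Inl k # w) N) p) \<longlonglongrightarrow> phi p"
    unfolding phi_def using XY_word[OF p] adm_unmarked by (intro plin_tendsto m_tendsto) auto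
  moreover have "\<forall>\<^sub>F N in sequentially. plin (\<lambda>w. m (Inl k # w) N) p = expectation (\<lambda>\<omega>. vstate N (v N) (poly_eval N (Z N \<omega>) p))"
    using expectation_plin[of _ "\<lambda>w. Inl k # w" p]
    by (intro eventually_mono[OF eventually_ge_at_top[of 1]]) (simp add: vstate_eq_plin[OF _ p])
  ultimately show ?thesis by (rule Lim_transform_eventually)
qed

lemma tau_extends_X:
  assumes p: "p \<in> Xp"
  shows "tau p = \<tau> p"
proof (rule LIMSEQ_unique)
  have "ntr N (poly_eval N (Z N \<omega>) p) = ntr N (poly_eval N (xeval (A N)) p)" for N \<omega>
    unfolding ntr_poly_eval using p by (intro plin_cong) (auto simp: mono_eval_X ncpolys_def)
  then show "(\<lambda>N. ntr N (poly_eval N (xeval (A N)) p)) \<longlonglongrightarrow> tau p"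
    using expectation_ntr_tendsto[OF Xp_XY[OF p]] by (simp add: prob_space)
qed (rule limA[OF p])

lemma phi_extends_X:
  assumes p: "p \<in> Xp"
  shows "phi p = \<phi> p"
proof (rule LIMSEQ_unique)
  have "vstate N (v N) (poly_eval N (Z N \<omega>) p) = vstate N (v N) (poly_eval N (xeval (A N)) p)" for N \<omega>
    unfolding vstate_poly_eval using p by (intro plin_cong) (auto simp: mono_eval_X ncpolys_def)
  then show "(\<lambda>N. vstate N (v N) (poly_eval N (xeval (A N)) p)) \<longlonglongrightarrow> phi p"
    using expectation_vstate_tendsto[OF Xp_XY[OF p]] by (simp add: prob_space)
qed (rule limAv[OF p])

text \<open>In contrast to \<open>X\<close>, the traces agree with those of \<open>B\<close> only
  almost surely, so the comparison passes through the moments \<open>m\<close>.\<close>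

lemma tau_extends_Y:
  assumes p: "p \<in> Yp"
  shows "tau p = \<tau> p"
proof (rule LIMSEQ_unique)
  have w: "set w \<subseteq> Yvars l" if "p w \<noteq> 0" for w using p that by (auto simp: ncpolys_def)
  have "plin (\<lambda>w. m w N) p = ntr N (poly_eval N (yeval (B N)) p)" if "N \<ge> 1" for N
    unfolding ntr_poly_eval using Mom_single_const[OF that ntr_mono_eval_yeval[OF that w]]
    by (intro plin_cong) (simp add: m_def)
  then have ev: "\<forall>\<^sub>F N in sequentially. plin (\<lambda>w. m w N) p = ntr N (poly_eval N (yeval (B N)) p)"
    by (intro eventually_mono[OF eventually_ge_at_top[of 1]])
  have lim: "(\<lambda>N. plin (\<lambda>w. m w N) p) \<longlonglongrightarrow> tau p"
    unfolding tau_def using w adm_unmarked by (intro plin_tendsto m_tendsto) (metis le_supI2)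
  show "(\<lambda>N. ntr N (poly_eval N (yeval (B N)) p)) \<longlonglongrightarrow> tau p"
    by (rule Lim_transform_eventually[OF lim ev])
qed (rule limB[OF p])

lemma t_mark: "t [Inl k] = 1"
proof (rule LIMSEQ_unique)
  show "m [Inl k] \<longlonglongrightarrow> t [Inl k]" using adm_unmarked[of "[]"] by (intro m_tendsto) auto
  have "m [Inl k] N = 1" if N: "N \<ge> 1" for N
  proof -
    have "vstate N (v N) (idm N) = (\<Sum>i<N. (\<Sum>j<N. if j = i then v N j else 0) * cnj (v N i))"
      unfolding vstate_def by (intro sum.cong arg_cong2[of _ _ _ _ "(*)"] refl) (auto simp: idm_def)
    also have "\<dots> = of_real (\<Sum>i<N. (cmod (v N i))\<^sup>2)"
      unfolding of_real_sum by (intro sum.cong) (simp_all add: complex_norm_square del: of_real_power)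
    also have "\<dots> = 1" using unit[OF N] by (simp only: unit_vec_def of_real_1)
    finally have "T N \<omega> [Inl k] = 1" for \<omega> using T_marked[OF N, of "[]"] by simp
    then show ?thesis unfolding m_def by (intro Mom_single_const[OF N]) auto
  qed
  then show "m [Inl k] \<longlonglongrightarrow> 1"
    by (intro tendsto_eventually eventually_mono[OF eventually_ge_at_top[of 1]])
qed

section \<open>Almost sure convergence\<close>

lemma AE_T_tendsto:
  assumes sa: "\<And>N i. i < k \<Longrightarrow> selfadj_mat N (A N i)" "\<And>N j. j < l \<Longrightarrow> selfadj_mat N (B N j)"
    and w: "adm w"
  shows "AE \<omega> in M. (\<lambda>N. T N \<omega> w) \<longlonglongrightarrow> t w"
proof -
  have cnj_T: "cnj (T N \<omega> w) = T N \<omega> (rev w)" for N \<omega>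
  proof -
    \<comment> \<open>The marked matrix is self-adjoint as well, so marked words are treated like
      all others.\<close>
    have "selfadj_mat N (letters N (A' N) (B N) (U N \<omega>) x)" if "x \<in> set w" for x
      using w that sa by (intro selfadj_letters) (auto simp: adm_def Xvars_def Yvars_def A'_def selfadj_scaled_proj)
    then show ?thesis by (simp add: mono_eval_rev_adj ntr_adj)
  qed
  have cnj_m: "cnj (m w N) = m (rev w) N" for N
    unfolding m_expectation by (simp flip: cnj_T)
  have rw: "adm (rev w)" by (rule adm_mset_cong[OF w]) simp
  \<comment> \<open>The product of these four centered traces is the fourth power of a modulus. Its
    expectation has the summable rate (1/sqrt N)^4; two factors would only give 1/N.\<close>
  let ?S = "[w, w, rev w, rev w]"
  have fourth: "complex_of_real (cmod (T N \<omega> w - m w N) ^ 4) = mom (T N \<omega>) (map (\<lambda>q. (q, m q N)) ?S)" for N \<omega>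
  proof -
    let ?z = "T N \<omega> w - m w N"
    have "complex_of_real (cmod ?z ^ 4) = (complex_of_real ((cmod ?z)\<^sup>2))\<^sup>2" by (simp flip: power_mult)
    also have "\<dots> = (?z * cnj ?z)\<^sup>2" by (simp add: complex_norm_square del: of_real_power)
    also have "cnj ?z = T N \<omega> (rev w) - m (rev w) N" by (simp add: cnj_T cnj_m)
    finally show ?thesis by (simp add: power2_eq_square mult_ac)
  qed
  have int: "integrable M (\<lambda>\<omega>. cmod (T N \<omega> w - m w N) ^ 4)" if "N \<ge> 1" for N
  proof -
    interpret h: haar_matrix M N "A' N" "B N" "U N" by (rule haar_matrix[OF that])
    have "integrable M (\<lambda>\<omega>. complex_of_real (cmod (T N \<omega> w - m w N) ^ 4))"
      unfolding fourth by (rule h.integrable_mom)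
    then have "integrable M (\<lambda>\<omega>. Re (complex_of_real (cmod (T N \<omega> w - m w N) ^ 4)))" by (rule integrable_Re)
    then show ?thesis by (simp only: Re_complex_of_real)
  qed
  have E: "complex_of_real (expectation (\<lambda>\<omega>. cmod (T N \<omega> w - m w N) ^ 4)) = MomS (map ce ?S) N" for N
    unfolding integral_complex_of_real[symmetric] fourth by (simp add: MomS_def Mom_def)
  have "bigo_le (MomS (map ce ?S @ map pl [])) (\<lambda>N. (1 / sqrt (real N)) ^ length ?S)"
    using w rw by (intro MomS_centered) auto
  then obtain K where K: "\<forall>\<^sub>F N in sequentially. cmod (MomS (map ce ?S) N) \<le> K * (1 / sqrt (real N)) ^ 4"
    by (auto simp: bigo_le_def numeral_eq_Suc)
  have "AE \<omega> in M. (\<lambda>N. cmod (T N \<omega> w - m w N) ^ 4) \<longlonglongrightarrow> 0"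
  proof (rule AE_tendsto_0_of_summable_expectation)
    show "\<forall>\<^sub>F N in sequentially. expectation (\<lambda>\<omega>. cmod (T N \<omega> w - m w N) ^ 4) \<le> K / (real N)\<^sup>2"
      using K
    proof eventually_elim
      case (elim N)
      have "sqrt (real N) ^ 4 = (real N)\<^sup>2"
        using power_mult[of "sqrt (real N)" 2 2] by simp
      then have "K * (1 / sqrt (real N)) ^ 4 = K / (real N)\<^sup>2" by (simp add: power_divide)
      moreover have "expectation (\<lambda>\<omega>. cmod (T N \<omega> w - m w N) ^ 4) \<le> cmod (MomS (map ce ?S) N)"
        unfolding E[symmetric] norm_of_real by (rule abs_ge_self)
      ultimately show ?case using elim by linarith
    qed
  qed (use int in auto)
  then show ?thesis
  proof eventually_elim
    case (elim \<omega>)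
    have "(\<lambda>N. root 4 (cmod (T N \<omega> w - m w N) ^ 4)) \<longlonglongrightarrow> root 4 0"
      by (rule tendsto_real_root[OF elim])
    then have "(\<lambda>N. cmod (T N \<omega> w - m w N)) \<longlonglongrightarrow> 0"
      by (simp add: real_root_power_cancel)
    then have "(\<lambda>N. T N \<omega> w - m w N) \<longlonglongrightarrow> 0" by (rule tendsto_norm_zero_cancel)
    from tendsto_add[OF this m_tendsto[OF w]] show ?case by simp
  qed
qed

text \<open>A polynomial has finitely many words, so the exceptional null sets can be
  united.\<close>

lemma AE_plin_tendsto:
  assumes "finpoly p" "\<And>w. p w \<noteq> 0 \<Longrightarrow> AE \<omega> in M. (\<lambda>N. T N \<omega> (f w)) \<longlonglongrightarrow> L w"
  shows "AE \<omega> in M. (\<lambda>N. plin (\<lambda>w. T N \<omega> (f w)) p) \<longlonglongrightarrow> plin L p"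
proof -
  have "AE \<omega> in M. \<forall>w\<in>{w. p w \<noteq> 0}. (\<lambda>N. T N \<omega> (f w)) \<longlonglongrightarrow> L w"
    using assms by (intro AE_finite_allI) (auto simp: finpoly_def)
  then show ?thesis by eventually_elim (auto intro: plin_tendsto)
qed

lemma AE_ntr_tendsto:
  assumes sa: "\<And>N i. i < k \<Longrightarrow> selfadj_mat N (A N i)" "\<And>N j. j < l \<Longrightarrow> selfadj_mat N (B N j)"
    and p: "p \<in> XY"
  shows "AE \<omega> in M. (\<lambda>N. ntr N (poly_eval N (Z N \<omega>) p)) \<longlonglongrightarrow> tau p"
  unfolding ntr_eq_plin[OF p] tau_def
  by (rule AE_plin_tendsto[OF ncpolys_finpoly[OF p]]) (use XY_word[OF p] adm_unmarked AE_T_tendsto[OF sa] in blast)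

lemma AE_vstate_tendsto:
  assumes sa: "\<And>N i. i < k \<Longrightarrow> selfadj_mat N (A N i)" "\<And>N j. j < l \<Longrightarrow> selfadj_mat N (B N j)"
    and p: "p \<in> XY"
  shows "AE \<omega> in M. (\<lambda>N. vstate N (v N) (poly_eval N (Z N \<omega>) p)) \<longlonglongrightarrow> phi p"
proof -
  have "AE \<omega> in M. (\<lambda>N. plin (\<lambda>w. T N \<omega> (Inl k # w)) p) \<longlonglongrightarrow> phi p"
    unfolding phi_def
    by (rule AE_plin_tendsto[OF ncpolys_finpoly[OF p]]) (use XY_word[OF p] adm_unmarked AE_T_tendsto[OF sa] in blast)
  then show ?thesis
  proof eventually_elim
    case (elim \<omega>)
    have "\<forall>\<^sub>F N in sequentially. plin (\<lambda>w. T N \<omega> (Inl k # w)) p = vstate N (v N) (poly_eval N (Z N \<omega>) p)"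
      by (intro eventually_mono[OF eventually_ge_at_top[of 1]]) (simp add: vstate_eq_plin[OF _ p])
    then show ?case by (rule Lim_transform_eventually[OF elim])
  qed
qed

lemma lin_on_plin: "lin_on XY (plin f)"
proof -
  have "plin f (\<lambda>w. p w + q w) = plin f p + plin f q" if "p \<in> XY" "q \<in> XY" for p q
    using plin_lincomb[of p q f 1] that by (simp add: ncpolys_finpoly)
  moreover have "plin f (\<lambda>w. c * p w) = c * plin f p" for c p
    unfolding plin_def sum_distrib_left by (cases "c = 0") (auto simp: mult.assoc)
  ultimately show ?thesis by (simp add: lin_on_def)
qed

end

theorem theorem3p10:
  fixes k l :: nat
    and A :: "nat \<Rightarrow> nat \<Rightarrow> cmat" and B :: "nat \<Rightarrow> nat \<Rightarrow> cmat" and v :: "nat \<Rightarrow> cvec"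
    and \<tau> \<phi> :: "ncpoly \<Rightarrow> complex"
    and M :: "'w measure" and U :: "nat \<Rightarrow> 'w \<Rightarrow> cmat"
  defines "XA \<equiv> \<lambda>N. (\<lambda>x. case x of Inl i \<Rightarrow> A N i | Inr j \<Rightarrow> (\<lambda>_ _. 0)) :: var \<Rightarrow> cmat"
    and "YB \<equiv> \<lambda>N. (\<lambda>x. case x of Inl i \<Rightarrow> (\<lambda>_ _. 0) | Inr j \<Rightarrow> B N j) :: var \<Rightarrow> cmat"
    and "Z \<equiv> \<lambda>N \<omega>. (\<lambda>x. case x of Inl i \<Rightarrow> A N i
                     | Inr j \<Rightarrow> mmult N (mmult N (U N \<omega>) (B N j)) (adj (U N \<omega>))) :: var \<Rightarrow> cmat"
  assumes unit: "\<And>N. N \<ge> 1 \<Longrightarrow> unit_vec N (v N)"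
    and limA: "\<And>P. P \<in> ncpolys (Xvars k) \<Longrightarrow> (\<lambda>N. ntr N (poly_eval N (XA N) P)) \<longlonglongrightarrow> \<tau> P"
    and limAv: "\<And>P. P \<in> ncpolys (Xvars k) \<Longrightarrow> (\<lambda>N. vstate N (v N) (poly_eval N (XA N) P)) \<longlonglongrightarrow> \<phi> P"
    and limB: "\<And>P. P \<in> ncpolys (Yvars l) \<Longrightarrow> (\<lambda>N. ntr N (poly_eval N (YB N) P)) \<longlonglongrightarrow> \<tau> P"
    and prob: "prob_space M"
    and haar: "\<And>N. N \<ge> 1 \<Longrightarrow> haar_unitary M N (U N)"
  shows "(\<exists>\<tau>' \<phi>'.
           lin_on (ncpolys (Xvars k \<union> Yvars l)) \<tau>' \<and> lin_on (ncpolys (Xvars k \<union> Yvars l)) \<phi>' \<and>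
           (\<forall>P \<in> ncpolys (Xvars k) \<union> ncpolys (Yvars l). \<tau>' P = \<tau> P) \<and>
           (\<forall>P \<in> ncpolys (Xvars k). \<phi>' P = \<phi> P) \<and>
           (\<forall>P \<in> ncpolys (Xvars k \<union> Yvars l).
              (\<lambda>N. integral\<^sup>L M (\<lambda>\<omega>. ntr N (poly_eval N (Z N \<omega>) P))) \<longlonglongrightarrow> \<tau>' P) \<and>
           (\<forall>P \<in> ncpolys (Xvars k \<union> Yvars l).
              (\<lambda>N. integral\<^sup>L M (\<lambda>\<omega>. vstate N (v N) (poly_eval N (Z N \<omega>) P))) \<longlonglongrightarrow> \<phi>' P) \<and>
           cond_free (ncpolys (Xvars k)) (ncpolys (Yvars l)) \<tau>' \<phi>' \<and>
           (\<forall>P \<in> ncpolys (Yvars l). \<phi>' P = \<tau>' P) \<and>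
           ((\<forall>N i. i < k \<longrightarrow> selfadj_mat N (A N i)) \<and> (\<forall>N j. j < l \<longrightarrow> selfadj_mat N (B N j)) \<longrightarrow>
              (\<forall>P \<in> ncpolys (Xvars k \<union> Yvars l).
                 (AE \<omega> in M. (\<lambda>N. ntr N (poly_eval N (Z N \<omega>) P)) \<longlonglongrightarrow> \<tau>' P) \<and>
                 (AE \<omega> in M. (\<lambda>N. vstate N (v N) (poly_eval N (Z N \<omega>) P)) \<longlonglongrightarrow> \<phi>' P))))"
proof -
  have XA: "XA N = xeval (A N)" and YB: "YB N = yeval (B N)" for N
    by (simp_all add: XA_def YB_def xeval_def yeval_def)
  have Z: "Z N \<omega> = letters N (A N) (B N) (U N \<omega>)" for N \<omega>
    by (simp add: Z_def letters_def)
  interpret prob_space M by (rule prob)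
  interpret haar_model M k l A B v \<tau> \<phi> U
    using unit limA limAv limB haar unfolding XA YB by unfold_locales
  show ?thesis
    unfolding Z
  proof (rule exI[of _ tau], rule exI[of _ phi], intro conjI impI ballI)
    show "lin_on XY tau" "lin_on XY phi"
      using lin_on_plin by (simp_all add: tau_def[abs_def] phi_def[abs_def])
    show "tau P = \<tau> P" if "P \<in> Xp \<union> Yp" for P
      using that tau_extends_X tau_extends_Y by blast
    show "phi P = \<phi> P" if "P \<in> Xp" for P by (rule phi_extends_X[OF that])
    show "(\<lambda>N. expectation (\<lambda>\<omega>. ntr N (poly_eval N (letters N (A N) (B N) (U N \<omega>)) P))) \<longlonglongrightarrow> tau P" if "P \<in> XY" for P
      by (rule expectation_ntr_tendsto[OF that])
    show "(\<lambda>N. expectation (\<lambda>\<omega>. vstate N (v N) (poly_eval N (letters N (A N) (B N) (U N \<omega>)) P))) \<longlonglongrightarrow> phi P" if "P \<in> XY" for P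
      by (rule expectation_vstate_tendsto[OF that])
    show "cond_free Xp Yp tau phi" by (rule cond_free_tau_phi[OF t_mark])
    show "phi P = tau P" if "P \<in> Yp" for P by (rule phi_Y[OF that t_mark])
  next
    fix P assume sa: "(\<forall>N i. i < k \<longrightarrow> selfadj_mat N (A N i)) \<and> (\<forall>N j. j < l \<longrightarrow> selfadj_mat N (B N j))" and P: "P \<in> XY"
    show "AE \<omega> in M. (\<lambda>N. ntr N (poly_eval N (letters N (A N) (B N) (U N \<omega>)) P)) \<longlonglongrightarrow> tau P"
      using sa P by (intro AE_ntr_tendsto) auto
    show "AE \<omega> in M. (\<lambda>N. vstate N (v N) (poly_eval N (letters N (A N) (B N) (U N \<omega>)) P)) \<longlonglongrightarrow> phi P"
      using sa P by (intro AE_vstate_tendsto) auto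
  qed
qed

end
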